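(* Let $\mathbf{k}$ be a field, let $(C,D,\Omega)$ be a Cartan triple and let $H=H(C,D,\Omega)$ be the associated GLS algebra over $\mathbf{k}$. Then Han's conjecture holds for $H$: if the Hochschild homology groups $\mathrm{HH}_n(H)$ vanish for all sufficiently large $n$, then $H$ has finite global dimension.
   Context: A Cartan triple $(C,D,\Omega)$ consists of the following data. - $C=(c_{ij})\in M_n(\mathbb{Z})$ is a symmetrizable generalized Cartan matrix: $c_{ii}=2$ for all $i$; $c_{ij}\le 0$ for all $i\ne j$, and $c_{ij}=0$ if and only if $c_{ji}=0$; and there is a diagonal integer matrix $D=\mathrm{diag}(d_1,\dots,d_n)$ with all $d_i\ge 1$ such that $DC$ is symmetric. - $D$ is such a matrix (a symmetrizer of $C$). - $\Omega\subseteq\{1,\dots,n\}\times\{1,\dots,n\}$ is an orientation of $C$: $\{(i,j),(j,i)\}\cap\Omega\neq\emptyset$ if and only if $c_{ij}<0$; and for each sequence $(i_1,\dots,i_{t+1})$ with $t\ge 1$ and $(i_s,i_{s+1})\in\Omega$ for all $1\le s\le t$ one has $i_1\ne i_{t+1}$. The quiver $Q=Q(C,\Omega)$ has vertices $1,\dots,n$ and arrows $\alpha^{(g)}_{ij}:j\to i$ for $(i,j)\in\Omega$ and $1\le g\le\gcd(c_{ij},c_{ji})$ (the gcd taken positive), together with a loop $\varepsilon_i:i\to i$ for each $i$. Paths are composed from right to left. The GLS algebra is $H(C,D,\Omega)=\mathbf{k}Q/I$, where $I$ is the two-sided ideal generated by the relations - $\varepsilon_i^{d_i}=0$ for each vertex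 $i$; - $\varepsilon_i^{d_i/\gcd(d_i,d_j)}\alpha^{(g)}_{ij}=\alpha^{(g)}_{ij}\varepsilon_j^{d_j/\gcd(d_i,d_j)}$ for each $(i,j)\in\Omega$ and each $1\le g\le\gcd(c_{ij},c_{ji})$. Hochschild homology is over $\mathbf{k}$: $\mathrm{HH}_n(A)=\mathrm{Tor}_n^{A\otimes_{\mathbf k}A^{\mathrm{op}}}(A,A)$. *)

theory Defs
  imports
    "HOL-Algebra.QuotRing"
    "HOL-Algebra.Module"
    "HOL-Algebra.Elementary_Groups"
    "HOL-Algebra.Free_Abelian_Groups"
    "HOL-Algebra.Algebraic_Closure_Type"
    "HOL-Analysis.Finite_Cartesian_Product"
    "HOL-Library.Extended_Nat"
    "Graph_Theory.Arc_Walk"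
begin

section \<open>Cartan triples\<close>

definition generalized_cartan_matrix :: "int ^ 'n ^ 'n \<Rightarrow> bool" where
  "generalized_cartan_matrix C \<longleftrightarrow>
     (\<forall>i. C $ i $ i = 2) \<and>
     (\<forall>i j. i \<noteq> j \<longrightarrow> C $ i $ j \<le> 0) \<and>
     (\<forall>i j. i \<noteq> j \<longrightarrow> (C $ i $ j = 0 \<longleftrightarrow> C $ j $ i = 0))"

definition symmetrizer :: "int ^ 'n ^ 'n \<Rightarrow> int ^ 'n ^ 'n \<Rightarrow> bool" where
  "symmetrizer C D \<longleftrightarrow>
     (\<forall>i j. i \<noteq> j \<longrightarrow> D $ i $ j = 0) \<and>
     (\<forall>i. D $ i $ i \<ge> 1) \<and>
     transpose (D ** C) = D ** C"

definition orientation :: "int ^ 'n ^ 'n \<Rightarrow> ('n \<times> 'n) set \<Rightarrow> bool" where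
  "orientation C \<Omega> \<longleftrightarrow>
     (\<forall>i j. {(i, j), (j, i)} \<inter> \<Omega> \<noteq> {} \<longleftrightarrow> C $ i $ j < 0) \<and>
     (\<forall>t\<ge>1. \<forall>v :: nat \<Rightarrow> 'n. (\<forall>s\<in>{1..t}. (v s, v (s + 1)) \<in> \<Omega>) \<longrightarrow> v 1 \<noteq> v (t + 1))"

definition cartan_triple :: "int ^ 'n ^ 'n \<Rightarrow> int ^ 'n ^ 'n \<Rightarrow> ('n \<times> 'n) set \<Rightarrow> bool" where
  "cartan_triple C D \<Omega> \<longleftrightarrow>
     generalized_cartan_matrix C \<and> symmetrizer C D \<and> orientation C \<Omega>"


section \<open>Path algebras and their quotients\<close>

text \<open>
  Algebras over a field are records of type \<^typ>\<open>('k, 'a) module\<close>, which contain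
  both a ring structure and a scalar multiplication.

  A path of a quiver is a triple \<open>(u, p, v)\<close>, where the list \<open>p\<close> contains the arrows of the
  path from \<open>u\<close> to \<open>v\<close> in the order in which they are traversed; \<open>(u, [], u)\<close> is the
  trivial path at \<open>u\<close>. Paths are composed from right to left, so \<open>x y\<close> traverses \<open>y\<close> first
  and its list of arrows is that of \<open>y\<close> followed by that of \<open>x\<close>.
\<close>

type_synonym ('v, 'e) path = "'v \<times> 'e list \<times> 'v"

definition paths :: "('v, 'e) pre_digraph \<Rightarrow> ('v, 'e) path set" where
  "paths Q = {(u, p, v). pre_digraph.awalk Q u p v}"

definition path_mult ::
  "(('v, 'e) path \<Rightarrow>\<^sub>0 'k::field) \<Rightarrow> (('v, 'e) path \<Rightarrow>\<^sub>0 'k) \<Rightarrow> (('v, 'e) path \<Rightarrow>\<^sub>0 'k)" where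
  "path_mult f g =
     (\<Sum>x\<in>Poly_Mapping.keys f. \<Sum>y\<in>Poly_Mapping.keys g.
        case (x, y) of ((w, p, v), (u, q, w')) \<Rightarrow>
          if w = w'
          then Poly_Mapping.single (u, q @ p, v) (Poly_Mapping.lookup f x * Poly_Mapping.lookup g y)
          else 0)"

text \<open>The identity is the sum of the trivial paths, so this is meant for finitely many vertices.\<close>

definition path_algebra ::
  "('v, 'e) pre_digraph \<Rightarrow> ('k::field, ('v, 'e) path \<Rightarrow>\<^sub>0 'k) module" where
  "path_algebra Q =
     \<lparr>carrier = {f. Poly_Mapping.keys f \<subseteq> paths Q},
      monoid.mult = path_mult,
      one = (\<Sum>u\<in>verts Q. Poly_Mapping.single (u, [], u) 1),
      zero = 0,
      add = (+),
      module.smult = (\<lambda>c. Poly_Mapping.map ((*) c))\<rparr>"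

definition arrow_elem :: "('v, 'e) pre_digraph \<Rightarrow> 'e \<Rightarrow> ('v, 'e) path \<Rightarrow>\<^sub>0 'k::field" where
  "arrow_elem Q a = Poly_Mapping.single (tail Q a, [a], head Q a) 1"

definition quotient_algebra :: "('k, 'a) module \<Rightarrow> 'a set \<Rightarrow> ('k, 'a set) module" where
  "quotient_algebra A I =
     ring.extend (A Quot I)
       (module.fields (\<lambda>c S. \<Union>x\<in>S. I +>\<^bsub>A\<^esub> (c \<odot>\<^bsub>A\<^esub> x)))"


section \<open>GLS algebras\<close>

text \<open>\<open>Alpha i j g\<close> is the arrow \<open>\<alpha>\<^sub>i\<^sub>j\<^sup>(\<^sup>g\<^sup>) : j \<rightarrow> i\<close> and \<open>Eps i\<close> is the loop \<open>\<epsilon>\<^sub>i\<close>.\<close>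

datatype 'n gls_arrow = Alpha 'n 'n nat | Eps 'n

definition gls_alphas :: "int ^ 'n ^ 'n \<Rightarrow> ('n \<times> 'n) set \<Rightarrow> ('n \<times> 'n \<times> nat) set" where
  "gls_alphas C \<Omega> = {(i, j, g). (i, j) \<in> \<Omega> \<and> 1 \<le> g \<and> int g \<le> gcd (C $ i $ j) (C $ j $ i)}"

definition gls_quiver :: "int ^ 'n ^ 'n \<Rightarrow> ('n \<times> 'n) set \<Rightarrow> ('n, 'n gls_arrow) pre_digraph" where
  "gls_quiver C \<Omega> =
     \<lparr>verts = UNIV,
      arcs = range Eps \<union> {Alpha i j g | i j g. (i, j, g) \<in> gls_alphas C \<Omega>},
      tail = (\<lambda>a. case a of Alpha i j g \<Rightarrow> j | Eps i \<Rightarrow> i),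
      head = (\<lambda>a. case a of Alpha i j g \<Rightarrow> i | Eps i \<Rightarrow> i)\<rparr>"

definition gls_relations ::
  "int ^ 'n ^ 'n \<Rightarrow> int ^ 'n ^ 'n \<Rightarrow> ('n \<times> 'n) set \<Rightarrow> (('n, 'n gls_arrow) path \<Rightarrow>\<^sub>0 'k::field) set" where
  "gls_relations C D \<Omega> =
     (let Q = gls_quiver C \<Omega>;
          kQ = path_algebra Q;
          d = (\<lambda>i. nat (D $ i $ i));
          eps = (\<lambda>i. arrow_elem Q (Eps i));
          alpha = (\<lambda>i j g. arrow_elem Q (Alpha i j g))
      in {eps i [^]\<^bsub>kQ\<^esub> d i | i. True} \<union>
         {(eps i [^]\<^bsub>kQ\<^esub> (d i div gcd (d i) (d j))) \<otimes>\<^bsub>kQ\<^esub> alpha i j g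
            \<ominus>\<^bsub>kQ\<^esub> alpha i j g \<otimes>\<^bsub>kQ\<^esub> (eps j [^]\<^bsub>kQ\<^esub> (d j div gcd (d i) (d j)))
          | i j g. (i, j, g) \<in> gls_alphas C \<Omega>})"

definition gls_algebra ::
  "int ^ 'n ^ 'n \<Rightarrow> int ^ 'n ^ 'n \<Rightarrow> ('n \<times> 'n) set
     \<Rightarrow> ('k::field, (('n, 'n gls_arrow) path \<Rightarrow>\<^sub>0 'k) set) module" where
  "gls_algebra C D \<Omega> =
     (let kQ = path_algebra (gls_quiver C \<Omega>)
      in quotient_algebra kQ (Idl\<^bsub>kQ\<^esub> (gls_relations C D \<Omega>)))"


section \<open>Modules over noncommutative rings\<close>

text \<open>
  The library's \<open>module\<close> locale requires a commutative ring of scalars. Of a record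
  of type \<^typ>\<open>('r, 'm) module\<close> that is used as a module, the fields \<open>mult\<close> and \<open>one\<close> are ignored.
  Right modules are left modules over the opposite ring: \<open>smult M r x\<close> then stands for \<open>x r\<close>.
\<close>

locale left_module = R?: ring R + M?: abelian_group M
  for R :: "('r, 'b) ring_scheme" (structure) and M :: "('r, 'm) module" (structure) +
  assumes smult_closed [simp, intro]:
      "\<lbrakk>a \<in> carrier R; x \<in> carrier M\<rbrakk> \<Longrightarrow> a \<odot>\<^bsub>M\<^esub> x \<in> carrier M"
    and smult_l_distr:
      "\<lbrakk>a \<in> carrier R; b \<in> carrier R; x \<in> carrier M\<rbrakk> \<Longrightarrow>
       (a \<oplus>\<^bsub>R\<^esub> b) \<odot>\<^bsub>M\<^esub> x = a \<odot>\<^bsub>M\<^esub> x \<oplus>\<^bsub>M\<^esub> b \<odot>\<^bsub>M\<^esub> x"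
    and smult_r_distr:
      "\<lbrakk>a \<in> carrier R; x \<in> carrier M; y \<in> carrier M\<rbrakk> \<Longrightarrow>
       a \<odot>\<^bsub>M\<^esub> (x \<oplus>\<^bsub>M\<^esub> y) = a \<odot>\<^bsub>M\<^esub> x \<oplus>\<^bsub>M\<^esub> a \<odot>\<^bsub>M\<^esub> y"
    and smult_assoc1:
      "\<lbrakk>a \<in> carrier R; b \<in> carrier R; x \<in> carrier M\<rbrakk> \<Longrightarrow>
       (a \<otimes>\<^bsub>R\<^esub> b) \<odot>\<^bsub>M\<^esub> x = a \<odot>\<^bsub>M\<^esub> (b \<odot>\<^bsub>M\<^esub> x)"
    and smult_one [simp]:
      "x \<in> carrier M \<Longrightarrow> \<one>\<^bsub>R\<^esub> \<odot>\<^bsub>M\<^esub> x = x"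

definition opposite_ring :: "('a, 'b) ring_scheme \<Rightarrow> ('a, 'b) ring_scheme" where
  "opposite_ring R = R\<lparr>monoid.mult := \<lambda>x y. y \<otimes>\<^bsub>R\<^esub> x\<rparr>"

definition module_hom ::
  "('r, 'b) ring_scheme \<Rightarrow> ('r, 'm) module \<Rightarrow> ('r, 'n) module \<Rightarrow> ('m \<Rightarrow> 'n) set" where
  "module_hom R M N =
     {f \<in> carrier M \<rightarrow> carrier N.
        (\<forall>x\<in>carrier M. \<forall>y\<in>carrier M. f (x \<oplus>\<^bsub>M\<^esub> y) = f x \<oplus>\<^bsub>N\<^esub> f y) \<and>
        (\<forall>a\<in>carrier R. \<forall>x\<in>carrier M. f (a \<odot>\<^bsub>M\<^esub> x) = a \<odot>\<^bsub>N\<^esub> f x)}"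

text \<open>
  The lifting property is tested against modules whose elements have the same type \<open>'p\<close> as
  those of \<open>P\<close>. This is no restriction if \<open>'p\<close> is infinite and not smaller than \<open>'r\<close>: then, up
  to isomorphism, the free module on the set \<open>carrier P\<close> has its elements in \<open>'p\<close>, and the
  lifting property makes \<open>P\<close> a direct summand of it.
\<close>

definition projective_module :: "('r, 'b) ring_scheme \<Rightarrow> ('r, 'p) module \<Rightarrow> bool" where
  "projective_module R P \<longleftrightarrow>
     left_module R P \<and>
     (\<forall>(M :: ('r, 'p) module) (N :: ('r, 'p) module) f g.
        left_module R M \<and> left_module R N \<and>
        g \<in> module_hom R M N \<and> g ` carrier M = carrier N \<and> f \<in> module_hom R P N \<longrightarrow>
        (\<exists>h\<in>module_hom R P M. \<forall>x\<in>carrier P. g (h x) = f x))"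

text \<open>\<open>\<dots> \<rightarrow> P 2 \<rightarrow> P 1 \<rightarrow> P 0 \<rightarrow> M \<rightarrow> 0\<close> with differentials \<open>d n : P (n + 1) \<rightarrow> P n\<close> and
  augmentation \<open>\<epsilon> : P 0 \<rightarrow> M\<close>\<close>

definition projective_resolution ::
  "('r, 'b) ring_scheme \<Rightarrow> ('r, 'm) module \<Rightarrow>
     (nat \<Rightarrow> ('r, 'p) module) \<Rightarrow> (nat \<Rightarrow> 'p \<Rightarrow> 'p) \<Rightarrow> ('p \<Rightarrow> 'm) \<Rightarrow> bool" where
  "projective_resolution R M P d \<epsilon> \<longleftrightarrow>
     (\<forall>n. projective_module R (P n)) \<and>
     (\<forall>n. d n \<in> module_hom R (P (Suc n)) (P n)) \<and>
     \<epsilon> \<in> module_hom R (P 0) M \<and>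
     \<epsilon> ` carrier (P 0) = carrier M \<and>
     d 0 ` carrier (P 1) = a_kernel (P 0) M \<epsilon> \<and>
     (\<forall>n. d (Suc n) ` carrier (P (Suc (Suc n))) = a_kernel (P (Suc n)) (P n) (d n))"

text \<open>
  The elements of the modules in a resolution of a module over \<open>'m\<close> are taken from this type. It
  is large enough: every free module on a subset of \<^typ>\<open>('r + 'm) list\<close>, and each of its
  submodules, can be realised in it by functions of finite support. Starting with the free
  module on \<open>carrier M\<close>, the kernels that occur in the construction of a free resolution have
  at most as many elements as \<^typ>\<open>('r + 'm) list\<close>, so that every
  module over \<open>'m\<close> has a projective resolution in this type, of minimal length.
\<close>

type_synonym ('r, 'm) res = "('r + 'm) list \<Rightarrow> 'r"


section \<open>Global dimension\<close>

definition projective_dimension :: "('r, 'b) ring_scheme \<Rightarrow> ('r, 'm) module \<Rightarrow> enat" where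
  "projective_dimension R M =
     Inf {enat l | l. \<exists>(P :: nat \<Rightarrow> ('r, ('r, 'm) res) module) d \<epsilon>.
            projective_resolution R M P d \<epsilon> \<and> (\<forall>n>l. carrier (P n) = {\<zero>\<^bsub>P n\<^esub>})}"

text \<open>
  The supremum is over all left modules with elements in \<open>'m\<close>. All cyclic modules occur (up to
  isomorphism) for \<open>'m = 'r set\<close>, so by Auslander's theorem this already is the
  global dimension for that type.
\<close>

definition global_dimension :: "'m itself \<Rightarrow> ('r, 'b) ring_scheme \<Rightarrow> enat" where
  "global_dimension _ R =
     (SUP M\<in>{M :: ('r, 'm) module. left_module R M}. projective_dimension R M)"


section \<open>Tensor products and Tor\<close>

definition tensor_relations ::
  "('r, 'b) ring_scheme \<Rightarrow> ('r, 'x) module \<Rightarrow> ('r, 'y) module \<Rightarrow> ('x \<times> 'y \<Rightarrow>\<^sub>0 int) set" where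
  "tensor_relations R U V =
     {frag_of (x \<oplus>\<^bsub>U\<^esub> x', y) - frag_of (x, y) - frag_of (x', y)
        | x x' y. x \<in> carrier U \<and> x' \<in> carrier U \<and> y \<in> carrier V} \<union>
     {frag_of (x, y \<oplus>\<^bsub>V\<^esub> y') - frag_of (x, y) - frag_of (x, y')
        | x y y'. x \<in> carrier U \<and> y \<in> carrier V \<and> y' \<in> carrier V} \<union>
     {frag_of (r \<odot>\<^bsub>U\<^esub> x, y) - frag_of (x, r \<odot>\<^bsub>V\<^esub> y)
        | r x y. r \<in> carrier R \<and> x \<in> carrier U \<and> y \<in> carrier V}"

definition tensor_kernel ::
  "('r, 'b) ring_scheme \<Rightarrow> ('r, 'x) module \<Rightarrow> ('r, 'y) module \<Rightarrow> ('x \<times> 'y \<Rightarrow>\<^sub>0 int) set" where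
  "tensor_kernel R U V =
     generate (free_Abelian_group (carrier U \<times> carrier V)) (tensor_relations R U V)"

text \<open>\<open>U \<otimes>\<^sub>R V\<close> for a right module \<open>U\<close> and a left module \<open>V\<close>, as an abelian group (written
  multiplicatively in the library)\<close>

definition tensor ::
  "('r, 'b) ring_scheme \<Rightarrow> ('r, 'x) module \<Rightarrow> ('r, 'y) module \<Rightarrow> ('x \<times> 'y \<Rightarrow>\<^sub>0 int) set monoid" where
  "tensor R U V = free_Abelian_group (carrier U \<times> carrier V) Mod tensor_kernel R U V"

definition tensor_class ::
  "('r, 'b) ring_scheme \<Rightarrow> ('r, 'x) module \<Rightarrow> ('r, 'y) module \<Rightarrow>
     ('x \<times> 'y \<Rightarrow>\<^sub>0 int) \<Rightarrow> ('x \<times> 'y \<Rightarrow>\<^sub>0 int) set" where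
  "tensor_class R U V f =
     tensor_kernel R U V #>\<^bsub>free_Abelian_group (carrier U \<times> carrier V)\<^esub> f"

text \<open>The map \<open>U \<otimes> h : U \<otimes>\<^sub>R V \<rightarrow> U \<otimes>\<^sub>R W\<close> induced by \<open>h : V \<rightarrow> W\<close>\<close>

definition tensor_map ::
  "('r, 'b) ring_scheme \<Rightarrow> ('r, 'x) module \<Rightarrow> ('r, 'z) module \<Rightarrow> ('y \<Rightarrow> 'z) \<Rightarrow>
     ('x \<times> 'y \<Rightarrow>\<^sub>0 int) set \<Rightarrow> ('x \<times> 'z \<Rightarrow>\<^sub>0 int) set" where
  "tensor_map R U W h T =
     (\<Union>f\<in>T. tensor_class R U W (frag_extend (\<lambda>(x, y). frag_of (x, h y)) f))"

text \<open>The homology in degree \<open>n\<close> of the complex \<open>\<dots> \<rightarrow> U \<otimes>\<^sub>R P 1 \<rightarrow> U \<otimes>\<^sub>R P 0 \<rightarrow> 0\<close>\<close>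

definition tensor_homology ::
  "('r, 'b) ring_scheme \<Rightarrow> ('r, 'x) module \<Rightarrow> (nat \<Rightarrow> ('r, 'p) module) \<Rightarrow> (nat \<Rightarrow> 'p \<Rightarrow> 'p) \<Rightarrow>
     nat \<Rightarrow> ('x \<times> 'p \<Rightarrow>\<^sub>0 int) set set monoid" where
  "tensor_homology R U P d n =
     (let cycles = (case n of
            0 \<Rightarrow> carrier (tensor R U (P 0))
          | Suc m \<Rightarrow> kernel (tensor R U (P (Suc m))) (tensor R U (P m)) (tensor_map R U (P m) (d m)));
          boundaries = tensor_map R U (P n) (d n) ` carrier (tensor R U (P (Suc n)))
      in (tensor R U (P n))\<lparr>carrier := cycles\<rparr> Mod boundaries)"

text \<open>\<open>Tor\<^sub>n\<^sup>R(U, V)\<close> for a right module \<open>U\<close> and a left module \<open>V\<close>, computed from a chosen projective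
  resolution of \<open>V\<close>\<close>

definition chosen_resolution ::
  "('r, 'b) ring_scheme \<Rightarrow> ('r, 'y) module \<Rightarrow>
     (nat \<Rightarrow> ('r, ('r, 'y) res) module) \<times> (nat \<Rightarrow> ('r, 'y) res \<Rightarrow> ('r, 'y) res)" where
  "chosen_resolution R V = (SOME (P, d). \<exists>\<epsilon>. projective_resolution R V P d \<epsilon>)"

definition Tor ::
  "nat \<Rightarrow> ('r, 'b) ring_scheme \<Rightarrow> ('r, 'x) module \<Rightarrow> ('r, 'y) module \<Rightarrow>
     ('x \<times> ('r, 'y) res \<Rightarrow>\<^sub>0 int) set set monoid" where
  "Tor n R U V = (case chosen_resolution R V of (P, d) \<Rightarrow> tensor_homology R U P d n)"


section \<open>Hochschild homology\<close>

text \<open>\<open>A \<otimes>\<^sub>K B\<close> with the multiplication \<open>(a \<otimes> b) (a' \<otimes> b') = a a' \<otimes> b b'\<close>, for \<open>K\<close> commutative\<close>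

definition algebra_tensor ::
  "('k, 'c) ring_scheme \<Rightarrow> ('k, 'a) module \<Rightarrow> ('k, 'b) module \<Rightarrow> ('a \<times> 'b \<Rightarrow>\<^sub>0 int) set ring" where
  "algebra_tensor K A B =
     \<lparr>carrier = carrier (tensor K A B),
      monoid.mult = (\<lambda>S T. \<Union>f\<in>S. \<Union>g\<in>T. tensor_class K A B
        (frag_extend (\<lambda>(a, b). frag_extend (\<lambda>(a', b'). frag_of (a \<otimes>\<^bsub>A\<^esub> a', b \<otimes>\<^bsub>B\<^esub> b')) g) f)),
      one = tensor_class K A B (frag_of (\<one>\<^bsub>A\<^esub>, \<one>\<^bsub>B\<^esub>)),
      zero = one (tensor K A B),
      add = monoid.mult (tensor K A B)\<rparr>"

definition enveloping_algebra ::
  "('k, 'c) ring_scheme \<Rightarrow> ('k, 'a) module \<Rightarrow> ('a \<times> 'a \<Rightarrow>\<^sub>0 int) set ring" where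
  "enveloping_algebra K A = algebra_tensor K A (opposite_ring A)"

text \<open>The additive extension of \<open>h\<close> to formal sums\<close>

definition frag_eval :: "('a, 'b) ring_scheme \<Rightarrow> ('c \<Rightarrow> 'a) \<Rightarrow> ('c \<Rightarrow>\<^sub>0 int) \<Rightarrow> 'a" where
  "frag_eval A h f =
     (\<Oplus>\<^bsub>A\<^esub>p\<in>Poly_Mapping.keys f. [Poly_Mapping.lookup f p] \<cdot>\<^bsub>A\<^esub> h p)"

text \<open>
  \<open>A\<close> as a left and as a right module over its enveloping algebra:
  \<open>(a \<otimes> b) x = a x b\<close> and \<open>x (a \<otimes> b) = b x a\<close>. The image of a coset \<open>T\<close> of formal sums
  is a singleton, because the actions respect the relations of the tensor product.
\<close>

definition enveloping_left_module :: "('k, 'a) module \<Rightarrow> (('a \<times> 'a \<Rightarrow>\<^sub>0 int) set, 'a) module" where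
  "enveloping_left_module A =
     ring.extend (ring.truncate A)
       (module.fields (\<lambda>T x. the_elem (frag_eval A (\<lambda>(a, b). a \<otimes>\<^bsub>A\<^esub> x \<otimes>\<^bsub>A\<^esub> b) ` T)))"

definition enveloping_right_module :: "('k, 'a) module \<Rightarrow> (('a \<times> 'a \<Rightarrow>\<^sub>0 int) set, 'a) module" where
  "enveloping_right_module A =
     ring.extend (ring.truncate A)
       (module.fields (\<lambda>T x. the_elem (frag_eval A (\<lambda>(a, b). b \<otimes>\<^bsub>A\<^esub> x \<otimes>\<^bsub>A\<^esub> a) ` T)))"

definition hochschild_homology ::
  "('k, 'c) ring_scheme \<Rightarrow> ('k, 'a) module \<Rightarrow> nat \<Rightarrow>
     ('a \<times> (('a \<times> 'a \<Rightarrow>\<^sub>0 int) set, 'a) res \<Rightarrow>\<^sub>0 int) set set monoid" where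
  "hochschild_homology K A n =
     Tor n (enveloping_algebra K A) (enveloping_right_module A) (enveloping_left_module A)"

end

theory Submission
  imports Defs "HOL-Computational_Algebra.Formal_Power_Series"
begin

text \<open>
  If all \<open>d\<^sub>i\<close> are 1, the loops vanish in \<open>H\<close>, and since \<open>\<Omega>\<close> is acyclic the primitive idempotents make \<open>H\<close>
  triangular with corners \<open>k\<close>; then every module has a finite projective resolution, whatever the homology.

  Otherwise some \<open>d\<^sub>i \<ge> 2\<close>, and the truncated polynomial algebra \<open>B = k[X]/(X\<^bsup>d\<^sub>i\<^esup>)\<close> is a retract of \<open>H\<close>:
  \<open>X\<close> goes to \<open>\<epsilon>\<^sub>i\<close>, and all arrows except \<open>\<epsilon>\<^sub>i\<close> go to 0. The 2-periodic resolution of \<open>B\<close> is compared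
  with an arbitrary resolution of \<open>H\<close>: multiplication by the alternating elements \<open>x \<otimes> 1 - 1 \<otimes> x\<close> and
  \<open>\<Sum> x\<^sup>a \<otimes> x\<^sup>b\<close> (\<open>a + b = d\<^sub>i - 1\<close>) gives chains in the resolution, and on \<open>k[X]/(X\<^bsup>d\<^sub>i\<^esup>)\<close>, viewed as a bimodule on
  which \<open>X\<close> acts on the right by 0, the corresponding periodic complex detects that
  these chains give nonzero classes in every odd degree of the Hochschild homology.
\<close>

section \<open>Modules and projective resolutions\<close>

text \<open>The target of the comparison is the 2-periodic bimodule resolution of \<open>B\<close>
  with its right-hand variable set to 0: the two elements become multiplication by X and by X^(d-1),
  and the result is an exact complex resolving the simple module k. Since a projective resolution
  maps to any exact complex over its augmentation, the resolution of \<open>H\<close> may stay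
  arbitrary; the chains inside it come from its own exactness. Constant terms separate the two: 1
  and d - 1 are both positive because d >= 2, so multiplication in the target leaves no constant
  term and boundaries become invisible. Odd degrees are the safe ones. There the differential of the
  chain is the commutator element applied to it, and this element annihilates 1 in \<open>H\<close>;
  in positive even degrees the other element acts on 1 as d x^(d-1), which is nonzero unless the
  characteristic divides d. A second obstacle is the choice of types. A chosen resolution is
  meaningful only once some resolution with elements in \<open>res\<close> is found, and
  projectivity is tested within one element type. This is the reason for the encodings by lists and
  for the transport of modules along injections.\<close>

lemma left_moduleI:
  assumes "ring R" "abelian_group M"
    and "\<And>a x. \<lbrakk>a \<in> carrier R; x \<in> carrier M\<rbrakk> \<Longrightarrow> a \<odot>\<^bsub>M\<^esub> x \<in> carrier M"
    and "\<And>a b x. \<lbrakk>a \<in> carrier R; b \<in> carrier R; x \<in> carrier M\<rbrakk> \<Longrightarrow>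
       (a \<oplus>\<^bsub>R\<^esub> b) \<odot>\<^bsub>M\<^esub> x = a \<odot>\<^bsub>M\<^esub> x \<oplus>\<^bsub>M\<^esub> b \<odot>\<^bsub>M\<^esub> x"
    and "\<And>a x y. \<lbrakk>a \<in> carrier R; x \<in> carrier M; y \<in> carrier M\<rbrakk> \<Longrightarrow>
       a \<odot>\<^bsub>M\<^esub> (x \<oplus>\<^bsub>M\<^esub> y) = a \<odot>\<^bsub>M\<^esub> x \<oplus>\<^bsub>M\<^esub> a \<odot>\<^bsub>M\<^esub> y"
    and "\<And>a b x. \<lbrakk>a \<in> carrier R; b \<in> carrier R; x \<in> carrier M\<rbrakk> \<Longrightarrow>
       (a \<otimes>\<^bsub>R\<^esub> b) \<odot>\<^bsub>M\<^esub> x = a \<odot>\<^bsub>M\<^esub> (b \<odot>\<^bsub>M\<^esub> x)"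
    and "\<And>x. x \<in> carrier M \<Longrightarrow> \<one>\<^bsub>R\<^esub> \<odot>\<^bsub>M\<^esub> x = x"
  shows "left_module R M"
  using assms by (simp add: left_module_def left_module_axioms_def)

context left_module
begin

lemma smult_zero_left [simp]: "x \<in> carrier M \<Longrightarrow> \<zero>\<^bsub>R\<^esub> \<odot>\<^bsub>M\<^esub> x = \<zero>\<^bsub>M\<^esub>"
  by (metis M.add.r_cancel_one' R.l_zero R.zero_closed smult_closed smult_l_distr)

lemma smult_zero_right [simp]: "a \<in> carrier R \<Longrightarrow> a \<odot>\<^bsub>M\<^esub> \<zero>\<^bsub>M\<^esub> = \<zero>\<^bsub>M\<^esub>"
  by (metis M.add.r_cancel_one' M.l_zero M.zero_closed smult_closed smult_r_distr)

lemma smult_minus_left: "\<lbrakk>a \<in> carrier R; x \<in> carrier M\<rbrakk> \<Longrightarrow> (\<ominus>\<^bsub>R\<^esub> a) \<odot>\<^bsub>M\<^esub> x = \<ominus>\<^bsub>M\<^esub> (a \<odot>\<^bsub>M\<^esub> x)"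
  by (metis M.minus_equality R.add.inv_closed R.l_neg smult_closed smult_l_distr smult_zero_left)

lemma smult_diff_left:
  "\<lbrakk>a \<in> carrier R; b \<in> carrier R; x \<in> carrier M\<rbrakk> \<Longrightarrow> (a \<ominus>\<^bsub>R\<^esub> b) \<odot>\<^bsub>M\<^esub> x = a \<odot>\<^bsub>M\<^esub> x \<ominus>\<^bsub>M\<^esub> b \<odot>\<^bsub>M\<^esub> x"
  by (simp add: a_minus_def smult_l_distr smult_minus_left)

lemma smult_finsum:
  assumes "a \<in> carrier R" "f \<in> S \<rightarrow> carrier M"
  shows "a \<odot>\<^bsub>M\<^esub> finsum M f S = (\<Oplus>\<^bsub>M\<^esub>i\<in>S. a \<odot>\<^bsub>M\<^esub> f i)"
  using assms
proof (induction S rule: infinite_finite_induct)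
  case (insert x F)
  then have "f \<in> F \<rightarrow> carrier M" "f x \<in> carrier M" "(\<lambda>i. a \<odot>\<^bsub>M\<^esub> f i) \<in> F \<rightarrow> carrier M" by auto
  with insert show ?case by (simp add: smult_r_distr M.finsum_closed)
qed auto

lemma finsum_smult:
  assumes "x \<in> carrier M" "f \<in> S \<rightarrow> carrier R"
  shows "finsum R f S \<odot>\<^bsub>M\<^esub> x = (\<Oplus>\<^bsub>M\<^esub>i\<in>S. f i \<odot>\<^bsub>M\<^esub> x)"
  using assms
proof (induction S rule: infinite_finite_induct)
  case (insert y F)
  then have "f \<in> F \<rightarrow> carrier R" "f y \<in> carrier R" "(\<lambda>i. f i \<odot>\<^bsub>M\<^esub> x) \<in> F \<rightarrow> carrier M" by auto
  with insert show ?case by (simp add: smult_l_distr R.finsum_closed)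
qed auto

lemma submodule:
  assumes "S \<subseteq> carrier M" "\<zero>\<^bsub>M\<^esub> \<in> S"
    and add: "\<And>x y. \<lbrakk>x \<in> S; y \<in> S\<rbrakk> \<Longrightarrow> x \<oplus>\<^bsub>M\<^esub> y \<in> S"
    and sm: "\<And>a x. \<lbrakk>a \<in> carrier R; x \<in> S\<rbrakk> \<Longrightarrow> a \<odot>\<^bsub>M\<^esub> x \<in> S"
  shows "left_module R (M\<lparr>carrier := S\<rparr>)"
proof -
  have S: "x \<in> carrier M" if "x \<in> S" for x using assms that by blast
  have neg: "\<exists>y\<in>S. y \<oplus>\<^bsub>M\<^esub> x = \<zero>\<^bsub>M\<^esub>" if "x \<in> S" for x
  proof
    have "(\<ominus>\<^bsub>R\<^esub> \<one>\<^bsub>R\<^esub>) \<odot>\<^bsub>M\<^esub> x = \<ominus>\<^bsub>M\<^esub> x" using smult_minus_left[of "\<one>\<^bsub>R\<^esub>" x] S that by simp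
    then show "(\<ominus>\<^bsub>R\<^esub> \<one>\<^bsub>R\<^esub>) \<odot>\<^bsub>M\<^esub> x \<oplus>\<^bsub>M\<^esub> x = \<zero>\<^bsub>M\<^esub>" using S that by (simp add: M.l_neg)
    show "(\<ominus>\<^bsub>R\<^esub> \<one>\<^bsub>R\<^esub>) \<odot>\<^bsub>M\<^esub> x \<in> S" using sm that by simp
  qed
  have "abelian_group (M\<lparr>carrier := S\<rparr>)"
    using assms neg by (intro abelian_groupI) (auto simp: S M.add.m_ac subset_eq)
  then show ?thesis
    using sm by (intro left_moduleI) (auto simp: S smult_l_distr smult_r_distr smult_assoc1 R.ring_axioms)
qed

end

lemma module_hom_closed: "f \<in> module_hom R M N \<Longrightarrow> x \<in> carrier M \<Longrightarrow> f x \<in> carrier N"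
  by (auto simp: module_hom_def)

lemma module_hom_add:
  "f \<in> module_hom R M N \<Longrightarrow> x \<in> carrier M \<Longrightarrow> y \<in> carrier M \<Longrightarrow> f (x \<oplus>\<^bsub>M\<^esub> y) = f x \<oplus>\<^bsub>N\<^esub> f y"
  by (auto simp: module_hom_def)

lemma module_hom_smult:
  "f \<in> module_hom R M N \<Longrightarrow> a \<in> carrier R \<Longrightarrow> x \<in> carrier M \<Longrightarrow> f (a \<odot>\<^bsub>M\<^esub> x) = a \<odot>\<^bsub>N\<^esub> f x"
  by (auto simp: module_hom_def)

lemma module_homI:
  assumes "\<And>x. x \<in> carrier M \<Longrightarrow> f x \<in> carrier N"
    and "\<And>x y. \<lbrakk>x \<in> carrier M; y \<in> carrier M\<rbrakk> \<Longrightarrow> f (x \<oplus>\<^bsub>M\<^esub> y) = f x \<oplus>\<^bsub>N\<^esub> f y"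
    and "\<And>a x. \<lbrakk>a \<in> carrier R; x \<in> carrier M\<rbrakk> \<Longrightarrow> f (a \<odot>\<^bsub>M\<^esub> x) = a \<odot>\<^bsub>N\<^esub> f x"
  shows "f \<in> module_hom R M N"
  using assms by (auto simp: module_hom_def)

lemma module_hom_zero:
  assumes "left_module R M" "left_module R N" "f \<in> module_hom R M N"
  shows "f \<zero>\<^bsub>M\<^esub> = \<zero>\<^bsub>N\<^esub>"
proof -
  interpret M: left_module R M by fact
  interpret N: left_module R N by fact
  show ?thesis
    using module_hom_smult[OF assms(3), of "\<zero>\<^bsub>R\<^esub>" "\<zero>\<^bsub>M\<^esub>"] module_hom_closed[OF assms(3), of "\<zero>\<^bsub>M\<^esub>"] by simp
qed

lemma module_hom_comp:
  "f \<in> module_hom R M N \<Longrightarrow> g \<in> module_hom R N L \<Longrightarrow> (\<lambda>x. g (f x)) \<in> module_hom R M L"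
  by (auto simp: module_hom_def Pi_def)

lemma kernel_module:
  assumes "left_module R M" "left_module R N" "f \<in> module_hom R M N"
  shows "left_module R (M\<lparr>carrier := a_kernel M N f\<rparr>)"
proof -
  interpret M: left_module R M by fact
  interpret N: left_module R N by fact
  show ?thesis
    using assms(3) by (intro M.submodule)
      (auto simp: a_kernel_def' module_hom_zero[OF assms] module_hom_add module_hom_smult)
qed

lemma projective_moduleD: "projective_module R P \<Longrightarrow> left_module R P"
  by (simp add: projective_module_def)

text \<open>Splices covers into a resolution. \<open>G n\<close> is an invariant of the kernel in
  degree \<open>n\<close> that makes the next cover possible, and \<open>Z\<close> collects what is
  known about the terms of positive degree. The first cover is separate because \<open>M\<close> has
  elements in \<open>'m\<close>, while all later kernels have elements in \<open>'p\<close>.\<close>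

lemma projective_resolution_step:
  fixes M :: "('r, 'm) module" and G :: "nat \<Rightarrow> ('r, 'p) module \<Rightarrow> bool"
  assumes M: "left_module R M"
    and base: "\<exists>P \<epsilon>. projective_module R P \<and> \<epsilon> \<in> module_hom R P M \<and> \<epsilon> ` carrier P = carrier M \<and>
       G 0 (P\<lparr>carrier := a_kernel P M \<epsilon>\<rparr>)"
    and step: "\<And>n K. left_module R K \<Longrightarrow> G n K \<Longrightarrow> \<exists>P \<epsilon>. projective_module R P \<and>
       \<epsilon> \<in> module_hom R P K \<and> \<epsilon> ` carrier P = carrier K \<and>
       G (Suc n) (P\<lparr>carrier := a_kernel P K \<epsilon>\<rparr>) \<and> Z (Suc n) P"
  obtains P \<epsilon> and d :: "nat \<Rightarrow> 'p \<Rightarrow> 'p"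
  where "projective_resolution R M P d \<epsilon>" "\<And>n. n > 0 \<Longrightarrow> Z n (P n)"
proof -
  obtain P0 \<epsilon> where P0: "projective_module R P0" "\<epsilon> \<in> module_hom R P0 M" "\<epsilon> ` carrier P0 = carrier M"
     "G 0 (P0\<lparr>carrier := a_kernel P0 M \<epsilon>\<rparr>)" using base by blast
  \<comment> \<open>A state consists of a term, the kernel that the next term has to cover, and the
    differential leaving the term, which is a dummy in degree 0. The clause for \<open>n = 0\<close>
    ties the chosen sequence to the given first cover.\<close>
  define Inv where "Inv = (\<lambda>n (P :: ('r, 'p) module, S, \<delta> :: 'p \<Rightarrow> 'p). projective_module R P \<and> left_module R (P\<lparr>carrier := S\<rparr>)
     \<and> S \<subseteq> carrier P \<and> G n (P\<lparr>carrier := S\<rparr>) \<and> (n = 0 \<longrightarrow> P = P0 \<and> S = a_kernel P0 M \<epsilon>))"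
  define Rel where "Rel = (\<lambda>n (P :: ('r, 'p) module, S, \<delta> :: 'p \<Rightarrow> 'p) (P' :: ('r, 'p) module, S', \<delta>' :: 'p \<Rightarrow> 'p). \<delta>' \<in> module_hom R P' (P\<lparr>carrier := S\<rparr>) \<and>
     \<delta>' ` carrier P' = S \<and> S' = a_kernel P' P \<delta>' \<and> Z (Suc n) P')"
  have "\<exists>f. \<forall>n. Inv n (f n) \<and> Rel n (f n) (f (Suc n))"
  proof (rule dependent_nat_choice)
    have "left_module R (P0\<lparr>carrier := a_kernel P0 M \<epsilon>\<rparr>)"
      using P0 M by (intro kernel_module) (auto dest: projective_moduleD)
    then show "\<exists>x. Inv 0 x"
      using P0 by (intro exI[of _ "(P0, a_kernel P0 M \<epsilon>, undefined)"]) (auto simp: Inv_def a_kernel_def')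
  next
    fix x n assume I: "Inv n x"
    obtain P S \<delta> where x: "x = (P, S, \<delta>)" by (cases x)
    have K: "left_module R (P\<lparr>carrier := S\<rparr>)" "G n (P\<lparr>carrier := S\<rparr>)" using I by (auto simp: Inv_def x)
    from step[OF this] obtain P' \<epsilon>' where P': "projective_module R P'"
       "\<epsilon>' \<in> module_hom R P' (P\<lparr>carrier := S\<rparr>)" "\<epsilon>' ` carrier P' = S"
       "G (Suc n) (P'\<lparr>carrier := a_kernel P' (P\<lparr>carrier := S\<rparr>) \<epsilon>'\<rparr>)" "Z (Suc n) P'" by auto
    have "left_module R (P'\<lparr>carrier := a_kernel P' (P\<lparr>carrier := S\<rparr>) \<epsilon>'\<rparr>)"
      using P' K by (intro kernel_module) (auto dest: projective_moduleD)
    then show "\<exists>y. Inv (Suc n) y \<and> Rel n x y"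
      using P' by (intro exI[of _ "(P', a_kernel P' P \<epsilon>', \<epsilon>')"]) (auto simp: Inv_def Rel_def x a_kernel_def')
  qed
  then obtain f where f: "\<And>n. Inv n (f n)" "\<And>n. Rel n (f n) (f (Suc n))" by blast
  define P where "P = (\<lambda>n. fst (f n))"
  define S where "S = (\<lambda>n. fst (snd (f n)))"
  define d where "d = (\<lambda>n. snd (snd (f (Suc n))))"
  have I: "projective_module R (P n)" "S n \<subseteq> carrier (P n)" for n
    using f(1)[of n] by (auto simp: Inv_def P_def S_def split: prod.splits)
  have z: "P 0 = P0" "S 0 = a_kernel P0 M \<epsilon>" using f(1)[of 0] by (auto simp: Inv_def P_def S_def)
  have R: "d n \<in> module_hom R (P (Suc n)) (P n\<lparr>carrier := S n\<rparr>)" "d n ` carrier (P (Suc n)) = S n"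
    "S (Suc n) = a_kernel (P (Suc n)) (P n) (d n)" "Z (Suc n) (P (Suc n))" for n
    using f(2)[of n] by (auto simp: Rel_def P_def S_def d_def split: prod.splits)
  have dh: "d n \<in> module_hom R (P (Suc n)) (P n)" for n
    using R(1)[of n] I(2)[of n] by (auto simp: module_hom_def)
  have "projective_resolution R M P d \<epsilon>"
    using I(1) dh P0 R(2,3) z by (simp add: projective_resolution_def)
  moreover have "Z n (P n)" if "n > 0" for n using R(4)[of "n - 1"] that by simp
  ultimately show ?thesis using that by blast
qed

section \<open>Direct sums of projectives generated by idempotents\<close>

text \<open>
  Finitely supported families \<open>f\<close> with \<open>f b\<close> in the left ideal generated by the idempotent \<open>e b\<close>;
  this is the direct sum of the projective modules \<open>R (e b)\<close>.
\<close>

definition family_module :: "('r, 'b) ring_scheme \<Rightarrow> 'i set \<Rightarrow> ('i \<Rightarrow> 'r) \<Rightarrow> ('r, 'i \<Rightarrow> 'r) module" where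
  "family_module R B e =
    \<lparr>carrier = {f. finite {b. f b \<noteq> \<zero>\<^bsub>R\<^esub>} \<and> (\<forall>b\<in>B. f b \<in> carrier R \<and> f b \<otimes>\<^bsub>R\<^esub> e b = f b) \<and>
       (\<forall>b. b \<notin> B \<longrightarrow> f b = \<zero>\<^bsub>R\<^esub>)},
     monoid.mult = undefined, one = undefined, zero = (\<lambda>_. \<zero>\<^bsub>R\<^esub>),
     add = (\<lambda>f g b. f b \<oplus>\<^bsub>R\<^esub> g b), module.smult = (\<lambda>r f b. r \<otimes>\<^bsub>R\<^esub> f b)\<rparr>"

definition family_unit :: "('r, 'b) ring_scheme \<Rightarrow> ('i \<Rightarrow> 'r) \<Rightarrow> 'i \<Rightarrow> 'i \<Rightarrow> 'r" where
  "family_unit R e b = (\<lambda>c. if c = b then e b else \<zero>\<^bsub>R\<^esub>)"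

definition family_eval :: "('r, 'b) ring_scheme \<Rightarrow> ('r, 'n) module \<Rightarrow> ('i \<Rightarrow> 'n) \<Rightarrow> ('i \<Rightarrow> 'r) \<Rightarrow> 'n" where
  "family_eval R N v f = (\<Oplus>\<^bsub>N\<^esub>b\<in>{b. f b \<noteq> \<zero>\<^bsub>R\<^esub>}. f b \<odot>\<^bsub>N\<^esub> v b)"

locale idempotent_family = ring R for R (structure) +
  fixes B :: "'i set" and e :: "'i \<Rightarrow> 'a"
  assumes e_closed: "\<And>b. b \<in> B \<Longrightarrow> e b \<in> carrier R"
    and e_idem: "\<And>b. b \<in> B \<Longrightarrow> e b \<otimes> e b = e b"
begin

abbreviation "F \<equiv> family_module R B e"

lemma family_carrier:
  "f \<in> carrier F \<longleftrightarrow> finite {b. f b \<noteq> \<zero>} \<and> (\<forall>b\<in>B. f b \<in> carrier R \<and> f b \<otimes> e b = f b) \<and>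
       (\<forall>b. b \<notin> B \<longrightarrow> f b = \<zero>)"
  by (simp add: family_module_def)

lemma family_val: "f \<in> carrier F \<Longrightarrow> f b \<in> carrier R"
  by (cases "b \<in> B") (auto simp: family_carrier)

lemma family_ops:
  "\<zero>\<^bsub>F\<^esub> = (\<lambda>_. \<zero>)" "f \<oplus>\<^bsub>F\<^esub> g = (\<lambda>b. f b \<oplus> g b)" "r \<odot>\<^bsub>F\<^esub> f = (\<lambda>b. r \<otimes> f b)"
  by (auto simp: family_module_def)

lemma family_left_module: "left_module R F"
proof -
  have add: "f \<oplus>\<^bsub>F\<^esub> g \<in> carrier F" if "f \<in> carrier F" "g \<in> carrier F" for f g
  proof -
    have "finite {b. f b \<oplus> g b \<noteq> \<zero>}"
      by (rule finite_subset[of _ "{b. f b \<noteq> \<zero>} \<union> {b. g b \<noteq> \<zero>}"]) (use that in \<open>auto simp: family_carrier\<close>)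
    then show ?thesis using that e_closed by (auto simp: family_carrier family_ops l_distr)
  qed
  have sm: "r \<odot>\<^bsub>F\<^esub> f \<in> carrier F" if "f \<in> carrier F" "r \<in> carrier R" for r f
  proof -
    have "finite {b. r \<otimes> f b \<noteq> \<zero>}"
      by (rule finite_subset[of _ "{b. f b \<noteq> \<zero>}"]) (use that in \<open>auto simp: family_carrier\<close>)
    then show ?thesis using that e_closed by (auto simp: family_carrier family_ops m_assoc)
  qed
  have "\<exists>g\<in>carrier F. g \<oplus>\<^bsub>F\<^esub> f = \<zero>\<^bsub>F\<^esub>" if "f \<in> carrier F" for f
  proof (rule bexI)
    show "(\<ominus> \<one>) \<odot>\<^bsub>F\<^esub> f \<in> carrier F" using sm that by simp
    show "(\<ominus> \<one>) \<odot>\<^bsub>F\<^esub> f \<oplus>\<^bsub>F\<^esub> f = \<zero>\<^bsub>F\<^esub>" using family_val[OF that] by (auto simp: family_ops l_neg l_minus)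
  qed
  then have "abelian_group F"
    using add family_val e_closed
    by (intro abelian_groupI) (auto simp: family_ops add.m_ac fun_eq_iff, auto simp: family_carrier)
  then show ?thesis
    using sm add family_val by (intro left_moduleI) (auto simp: ring_axioms family_ops l_distr r_distr m_assoc)
qed

lemma family_unit_closed: "b \<in> B \<Longrightarrow> family_unit R e b \<in> carrier F"
  using e_closed e_idem by (auto simp: family_carrier family_unit_def)

lemma family_eval_superset:
  assumes "left_module R N" "f \<in> carrier F" "v \<in> B \<rightarrow> carrier N" "finite S" "{b. f b \<noteq> \<zero>} \<subseteq> S" "S \<subseteq> B"
  shows "family_eval R N v f = (\<Oplus>\<^bsub>N\<^esub>b\<in>S. f b \<odot>\<^bsub>N\<^esub> v b)"
proof -
  interpret N: left_module R N by fact
  show ?thesis unfolding family_eval_def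
    using assms family_val by (intro N.add.finprod_mono_neutral_cong_left) (auto simp: Pi_def subset_eq)
qed

lemma family_supp_subset: "f \<in> carrier F \<Longrightarrow> {b. f b \<noteq> \<zero>} \<subseteq> B"
  by (auto simp: family_carrier)

lemma family_eval_hom:
  assumes N: "left_module R N" and v: "v \<in> B \<rightarrow> carrier N"
  shows "family_eval R N v \<in> module_hom R F N"
proof -
  interpret N: left_module R N by fact
  interpret F: left_module R F by (rule family_left_module)
  have cl: "f b \<odot>\<^bsub>N\<^esub> v b \<in> carrier N" if "f \<in> carrier F" "b \<in> B" for f b using that family_val v by auto
  show ?thesis
  proof (rule module_homI)
    fix f assume "f \<in> carrier F"
    then show "family_eval R N v f \<in> carrier N"
      unfolding family_eval_def using family_supp_subset cl by (intro N.finsum_closed) auto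
  next
    fix f g assume f: "f \<in> carrier F" and g: "g \<in> carrier F"
    let ?S = "{b. f b \<noteq> \<zero>} \<union> {b. g b \<noteq> \<zero>}"
    have S: "finite ?S" "?S \<subseteq> B" using f g by (auto simp: family_carrier)
    have 1: "(\<lambda>b. f b \<odot>\<^bsub>N\<^esub> v b) \<in> ?S \<rightarrow> carrier N" "(\<lambda>b. g b \<odot>\<^bsub>N\<^esub> v b) \<in> ?S \<rightarrow> carrier N"
      using cl[OF f] cl[OF g] S(2) by blast+
    have "family_eval R N v (f \<oplus>\<^bsub>F\<^esub> g) = (\<Oplus>\<^bsub>N\<^esub>b\<in>?S. (f \<oplus>\<^bsub>F\<^esub> g) b \<odot>\<^bsub>N\<^esub> v b)"
      using S by (intro family_eval_superset N v F.M.add.m_closed f g) (auto simp: family_ops)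
    also have "\<dots> = (\<Oplus>\<^bsub>N\<^esub>b\<in>?S. f b \<odot>\<^bsub>N\<^esub> v b \<oplus>\<^bsub>N\<^esub> g b \<odot>\<^bsub>N\<^esub> v b)"
      using family_val[OF f] family_val[OF g] S v 1
      by (intro N.finsum_cong' refl) (auto simp: family_ops Pi_def intro!: N.smult_l_distr)
    also have "\<dots> = (\<Oplus>\<^bsub>N\<^esub>b\<in>?S. f b \<odot>\<^bsub>N\<^esub> v b) \<oplus>\<^bsub>N\<^esub> (\<Oplus>\<^bsub>N\<^esub>b\<in>?S. g b \<odot>\<^bsub>N\<^esub> v b)"
      using 1 by (intro N.finsum_addf)
    also have "\<dots> = family_eval R N v f \<oplus>\<^bsub>N\<^esub> family_eval R N v g"
      using f g S by (intro arg_cong2[of _ _ _ _ "add N"] family_eval_superset[symmetric] N v) auto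
    finally show "family_eval R N v (f \<oplus>\<^bsub>F\<^esub> g) = family_eval R N v f \<oplus>\<^bsub>N\<^esub> family_eval R N v g" .
  next
    fix r f assume r: "r \<in> carrier R" and f: "f \<in> carrier F"
    let ?S = "{b. f b \<noteq> \<zero>}"
    have S: "finite ?S" "?S \<subseteq> B" using f by (auto simp: family_carrier)
    have "family_eval R N v (r \<odot>\<^bsub>F\<^esub> f) = (\<Oplus>\<^bsub>N\<^esub>b\<in>?S. (r \<odot>\<^bsub>F\<^esub> f) b \<odot>\<^bsub>N\<^esub> v b)"
      using r S by (intro family_eval_superset N v F.smult_closed f) (auto simp: family_ops)
    also have "\<dots> = (\<Oplus>\<^bsub>N\<^esub>b\<in>?S. r \<odot>\<^bsub>N\<^esub> (f b \<odot>\<^bsub>N\<^esub> v b))"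
      using family_val[OF f] r S v by (intro N.finsum_cong' refl) (auto simp: family_ops Pi_def intro!: N.smult_assoc1)
    also have "\<dots> = r \<odot>\<^bsub>N\<^esub> family_eval R N v f"
      unfolding family_eval_def using r S cl[OF f] by (intro N.smult_finsum[symmetric]) auto
    finally show "family_eval R N v (r \<odot>\<^bsub>F\<^esub> f) = r \<odot>\<^bsub>N\<^esub> family_eval R N v f" .
  qed
qed

lemma family_eval_unit:
  assumes N: "left_module R N" and v: "v \<in> B \<rightarrow> carrier N" and b: "b \<in> B"
  shows "family_eval R N v (family_unit R e b) = e b \<odot>\<^bsub>N\<^esub> v b"
proof -
  interpret N: left_module R N by fact
  have "e b \<odot>\<^bsub>N\<^esub> v b \<in> carrier N" using v b e_closed by auto
  moreover have "family_eval R N v (family_unit R e b) = (\<Oplus>\<^bsub>N\<^esub>c\<in>{b}. family_unit R e b c \<odot>\<^bsub>N\<^esub> v c)"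
    using b by (intro family_eval_superset N v family_unit_closed) (auto simp: family_unit_def)
  ultimately show ?thesis by (simp add: family_unit_def)
qed

lemma family_hom_eqI:
  assumes N: "left_module R N" and h: "h \<in> module_hom R F N" "h' \<in> module_hom R F N"
    and eq: "\<And>b. b \<in> B \<Longrightarrow> h (family_unit R e b) = h' (family_unit R e b)" and f: "f \<in> carrier F"
  shows "h f = h' f"
proof -
  interpret F: left_module R F by (rule family_left_module)
  have "\<forall>f\<in>carrier F. {b. f b \<noteq> \<zero>} \<subseteq> S \<longrightarrow> h f = h' f" if "finite S" for S
    using that
  proof (induction S rule: finite_induct)
    case empty
    have "f = \<zero>\<^bsub>F\<^esub>" if "{b. f b \<noteq> \<zero>} \<subseteq> {}" for f using that by (auto simp: family_ops)
    then show ?case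
      using module_hom_zero[OF family_left_module N h(1)] module_hom_zero[OF family_left_module N h(2)] by metis
  next
    case (insert b S)
    show ?case
    proof safe
      fix f assume f: "f \<in> carrier F" "{b. f b \<noteq> \<zero>} \<subseteq> insert b S"
      define g where "g = f(b := \<zero>)"
      show "h f = h' f"
      proof (cases "b \<in> B")
        case b: True
        have "{b. g b \<noteq> \<zero>} \<subseteq> {b. f b \<noteq> \<zero>}" by (auto simp: g_def)
        then have "finite {b. g b \<noteq> \<zero>}" using f(1) finite_subset unfolding family_carrier by blast
        then have g: "g \<in> carrier F" "{b. g b \<noteq> \<zero>} \<subseteq> S"
          using f e_closed by (auto simp: g_def family_carrier)
        have u: "family_unit R e b \<in> carrier F" using b by (rule family_unit_closed)
        have "f = g \<oplus>\<^bsub>F\<^esub> f b \<odot>\<^bsub>F\<^esub> family_unit R e b"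
          using f(1) family_val[OF f(1)] b by (auto simp: family_ops g_def family_unit_def family_carrier)
        moreover have "h (g \<oplus>\<^bsub>F\<^esub> f b \<odot>\<^bsub>F\<^esub> family_unit R e b) = h' (g \<oplus>\<^bsub>F\<^esub> f b \<odot>\<^bsub>F\<^esub> family_unit R e b)"
          using g u family_val[OF f(1)] insert.IH eq[OF b]
          by (simp add: module_hom_add[OF h(1)] module_hom_add[OF h(2)] module_hom_smult[OF h(1)] module_hom_smult[OF h(2)])
        ultimately show ?thesis by simp
      next
        case False
        then have "{b. f b \<noteq> \<zero>} \<subseteq> S" using f by (auto simp: family_carrier)
        then show ?thesis using insert.IH f by blast
      qed
    qed
  qed
  then show ?thesis using f by (auto simp: family_carrier)
qed

text \<open>A preimage \<open>v b\<close> of the image of a unit need not be fixed by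
  \<open>e b\<close>. \<open>family_eval\<close> multiplies it by \<open>e b\<close>, and the
  product is still a preimage because the unit itself is fixed by \<open>e b\<close>.\<close>

lemma family_projective: "projective_module R F"
  unfolding projective_module_def
proof (intro conjI allI impI family_left_module, elim conjE)
  fix M N :: "('a, 'i \<Rightarrow> 'a) module" and f g
  assume M: "left_module R M" and N: "left_module R N" and g: "g \<in> module_hom R M N"
    and surj: "g ` carrier M = carrier N" and f: "f \<in> module_hom R F N"
  interpret M: left_module R M by fact
  interpret N: left_module R N by fact
  have "\<forall>b\<in>B. \<exists>m. m \<in> carrier M \<and> g m = f (family_unit R e b)"
    using surj module_hom_closed[OF f family_unit_closed] by (metis imageE)
  then obtain v where v: "\<And>b. b \<in> B \<Longrightarrow> v b \<in> carrier M \<and> g (v b) = f (family_unit R e b)" by metis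
  then have v': "v \<in> B \<rightarrow> carrier M" by auto
  let ?h = "family_eval R M v"
  have h: "?h \<in> module_hom R F M" by (rule family_eval_hom[OF M v'])
  show "\<exists>h\<in>module_hom R F M. \<forall>x\<in>carrier F. g (h x) = f x"
  proof (intro bexI[OF _ h] ballI)
    fix x assume x: "x \<in> carrier F"
    show "g (?h x) = f x"
    proof (rule family_hom_eqI[OF N module_hom_comp[OF h g] f _ x])
      fix b assume b: "b \<in> B"
      have "g (?h (family_unit R e b)) = e b \<odot>\<^bsub>N\<^esub> f (family_unit R e b)"
        using v[OF b] e_closed[OF b] by (simp add: family_eval_unit[OF M v' b] module_hom_smult[OF g])
      also have "\<dots> = f (e b \<odot>\<^bsub>F\<^esub> family_unit R e b)"
        using family_unit_closed[OF b] e_closed[OF b] by (simp add: module_hom_smult[OF f])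
      also have "e b \<odot>\<^bsub>F\<^esub> family_unit R e b = family_unit R e b"
        using e_closed[OF b] e_idem[OF b] by (auto simp: family_ops family_unit_def)
      finally show "g (?h (family_unit R e b)) = f (family_unit R e b)" .
    qed
  qed
qed

end

section \<open>Resolutions inside the prescribed element type\<close>

text \<open>
  An injection of lists of pairs into lists: every entry of a first component is preceded by \<open>Inl\<close>, and an
  \<open>Inr\<close> closes it and announces the second component.
\<close>

fun encode_pairs :: "(('r + 'm) list \<times> 'r) list \<Rightarrow> ('r + 'm) list" where
  "encode_pairs [] = []"
| "encode_pairs (([], r) # xs) = Inr undefined # Inl r # encode_pairs xs"
| "encode_pairs ((z # l, r) # xs) = Inl undefined # z # encode_pairs ((l, r) # xs)"

lemma encode_pairs_inj: "encode_pairs xs = encode_pairs ys \<Longrightarrow> xs = ys"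
proof (induction xs arbitrary: ys rule: encode_pairs.induct)
  case 1
  then show ?case by (cases ys rule: encode_pairs.cases) auto
next
  case (2 r xs)
  then show ?case by (cases ys rule: encode_pairs.cases) auto
next
  case (3 z l r xs)
  then show ?case by (cases ys rule: encode_pairs.cases) fastforce+
qed

text \<open>A function of finite support is determined by the finite set of its nonzero entries; any
  listing of that set, encoded as one list, identifies it. Thus the elements of a kernel can index
  the basis of the next free module.\<close>

lemma finite_support_encoding:
  fixes z :: 'r and K :: "(('r, 'm) res) set"
  assumes "\<And>f. f \<in> K \<Longrightarrow> finite {b. f b \<noteq> z}"
  shows "\<exists>j :: ('r, 'm) res \<Rightarrow> ('r + 'm) list. inj_on j K"
proof -
  have "\<forall>f\<in>K. \<exists>xs. set xs = {(b, f b) | b. f b \<noteq> z}"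
  proof
    fix f assume "f \<in> K"
    then have "finite ((\<lambda>b. (b, f b)) ` {b. f b \<noteq> z})" using assms by blast
    moreover have "(\<lambda>b. (b, f b)) ` {b. f b \<noteq> z} = {(b, f b) | b. f b \<noteq> z}" by auto
    ultimately show "\<exists>xs. set xs = {(b, f b) | b. f b \<noteq> z}" using finite_list by metis
  qed
  from bchoice[OF this] obtain xs where xs: "\<And>f. f \<in> K \<Longrightarrow> set (xs f) = {(b, f b) | b. f b \<noteq> z}" by blast
  have "inj_on (\<lambda>f. encode_pairs (xs f)) K"
  proof (rule inj_onI)
    fix f g assume fg: "f \<in> K" "g \<in> K" "encode_pairs (xs f) = encode_pairs (xs g)"
    then have "{(b, f b) | b. f b \<noteq> z} = {(b, g b) | b. g b \<noteq> z}"
      using xs[of f] xs[of g] encode_pairs_inj[of "xs f" "xs g"] by simp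
    then have "(b, y) \<in> {(b, f b) | b. f b \<noteq> z} \<longleftrightarrow> (b, y) \<in> {(b, g b) | b. g b \<noteq> z}" for b y
      by simp
    then have eq: "y \<noteq> z \<Longrightarrow> f b = y \<longleftrightarrow> g b = y" for b y by auto
    show "f = g"
    proof
      show "f b = g b" for b using eq[of "f b" b] eq[of "g b" b] by (cases "f b = z"; cases "g b = z") auto
    qed
  qed
  then show ?thesis by blast
qed

text \<open>The elements of \<open>M\<close> serve as a basis, renamed by \<open>j\<close> to lists
  so that the free module has the element type \<open>res\<close>. Finite support is recorded in
  order that the kernel can be encoded by lists in turn.\<close>

lemma projective_cover_by_free:
  fixes M :: "('r, 'n) module" and j :: "'n \<Rightarrow> ('r + 'm) list"
  assumes M: "left_module R M" and j: "inj_on j (carrier M)"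
  shows "\<exists>(P :: ('r, ('r, 'm) res) module) \<epsilon>. projective_module R P \<and> \<epsilon> \<in> module_hom R P M \<and>
     \<epsilon> ` carrier P = carrier M \<and> (\<forall>f\<in>carrier P. finite {b. f b \<noteq> \<zero>\<^bsub>R\<^esub>})"
proof -
  interpret M: left_module R M by fact
  interpret idempotent_family R "j ` carrier M" "\<lambda>_. \<one>\<^bsub>R\<^esub>"
    by unfold_locales simp_all
  define v where "v = inv_into (carrier M) j"
  have v: "v \<in> j ` carrier M \<rightarrow> carrier M" by (auto simp: v_def inv_into_into)
  have "m \<in> family_eval R M v ` carrier F" if m: "m \<in> carrier M" for m
  proof
    show "m = family_eval R M v (family_unit R (\<lambda>_. \<one>\<^bsub>R\<^esub>) (j m))"
      using m j by (subst family_eval_unit[OF M v]) (simp_all add: v_def)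
    show "family_unit R (\<lambda>_. \<one>\<^bsub>R\<^esub>) (j m) \<in> carrier F" using m by (intro family_unit_closed) auto
  qed
  moreover have "family_eval R M v ` carrier F \<subseteq> carrier M"
    using module_hom_closed[OF family_eval_hom[OF M v]] by blast
  ultimately have "family_eval R M v ` carrier F = carrier M" by blast
  then show ?thesis
    using family_projective family_eval_hom[OF M v] family_carrier by blast
qed

text \<open>This makes the choice in \<open>chosen_resolution\<close> meaningful. The invariant
  handed from kernel to kernel is finite support, which by \<open>finite_support_encoding\<close>
  provides names for the next basis.\<close>

lemma projective_resolution_exists:
  fixes R :: "('r, 'b) ring_scheme" and M :: "('r, 'm) module"
  assumes M: "left_module R M"
  obtains P d \<epsilon> where "projective_resolution R M (P :: nat \<Rightarrow> ('r, ('r, 'm) res) module) d \<epsilon>"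
proof -
  have "inj_on (\<lambda>m. [Inr m] :: ('r + 'm) list) (carrier M)" by (auto simp: inj_on_def)
  from projective_cover_by_free[OF M this]
  obtain P :: "('r, ('r, 'm) res) module" and \<epsilon> where P: "projective_module R P" "\<epsilon> \<in> module_hom R P M"
     "\<epsilon> ` carrier P = carrier M" "\<forall>f\<in>carrier P. finite {b. f b \<noteq> \<zero>\<^bsub>R\<^esub>}"
    by blast
  have "\<exists>(P :: ('r, ('r, 'm) res) module) \<epsilon>. projective_module R P \<and> \<epsilon> \<in> module_hom R P K \<and>
     \<epsilon> ` carrier P = carrier K \<and> (\<forall>f\<in>carrier P. finite {b. f b \<noteq> \<zero>\<^bsub>R\<^esub>})"
    if K: "left_module R K" and fin: "\<forall>f\<in>carrier K. finite {b. f b \<noteq> \<zero>\<^bsub>R\<^esub>}"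
    for K :: "('r, ('r, 'm) res) module"
  proof -
    from fin have "\<exists>j :: ('r, 'm) res \<Rightarrow> ('r + 'm) list. inj_on j (carrier K)"
      by (intro finite_support_encoding) blast
    then obtain j :: "('r, 'm) res \<Rightarrow> ('r + 'm) list" where "inj_on j (carrier K)" ..
    from projective_cover_by_free[OF K this] show ?thesis .
  qed
  note step = this
  let ?G = "\<lambda>(_ :: nat) (K :: ('r, ('r, 'm) res) module). \<forall>f\<in>carrier K. finite {b. f b \<noteq> \<zero>\<^bsub>R\<^esub>}"
  show ?thesis
  proof (rule projective_resolution_step[OF M, where G = ?G and Z = "\<lambda>_ _. True"])
    show "\<exists>P \<epsilon>. projective_module R P \<and> \<epsilon> \<in> module_hom R P M \<and> \<epsilon> ` carrier P = carrier M \<and>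
        ?G 0 (P\<lparr>carrier := a_kernel P M \<epsilon>\<rparr>)"
      using P by (intro exI[of _ P] exI[of _ \<epsilon>]) (simp add: a_kernel_def')
  next
    fix n and K :: "('r, ('r, 'm) res) module"
    assume "left_module R K" "?G n K"
    from step[OF this] obtain P :: "('r, ('r, 'm) res) module" and \<epsilon> where P: "projective_module R P"
      "\<epsilon> \<in> module_hom R P K" "\<epsilon> ` carrier P = carrier K" "\<forall>f\<in>carrier P. finite {b. f b \<noteq> \<zero>\<^bsub>R\<^esub>}"
      by blast
    then show "\<exists>P \<epsilon>. projective_module R P \<and> \<epsilon> \<in> module_hom R P K \<and> \<epsilon> ` carrier P = carrier K \<and>
        ?G (Suc n) (P\<lparr>carrier := a_kernel P K \<epsilon>\<rparr>) \<and> True"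
      by (intro exI[of _ P] exI[of _ \<epsilon>]) (simp add: a_kernel_def')
  qed (rule that)
qed

section \<open>Bases of vector spaces given by carrier sets\<close>

lemma lookup_map_times: "Poly_Mapping.lookup (Poly_Mapping.map ((*) c) f) x = c * Poly_Mapping.lookup f x" for c :: "'k::field"
  by (auto simp: Poly_Mapping.map.rep_eq when_def)

interpretation pm: vector_space "\<lambda>c :: 'k::field. Poly_Mapping.map ((*) c) :: ('n \<Rightarrow>\<^sub>0 'k) \<Rightarrow> _"
  by unfold_locales (auto intro!: poly_mapping_eqI simp: lookup_map_times lookup_add algebra_simps)

lemma poly_mapping_sum_single: "f = (\<Sum>x\<in>Poly_Mapping.keys f. Poly_Mapping.map ((*) (Poly_Mapping.lookup f x)) (Poly_Mapping.single x 1))"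
  for f :: "'n \<Rightarrow>\<^sub>0 'k::field"
proof (rule poly_mapping_eqI)
  fix y
  have "Poly_Mapping.lookup (\<Sum>x\<in>Poly_Mapping.keys f. Poly_Mapping.map ((*) (Poly_Mapping.lookup f x)) (Poly_Mapping.single x 1)) y
      = (\<Sum>x\<in>Poly_Mapping.keys f. if x = y then Poly_Mapping.lookup f x else 0)"
    unfolding lookup_sum by (intro sum.cong refl) (simp add: lookup_map_times lookup_single when_def)
  then show "Poly_Mapping.lookup f y = Poly_Mapping.lookup (\<Sum>x\<in>Poly_Mapping.keys f. Poly_Mapping.map ((*) (Poly_Mapping.lookup f x)) (Poly_Mapping.single x 1)) y"
    by (simp add: in_keys_iff)
qed

text \<open>By uniqueness of coordinates, those of \<open>x\<close> with respect to \<open>B\<close>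
  vanish outside \<open>A\<close> and also outside \<open>B - A\<close>, hence everywhere.\<close>

lemma (in vector_space) span_Int_span_Diff:
  assumes "independent B" "A \<subseteq> B" "x \<in> span A" "x \<in> span (B - A)"
  shows "x = 0"
proof -
  have x: "x \<in> span B" using assms(2,3) span_mono by blast
  have "representation B x = representation A x" "representation B x = representation (B - A) x"
    using assms by (auto intro!: representation_extend)
  then have "representation B x = (\<lambda>_. 0)"
    using representation_ne_zero[of A x] representation_ne_zero[of "B - A" x] by (metis DiffE ext)
  then show ?thesis using sum_nonzero_representation_eq[OF assms(1) x] by simp
qed

text \<open>The components of a module are subsets of a carrier, while spans and independence refer
  to a whole type. \<open>lincomb\<close> links \<open>W\<close> to the space of formal
  combinations, where independent sets can be extended.\<close>

locale scalar_subspace = abelian_group N for N (structure) +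
  fixes sc :: "'k::field \<Rightarrow> 'a \<Rightarrow> 'a" and W :: "'a set"
  assumes W: "W \<subseteq> carrier N" "\<zero> \<in> W" "\<And>x y. \<lbrakk>x \<in> W; y \<in> W\<rbrakk> \<Longrightarrow> x \<oplus> y \<in> W"
    and sc: "\<And>c x. x \<in> W \<Longrightarrow> sc c x \<in> W"
      "\<And>c d x. x \<in> W \<Longrightarrow> sc (c + d) x = sc c x \<oplus> sc d x"
      "\<And>c x y. \<lbrakk>x \<in> W; y \<in> W\<rbrakk> \<Longrightarrow> sc c (x \<oplus> y) = sc c x \<oplus> sc c y"
      "\<And>c d x. x \<in> W \<Longrightarrow> sc (c * d) x = sc c (sc d x)"
      "\<And>x. x \<in> W \<Longrightarrow> sc 1 x = x"
begin

definition lincomb :: "('a \<Rightarrow>\<^sub>0 'k) \<Rightarrow> 'a" where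
  "lincomb c = (\<Oplus>b\<in>Poly_Mapping.keys c. sc (Poly_Mapping.lookup c b) b)"

lemma W_carrier: "x \<in> W \<Longrightarrow> x \<in> carrier N" using W by blast

lemma sc_0: "x \<in> W \<Longrightarrow> sc 0 x = \<zero>"
  using sc(1)[of x 0] sc(2)[of x 0 0] by (metis W_carrier add.r_cancel_one' add_0)

lemma sc_zero: "sc c \<zero> = \<zero>"
  using sc(1)[of "\<zero>" c] sc(3)[of "\<zero>" "\<zero>" c] W(2) by (metis W_carrier add.r_cancel_one' r_zero)

lemma lincomb_superset:
  assumes "Poly_Mapping.keys c \<subseteq> S" "S \<subseteq> W" "finite S"
  shows "lincomb c = (\<Oplus>b\<in>S. sc (Poly_Mapping.lookup c b) b)"
  unfolding lincomb_def
  using assms sc by (intro add.finprod_mono_neutral_cong_left) (auto simp: in_keys_iff subset_eq sc_0 intro!: W_carrier)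

lemma lincomb_in_W: "Poly_Mapping.keys c \<subseteq> W \<Longrightarrow> lincomb c \<in> W"
proof -
  assume c: "Poly_Mapping.keys c \<subseteq> W"
  have "(\<Oplus>b\<in>S. sc (Poly_Mapping.lookup c b) b) \<in> W" if "S \<subseteq> W" "finite S" for S
    using that(2,1)
  proof (induction S)
    case (insert x S)
    then have "(\<lambda>b. sc (Poly_Mapping.lookup c b) b) \<in> S \<rightarrow> carrier N" "sc (Poly_Mapping.lookup c x) x \<in> carrier N"
      using sc(1) by (auto intro!: W_carrier)
    with insert show ?case using W(3) sc(1) by simp
  qed (simp add: W(2))
  then show ?thesis using c by (simp add: lincomb_def)
qed

lemma lincomb_add:
  assumes "Poly_Mapping.keys c \<subseteq> W" "Poly_Mapping.keys d \<subseteq> W"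
  shows "lincomb (c + d) = lincomb c \<oplus> lincomb d"
proof -
  let ?S = "Poly_Mapping.keys c \<union> Poly_Mapping.keys d"
  have S: "?S \<subseteq> W" "finite ?S" using assms by auto
  have 1: "(\<lambda>b. sc (Poly_Mapping.lookup f b) b) \<in> ?S \<rightarrow> carrier N" for f using S sc(1) by (auto intro!: W_carrier)
  have "lincomb (c + d) = (\<Oplus>b\<in>?S. sc (Poly_Mapping.lookup (c + d) b) b)"
    using S keys_add[of c d] by (intro lincomb_superset) auto
  also have "\<dots> = (\<Oplus>b\<in>?S. sc (Poly_Mapping.lookup c b) b \<oplus> sc (Poly_Mapping.lookup d b) b)"
    using S sc(1,2) by (intro finsum_cong') (auto simp: lookup_add subset_eq intro!: W_carrier W(3))
  also have "\<dots> = lincomb c \<oplus> lincomb d"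
    using 1 S by (subst (1 2) lincomb_superset[of _ ?S]) (auto simp: finsum_addf)
  finally show ?thesis .
qed

lemma lincomb_scale:
  assumes "Poly_Mapping.keys c \<subseteq> W"
  shows "lincomb (Poly_Mapping.map ((*) k) c) = sc k (lincomb c)"
proof -
  have k: "Poly_Mapping.keys (Poly_Mapping.map ((*) k) c) \<subseteq> Poly_Mapping.keys c" by (auto simp: in_keys_iff lookup_map_times)
  have "(\<Oplus>b\<in>S. sc (k * Poly_Mapping.lookup c b) b) = sc k (\<Oplus>b\<in>S. sc (Poly_Mapping.lookup c b) b) \<and> (\<Oplus>b\<in>S. sc (Poly_Mapping.lookup c b) b) \<in> W"
    if "S \<subseteq> W" "finite S" for S
    using that(2,1)
  proof (induction S)
    case (insert x S)
    then have "(\<lambda>b. sc (Poly_Mapping.lookup c b) b) \<in> S \<rightarrow> carrier N" "sc (Poly_Mapping.lookup c x) x \<in> carrier N"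
       "(\<lambda>b. sc (k * Poly_Mapping.lookup c b) b) \<in> S \<rightarrow> carrier N" "sc (k * Poly_Mapping.lookup c x) x \<in> carrier N"
      using sc(1) by (auto intro!: W_carrier)
    with insert show ?case using W(3) sc by simp
  qed (simp add: W(2) sc_zero)
  from this[of "Poly_Mapping.keys c"] assms show ?thesis
    by (subst lincomb_superset[OF k assms]) (auto simp: lookup_map_times lincomb_def)
qed

lemma lincomb_single: "x \<in> W \<Longrightarrow> lincomb (Poly_Mapping.single x 1) = x"
  using sc(5) W_carrier by (simp add: lincomb_def)

text \<open>
  A basis of the kernel of \<open>lincomb\<close> is extended by formal generators, and the added generators form a basis.
\<close>

lemma basis_exists:
  obtains B where "B \<subseteq> W" "\<And>x. x \<in> W \<Longrightarrow> \<exists>c. Poly_Mapping.keys c \<subseteq> B \<and> lincomb c = x"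
    "\<And>c. Poly_Mapping.keys c \<subseteq> B \<Longrightarrow> lincomb c = \<zero> \<Longrightarrow> c = 0"
proof -
  let ?s = "\<lambda>x. Poly_Mapping.single x (1 :: 'k)"
  define L where "L = {c. Poly_Mapping.keys c \<subseteq> W \<and> lincomb c = \<zero>}"
  have keys_scale: "Poly_Mapping.keys (Poly_Mapping.map ((*) k) c) \<subseteq> Poly_Mapping.keys c" for k :: 'k and c :: "'a \<Rightarrow>\<^sub>0 'k"
    by (auto simp: in_keys_iff lookup_map_times)
  have L: "pm.subspace L"
  proof (rule pm.subspaceI)
    show "0 \<in> L" by (simp add: L_def lincomb_def)
  next
    fix x y assume "x \<in> L" "y \<in> L"
    then show "x + y \<in> L" using keys_add[of x y] by (auto simp: L_def lincomb_add)
  next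
    fix k x assume "x \<in> L"
    then show "Poly_Mapping.map ((*) k) x \<in> L"
      using keys_scale[of k x] by (auto simp: L_def lincomb_scale sc_zero)
  qed
  obtain B0 where B0: "B0 \<subseteq> L" "pm.independent B0" "L \<subseteq> pm.span B0"
    using pm.maximal_independent_subset by blast
  have span_B0: "pm.span B0 = L"
    using B0 L by (metis pm.span_minimal subset_antisym)
  obtain B where B: "B0 \<subseteq> B" "B \<subseteq> B0 \<union> ?s ` W" "pm.independent B" "B0 \<union> ?s ` W \<subseteq> pm.span B"
    using pm.maximal_independent_subset_extend[of B0 "B0 \<union> ?s ` W"] B0 by blast
  define Y where "Y = {x \<in> W. ?s x \<in> B - B0}"
  have BY: "B - B0 = ?s ` Y" using B(2) by (auto simp: Y_def)
  have span_Y: "c \<in> pm.span (?s ` Y)" if "Poly_Mapping.keys c \<subseteq> Y" for c :: "'a \<Rightarrow>\<^sub>0 'k"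
    using that by (subst poly_mapping_sum_single) (intro pm.span_sum pm.span_scale pm.span_base, blast)
  have Y_span: "Poly_Mapping.keys c \<subseteq> Y" if "c \<in> pm.span (?s ` Y)" for c
    using that
  proof (induction rule: pm.span_induct_alt)
    case (step k x y)
    then show ?case using keys_add[of "Poly_Mapping.map ((*) k) x" y] keys_scale[of k x] by (auto split: if_splits)
  qed auto
  show ?thesis
  proof (rule that[of Y])
    show "Y \<subseteq> W" by (auto simp: Y_def)
  next
    fix c assume c: "Poly_Mapping.keys c \<subseteq> Y" "lincomb c = \<zero>"
    \<comment> \<open>\<open>c\<close> lies in the span of \<open>B0\<close> and in the span of the
      added generators \<open>B - B0\<close>, and these meet only in 0.\<close>
    then have "c \<in> pm.span B0" by (auto simp: span_B0 L_def Y_def)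
    then show "c = 0" using pm.span_Int_span_Diff[OF B(3,1)] span_Y[OF c(1)] BY by simp
  next
    fix x assume x: "x \<in> W"
    have "B \<subseteq> B0 \<union> ?s ` Y" using BY by blast
    then have "?s x \<in> pm.span (B0 \<union> ?s ` Y)" using B(4) x pm.span_mono by blast
    \<comment> \<open>Modulo the kernel of \<open>lincomb\<close>, the formal generator of
      \<open>x\<close> is a combination of the added generators.\<close>
    then obtain y z where yz: "?s x = y + z" "y \<in> L" "z \<in> pm.span (?s ` Y)"
      by (auto simp: pm.span_Un span_B0)
    have z: "Poly_Mapping.keys z \<subseteq> Y" using Y_span yz by blast
    then have zW: "Poly_Mapping.keys z \<subseteq> W" by (auto simp: Y_def)
    have "x = lincomb (y + z)" using x by (simp flip: yz(1) add: lincomb_single)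
    also have "\<dots> = lincomb z"
      using yz(2) zW lincomb_in_W[OF zW] by (simp add: lincomb_add L_def W_carrier)
    finally show "\<exists>c. Poly_Mapping.keys c \<subseteq> Y \<and> lincomb c = x" using z by auto
  qed
qed

end

section \<open>Rings with triangular idempotents\<close>

text \<open>Off the diagonal, \<open>e v R e w\<close> can be nonzero only if
  \<open>ht w < ht v\<close>, so \<open>R e w\<close> has components only at \<open>w\<close> and at
  greater heights. This is what pushes the kernels of covers upwards.\<close>

locale triangular_ring = ring R for R (structure) +
  fixes V :: "'v set" and e :: "'v \<Rightarrow> 'a" and \<kappa> :: "'k::field \<Rightarrow> 'a" and ht :: "'v \<Rightarrow> nat"
  assumes finite_V: "finite V"
    and e_closed: "v \<in> V \<Longrightarrow> e v \<in> carrier R"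
    and e_idem: "v \<in> V \<Longrightarrow> e v \<otimes> e v = e v"
    and e_orth: "\<lbrakk>v \<in> V; w \<in> V; v \<noteq> w\<rbrakk> \<Longrightarrow> e v \<otimes> e w = \<zero>"
    and e_sum: "(\<Oplus>v\<in>V. e v) = \<one>"
    and \<kappa>_closed: "\<kappa> c \<in> carrier R"
    and \<kappa>_add: "\<kappa> (c + d) = \<kappa> c \<oplus> \<kappa> d"
    and \<kappa>_mult: "\<kappa> (c * d) = \<kappa> c \<otimes> \<kappa> d"
    and \<kappa>_one: "\<kappa> 1 = \<one>"
    and \<kappa>_comm: "v \<in> V \<Longrightarrow> \<kappa> c \<otimes> e v = e v \<otimes> \<kappa> c"
    and corner: "\<lbrakk>v \<in> V; r \<in> carrier R\<rbrakk> \<Longrightarrow> \<exists>c. e v \<otimes> r \<otimes> e v = \<kappa> c \<otimes> e v"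
    and triangular: "\<lbrakk>v \<in> V; w \<in> V; v \<noteq> w; ht v \<le> ht w; r \<in> carrier R\<rbrakk> \<Longrightarrow> e v \<otimes> r \<otimes> e w = \<zero>"
begin

lemma \<kappa>_zero: "\<kappa> 0 = \<zero>"
  using \<kappa>_add[of 0 0] \<kappa>_closed[of 0] add.r_cancel_one'[of "\<kappa> 0" "\<kappa> 0"] by simp

lemma sum_components:
  assumes "left_module R M" "m \<in> carrier M"
  shows "m = (\<Oplus>\<^bsub>M\<^esub>v\<in>V. e v \<odot>\<^bsub>M\<^esub> m)"
proof -
  interpret M: left_module R M by fact
  show ?thesis
    using M.finsum_smult[of m e V] assms(2) e_closed by (simp add: e_sum Pi_def)
qed

text \<open>The subset \<open>S\<close> is separate from \<open>M\<close> so that the condition can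
  be stated for a kernel inside its cover.\<close>

definition supported_from :: "nat \<Rightarrow> ('a, 'n) module \<Rightarrow> 'n set \<Rightarrow> bool" where
  "supported_from k M S \<longleftrightarrow> (\<forall>v\<in>V. ht v < k \<longrightarrow> (\<forall>m\<in>S. e v \<odot>\<^bsub>M\<^esub> m = \<zero>\<^bsub>M\<^esub>))"

lemma component_subspace:
  assumes "left_module R M" "v \<in> V"
  shows "scalar_subspace M (\<lambda>c m. \<kappa> c \<odot>\<^bsub>M\<^esub> m) {m \<in> carrier M. e v \<odot>\<^bsub>M\<^esub> m = m}"
proof -
  interpret M: left_module R M by fact
  have "e v \<odot>\<^bsub>M\<^esub> (\<kappa> c \<odot>\<^bsub>M\<^esub> m) = \<kappa> c \<odot>\<^bsub>M\<^esub> m" if "m \<in> carrier M" "e v \<odot>\<^bsub>M\<^esub> m = m" for m c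
    using that assms(2) e_closed \<kappa>_closed \<kappa>_comm[OF assms(2), of c]
      M.smult_assoc1[of "e v" "\<kappa> c" m] M.smult_assoc1[of "\<kappa> c" "e v" m] by simp
  then show ?thesis
    using assms e_closed \<kappa>_closed
    by unfold_locales (auto simp: M.smult_l_distr M.smult_r_distr M.smult_assoc1 \<kappa>_add \<kappa>_mult \<kappa>_one)
qed

text \<open>
  The projective module is \<open>\<Oplus>\<^sub>v R e\<^sub>v \<otimes>\<^sub>k e\<^sub>v M\<close>. In the lowest degree \<open>k\<close> its map to \<open>M\<close>
  is bijective because \<open>e\<^sub>v R e\<^sub>v = k e\<^sub>v\<close>, so that the kernel is supported from \<open>k + 1\<close> on.
\<close>

lemma projective_cover_supported:
  fixes M :: "('a, 'n) module" and j :: "'n \<Rightarrow> ('a + 'm) list"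
  assumes M: "left_module R M" and j: "inj_on j (carrier M)" and supp: "supported_from k M (carrier M)"
  shows "\<exists>(P :: ('a, ('a, 'm) res) module) \<epsilon>. projective_module R P \<and> \<epsilon> \<in> module_hom R P M \<and>
    \<epsilon> ` carrier P = carrier M \<and> (\<forall>f\<in>carrier P. finite {b. f b \<noteq> \<zero>}) \<and>
    supported_from (Suc k) P (a_kernel P M \<epsilon>) \<and>
    (carrier M = {\<zero>\<^bsub>M\<^esub>} \<longrightarrow> carrier P = {\<zero>\<^bsub>P\<^esub>})"
proof -
  interpret M: left_module R M by fact
  let ?W = "\<lambda>v. {m \<in> carrier M. e v \<odot>\<^bsub>M\<^esub> m = m}"
  let ?lc = "scalar_subspace.lincomb M (\<lambda>c m. \<kappa> c \<odot>\<^bsub>M\<^esub> m)"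
  define basis where "basis = (\<lambda>v Y. Y \<subseteq> ?W v \<and> (\<forall>x\<in>?W v. \<exists>c. Poly_Mapping.keys c \<subseteq> Y \<and> ?lc c = x) \<and>
     (\<forall>c. Poly_Mapping.keys c \<subseteq> Y \<longrightarrow> ?lc c = \<zero>\<^bsub>M\<^esub> \<longrightarrow> c = 0))"
  define Y where "Y = (\<lambda>v. SOME Y. basis v Y)"
  have basis: "basis v (Y v)" if v: "v \<in> V" for v
  proof -
    interpret scalar_subspace M "\<lambda>c m. \<kappa> c \<odot>\<^bsub>M\<^esub> m" "?W v" by (rule component_subspace[OF M v])
    show ?thesis
    proof (rule basis_exists)
      fix B assume "B \<subseteq> ?W v" "\<And>x. x \<in> ?W v \<Longrightarrow> \<exists>c. Poly_Mapping.keys c \<subseteq> B \<and> ?lc c = x"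
        "\<And>c. Poly_Mapping.keys c \<subseteq> B \<Longrightarrow> ?lc c = \<zero>\<^bsub>M\<^esub> \<Longrightarrow> c = 0"
      then have "basis v B" unfolding basis_def by (intro conjI ballI allI impI)
      then show ?thesis unfolding Y_def by (rule someI)
    qed
  qed
  have Y: "Y v \<subseteq> ?W v" if "v \<in> V" for v
    using basis[OF that] unfolding basis_def by (rule conjunct1)
  have Yspan: "\<exists>c. Poly_Mapping.keys c \<subseteq> Y v \<and> ?lc c = x" if "v \<in> V" "x \<in> ?W v" for v x
    using basis[OF that(1)] that(2) unfolding basis_def by (elim conjE bspec)
  have Yind: "c = 0" if "v \<in> V" "Poly_Mapping.keys c \<subseteq> Y v" "?lc c = \<zero>\<^bsub>M\<^esub>" for v c
    using basis[OF that(1)] that(2,3) unfolding basis_def by (elim conjE allE[of _ c]) simp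
  have lc: "?lc c = (\<Oplus>\<^bsub>M\<^esub>m\<in>Poly_Mapping.keys c. \<kappa> (Poly_Mapping.lookup c m) \<odot>\<^bsub>M\<^esub> m)" if "v \<in> V" for v c
    by (rule scalar_subspace.lincomb_def[OF component_subspace[OF M that]])
  \<comment> \<open>Without zero in the bases, a basis element cannot belong to two vertices, so
    each index of the sum has a well-defined vertex.\<close>
  have Y0: "\<zero>\<^bsub>M\<^esub> \<notin> Y v" if v: "v \<in> V" for v
  proof
    assume "\<zero>\<^bsub>M\<^esub> \<in> Y v"
    then have "Poly_Mapping.single \<zero>\<^bsub>M\<^esub> (1 :: 'k) = 0"
      using v \<kappa>_closed by (intro Yind[OF v]) (auto simp: lc[OF v])
    then have "Poly_Mapping.lookup (Poly_Mapping.single \<zero>\<^bsub>M\<^esub> (1 :: 'k)) \<zero>\<^bsub>M\<^esub> = 0" by simp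
    then show False by simp
  qed
  have Yuniq: "v = w" if vw: "v \<in> V" "w \<in> V" "m \<in> Y v" "m \<in> Y w" for v w m
  proof (rule ccontr)
    assume "v \<noteq> w"
    moreover have m: "m \<in> carrier M" "e v \<odot>\<^bsub>M\<^esub> m = m" "e w \<odot>\<^bsub>M\<^esub> m = m" using vw Y by auto
    ultimately have "m = \<zero>\<^bsub>M\<^esub>"
      using M.smult_assoc1[of "e v" "e w" m] vw e_closed e_orth by simp
    then show False using Y0 vw by blast
  qed
  define B where "B = j ` (\<Union>v\<in>V. Y v)"
  define i where "i = inv_into (carrier M) j"
  define w where "w = (\<lambda>b. SOME v. v \<in> V \<and> i b \<in> Y v)"
  have ij: "i (j m) = m" if "m \<in> carrier M" for m using j that by (simp add: i_def)
  have Bw: "w b \<in> V" "i b \<in> Y (w b)" "i b \<in> carrier M" "j (i b) = b" "e (w b) \<odot>\<^bsub>M\<^esub> i b = i b" if "b \<in> B" for b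
  proof -
    from that obtain m v where m: "b = j m" "v \<in> V" "m \<in> Y v" unfolding B_def by blast
    then have mc: "m \<in> carrier M" using Y by blast
    have "w b \<in> V \<and> i b \<in> Y (w b)"
      unfolding w_def by (rule someI[of _ v]) (use m mc ij in simp)
    then show "w b \<in> V" "i b \<in> Y (w b)" by auto
    then show "i b \<in> carrier M" "e (w b) \<odot>\<^bsub>M\<^esub> i b = i b" using Y by blast+
    show "j (i b) = b" using m mc ij by simp
  qed
  have jB: "j m \<in> B" "w (j m) = v" if "v \<in> V" "m \<in> Y v" for v m
  proof -
    show "j m \<in> B" using that by (auto simp: B_def)
    then have "w (j m) \<in> V" "i (j m) \<in> Y (w (j m))" using Bw by auto
    moreover have "m \<in> carrier M" using that Y by blast
    ultimately show "w (j m) = v" using Yuniq[of "w (j m)" v m] that ij[of m] by simp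
  qed
  interpret fam: idempotent_family R B "\<lambda>b. e (w b)"
    by unfold_locales (use Bw e_closed e_idem in auto)
  have iB: "i \<in> B \<rightarrow> carrier M" using Bw by auto
  let ?F = "family_module R B (\<lambda>b. e (w b))"
  let ?\<epsilon> = "family_eval R M i"
  interpret F: left_module R ?F by (rule fam.family_left_module)
  have \<epsilon>: "?\<epsilon> \<in> module_hom R ?F M" by (rule fam.family_eval_hom[OF M iB])
  have Fw: "x b \<otimes> e (w b) = x b" if "x \<in> carrier ?F" "b \<in> B" for x b
    using that by (auto simp: fam.family_carrier)

  have img_Y: "m \<in> ?\<epsilon> ` carrier ?F" if "v \<in> V" "m \<in> Y v" for v m
  proof
    note b = jB[OF that]
    have "m \<in> carrier M" using Y that by blast
    then show "m = ?\<epsilon> (family_unit R (\<lambda>b. e (w b)) (j m))"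
      using fam.family_eval_unit[OF M iB b(1)] Bw(5)[OF b(1)] ij by simp
    show "family_unit R (\<lambda>b. e (w b)) (j m) \<in> carrier ?F" by (rule fam.family_unit_closed[OF b(1)])
  qed
  have img_add: "x \<oplus>\<^bsub>M\<^esub> y \<in> ?\<epsilon> ` carrier ?F" if xy: "x \<in> ?\<epsilon> ` carrier ?F" "y \<in> ?\<epsilon> ` carrier ?F" for x y
  proof -
    from xy obtain f g where "f \<in> carrier ?F" "g \<in> carrier ?F" "x = ?\<epsilon> f" "y = ?\<epsilon> g" by blast
    then show ?thesis by (intro image_eqI[of _ _ "f \<oplus>\<^bsub>?F\<^esub> g"]) (auto simp: module_hom_add[OF \<epsilon>])
  qed
  have img_smult: "r \<odot>\<^bsub>M\<^esub> x \<in> ?\<epsilon> ` carrier ?F" if xy: "x \<in> ?\<epsilon> ` carrier ?F" "r \<in> carrier R" for x r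
  proof -
    from xy obtain f where "f \<in> carrier ?F" "x = ?\<epsilon> f" by blast
    then show ?thesis using xy(2) by (intro image_eqI[of _ _ "r \<odot>\<^bsub>?F\<^esub> f"]) (auto simp: module_hom_smult[OF \<epsilon>])
  qed
  have img_0: "\<zero>\<^bsub>M\<^esub> \<in> ?\<epsilon> ` carrier ?F"
    using module_hom_zero[OF fam.family_left_module M \<epsilon>] F.M.zero_closed by (intro image_eqI[of _ _ "\<zero>\<^bsub>?F\<^esub>"]) simp_all
  have img_sub: "?\<epsilon> ` carrier ?F \<subseteq> carrier M" using module_hom_closed[OF \<epsilon>] by blast
  have img_sum: "finsum M f S \<in> ?\<epsilon> ` carrier ?F" if "finite S" "\<forall>s\<in>S. f s \<in> ?\<epsilon> ` carrier ?F" for f and S :: "'z set"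
    using that
  proof (induction S)
    case (insert s S)
    then have "f \<in> S \<rightarrow> carrier M" "f s \<in> carrier M" using img_sub by blast+
    with insert show ?case by (simp add: img_add)
  qed (simp add: img_0)
  have img: "m \<in> ?\<epsilon> ` carrier ?F" if m: "m \<in> carrier M" for m
  proof -
    have "e v \<odot>\<^bsub>M\<^esub> m \<in> ?\<epsilon> ` carrier ?F" if v: "v \<in> V" for v
    proof -
      have "e v \<odot>\<^bsub>M\<^esub> m \<in> ?W v" using v m e_closed e_idem by (simp flip: M.smult_assoc1)
      from Yspan[OF v this] obtain c where c: "Poly_Mapping.keys c \<subseteq> Y v" "?lc c = e v \<odot>\<^bsub>M\<^esub> m" by blast
      have "?lc c \<in> ?\<epsilon> ` carrier ?F"
        unfolding lc[OF v]
      proof (intro img_sum ballI img_smult \<kappa>_closed)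
        show "m \<in> ?\<epsilon> ` carrier ?F" if "m \<in> Poly_Mapping.keys c" for m
          using c(1) that by (intro img_Y[OF v]) blast
      qed simp
      then show ?thesis by (simp add: c(2))
    qed
    then have "(\<Oplus>\<^bsub>M\<^esub>v\<in>V. e v \<odot>\<^bsub>M\<^esub> m) \<in> ?\<epsilon> ` carrier ?F" by (intro img_sum finite_V) blast
    then show ?thesis using sum_components[OF M m] by simp
  qed

  \<comment> \<open>Here \<open>ht v \<le> k\<close>. The entries of \<open>e v x\<close> over
    another vertex lie in some \<open>e v R e w\<close> with \<open>ht w \<ge> k\<close> and vanish
    by triangularity. The remaining entries are scalars times \<open>e v\<close>, so that membership
    in the kernel is a linear relation among the elements of the basis \<open>Y v\<close>.\<close>
  have ker: "e v \<odot>\<^bsub>?F\<^esub> x = \<zero>\<^bsub>?F\<^esub>"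
    if v: "v \<in> V" "ht v < Suc k" and x: "x \<in> carrier ?F" "?\<epsilon> x = \<zero>\<^bsub>M\<^esub>" for v x
  proof -
    define y where "y = e v \<odot>\<^bsub>?F\<^esub> x"
    have y: "y \<in> carrier ?F" using v x e_closed by (simp add: y_def)
    have yb: "y b = e v \<otimes> x b" for b by (simp add: y_def fam.family_ops)
    have yb': "y b = e v \<otimes> x b \<otimes> e (w b)" if "b \<in> B" for b
      using Fw[OF y that] fam.family_val[OF x(1)] by (simp add: yb)
    have off: "y b = \<zero>" if b: "b \<in> B" "w b \<noteq> v" for b
    proof -
      have "ht (w b) \<ge> k"
      proof (rule ccontr)
        assume "\<not> k \<le> ht (w b)"
        then have "e (w b) \<odot>\<^bsub>M\<^esub> i b = \<zero>\<^bsub>M\<^esub>"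
          using Bw[OF b(1)] supp by (simp add: supported_from_def)
        then show False using Bw(1,2,5)[OF b(1)] Y0[of "w b"] by simp
      qed
      then show ?thesis
        unfolding yb'[OF b(1)] using v b Bw(1)[OF b(1)] fam.family_val[OF x(1)] by (intro triangular) auto
    qed
    \<comment> \<open>The scalar is not unique if \<open>e v\<close> is zero; taking 0 wherever the
      entry vanishes keeps the set of nonzero scalars finite.\<close>
    have "\<exists>c. y b = \<kappa> c \<otimes> e v \<and> (y b = \<zero> \<longrightarrow> c = 0)" if b: "b \<in> B" "w b = v" for b
    proof (cases "y b = \<zero>")
      case True
      then show ?thesis using e_closed v by (intro exI[of _ 0]) (simp add: \<kappa>_zero)
    next
      case False
      then show ?thesis using corner[OF v(1) fam.family_val[OF x(1), of b]] yb'[OF b(1)] b(2) by auto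
    qed
    note ex = this
    define c where "c = (\<lambda>b. SOME c. y b = \<kappa> c \<otimes> e v \<and> (y b = \<zero> \<longrightarrow> c = 0))"
    have c: "y b = \<kappa> (c b) \<otimes> e v \<and> (y b = \<zero> \<longrightarrow> c b = 0)" if "b \<in> B" "w b = v" for b
      unfolding c_def by (rule someI_ex) (rule ex[OF that])
    define g where "g = (\<lambda>m. if m \<in> Y v then c (j m) else 0)"
    have yf: "finite {b. y b \<noteq> \<zero>}" using y by (simp add: fam.family_carrier)
    have "{m. g m \<noteq> 0} \<subseteq> i ` {b. y b \<noteq> \<zero>}"
    proof
      fix m assume "m \<in> {m. g m \<noteq> 0}"
      then have m: "m \<in> Y v" "c (j m) \<noteq> 0" by (auto simp: g_def split: if_splits)
      then have "m \<in> carrier M" using Y v by blast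
      then show "m \<in> i ` {b. y b \<noteq> \<zero>}"
        using c[of "j m"] jB[OF v(1) m(1)] m(2) ij by (intro image_eqI[of _ _ "j m"]) auto
    qed
    then have fin: "finite {m. g m \<noteq> 0}" using yf finite_subset by blast
    define G where "G = Abs_poly_mapping g"
    have G: "Poly_Mapping.lookup G = g" using fin by (simp add: G_def)
    have keys: "Poly_Mapping.keys G = {m. g m \<noteq> 0}" by (auto simp: in_keys_iff G)
    have kY: "Poly_Mapping.keys G \<subseteq> Y v" by (auto simp: keys g_def split: if_splits)
    have kM: "Poly_Mapping.keys G \<subseteq> carrier M" using kY Y[OF v(1)] by blast
    have "\<zero>\<^bsub>M\<^esub> = ?\<epsilon> y"
      using module_hom_smult[OF \<epsilon> e_closed[OF v(1)] x(1)] x(2) e_closed[OF v(1)] by (simp add: y_def)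
    also have "\<dots> = (\<Oplus>\<^bsub>M\<^esub>b\<in>j ` Poly_Mapping.keys G. y b \<odot>\<^bsub>M\<^esub> i b)"
    proof (rule fam.family_eval_superset[OF M y iB])
      show "finite (j ` Poly_Mapping.keys G)" by simp
      show "j ` Poly_Mapping.keys G \<subseteq> B" using kY jB v by blast
      show "{b. y b \<noteq> \<zero>} \<subseteq> j ` Poly_Mapping.keys G"
      proof
        fix b assume b: "b \<in> {b. y b \<noteq> \<zero>}"
        then have bB: "b \<in> B" using fam.family_supp_subset[OF y] by blast
        with b off have wb: "w b = v" by blast
        have "c b \<noteq> 0" using c[OF bB wb] b e_closed v by (auto simp: \<kappa>_zero)
        then show "b \<in> j ` Poly_Mapping.keys G"
          using Bw[OF bB] wb by (intro image_eqI[of _ _ "i b"]) (auto simp: keys g_def)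
      qed
    qed
    also have "\<dots> = (\<Oplus>\<^bsub>M\<^esub>m\<in>Poly_Mapping.keys G. y (j m) \<odot>\<^bsub>M\<^esub> i (j m))"
    proof (rule M.add.finprod_reindex)
      show "(\<lambda>b. y b \<odot>\<^bsub>M\<^esub> i b) \<in> j ` Poly_Mapping.keys G \<rightarrow> carrier M"
        using kM ij fam.family_val[OF y] by auto
      show "inj_on j (Poly_Mapping.keys G)" using j kM inj_on_subset by blast
    qed
    also have "\<dots> = ?lc G"
      unfolding lc[OF v(1)]
    proof (rule M.finsum_cong')
      fix m assume m: "m \<in> Poly_Mapping.keys G"
      then have mY: "m \<in> Y v" and mc: "m \<in> carrier M" "e v \<odot>\<^bsub>M\<^esub> m = m" using kY kM Y v by auto
      show "y (j m) \<odot>\<^bsub>M\<^esub> i (j m) = \<kappa> (Poly_Mapping.lookup G m) \<odot>\<^bsub>M\<^esub> m"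
        using c[of "j m"] jB[OF v(1) mY] mc \<kappa>_closed e_closed[OF v(1)]
        by (simp add: ij G g_def mY M.smult_assoc1)
    qed (use kM \<kappa>_closed in auto)
    finally have "G = 0" using Yind[OF v(1) kY] by simp
    then have g0: "g m = 0" for m by (simp flip: G)
    have "y b = \<zero>" for b
    proof (cases "b \<in> B \<and> w b = v")
      case True
      then have "c b = 0" using g0[of "i b"] Bw[of b] by (auto simp: g_def)
      then show ?thesis using c True e_closed v by (simp add: \<kappa>_zero)
    next
      case False
      then show ?thesis using off fam.family_supp_subset[OF y] by blast
    qed
    then have "y = \<zero>\<^bsub>?F\<^esub>" by (simp add: fam.family_ops fun_eq_iff)
    then show ?thesis by (simp only: y_def)
  qed
  show ?thesis
  proof (intro exI conjI ballI impI)
    show "projective_module R ?F" by (rule fam.family_projective)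
    show "?\<epsilon> \<in> module_hom R ?F M" by (rule \<epsilon>)
    show "?\<epsilon> ` carrier ?F = carrier M" using img img_sub by blast
    show "finite {b. f b \<noteq> \<zero>}" if "f \<in> carrier ?F" for f using that by (simp add: fam.family_carrier)
    show "supported_from (Suc k) ?F (a_kernel ?F M ?\<epsilon>)"
      using ker by (simp add: supported_from_def a_kernel_def')
    \<comment> \<open>This clause makes a resolution stop once a kernel is zero: the bases are then
      empty, and so is the index set of the sum.\<close>
    assume "carrier M = {\<zero>\<^bsub>M\<^esub>}"
    then have "m \<notin> Y v" if "v \<in> V" for v m using Y[OF that] Y0[OF that] by (cases "m = \<zero>\<^bsub>M\<^esub>") auto
    then have "B = {}" by (auto simp: B_def)
    then show "carrier ?F = {\<zero>\<^bsub>?F\<^esub>}" by (auto simp: family_module_def)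
  qed
qed

lemma trivial_if_supported_late:
  assumes "left_module R M" "supported_from k M (carrier M)" "\<And>v. v \<in> V \<Longrightarrow> ht v < k"
  shows "carrier M = {\<zero>\<^bsub>M\<^esub>}"
proof -
  interpret M: left_module R M by fact
  have "m = \<zero>\<^bsub>M\<^esub>" if "m \<in> carrier M" for m
  proof -
    have "(\<Oplus>\<^bsub>M\<^esub>v\<in>V. e v \<odot>\<^bsub>M\<^esub> m) = (\<Oplus>\<^bsub>M\<^esub>v\<in>V. \<zero>\<^bsub>M\<^esub>)"
      using assms(2,3) that by (intro M.finsum_cong') (auto simp: supported_from_def)
    then show ?thesis using sum_components[OF assms(1) that] by simp
  qed
  then show ?thesis by blast
qed

text \<open>Each cover raises the least possible height in the kernel by one. The module covered in
  degree \<open>n\<close> is therefore supported from height \<open>n\<close> on, and it is zero as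
  soon as \<open>n \<ge> h\<close>.\<close>

lemma projective_dimension_le:
  fixes M :: "('a, 'm) module"
  assumes M: "left_module R M" and h: "\<And>v. v \<in> V \<Longrightarrow> ht v < h"
  shows "projective_dimension R M \<le> enat h"
proof -
  let ?G = "\<lambda>n (K :: ('a, ('a, 'm) res) module). (\<forall>f\<in>carrier K. finite {b. f b \<noteq> \<zero>}) \<and> supported_from (Suc n) K (carrier K)"
  let ?Z = "\<lambda>n (P :: ('a, ('a, 'm) res) module). n \<ge> h \<longrightarrow> carrier P = {\<zero>\<^bsub>P\<^esub>}"
  have supp_kernel: "supported_from n (P\<lparr>carrier := S\<rparr>) T \<longleftrightarrow> supported_from n P T"
    for n S T and P :: "('a, ('a, 'm) res) module"
    by (simp add: supported_from_def)
  obtain P \<epsilon> d where "projective_resolution R M (P :: nat \<Rightarrow> ('a, ('a, 'm) res) module) d \<epsilon>"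
    "\<And>n. n > 0 \<Longrightarrow> ?Z n (P n)"
  proof (rule projective_resolution_step[OF M, where G = ?G and Z = ?Z])
    have j: "inj_on (\<lambda>m. [Inr m] :: ('a + 'm) list) (carrier M)" by (auto simp: inj_on_def)
    have supp: "supported_from 0 M (carrier M)" by (simp add: supported_from_def)
    from projective_cover_supported[OF M j supp]
    obtain P :: "('a, ('a, 'm) res) module" and \<epsilon> where "projective_module R P" "\<epsilon> \<in> module_hom R P M"
      "\<epsilon> ` carrier P = carrier M" "\<forall>f\<in>carrier P. finite {b. f b \<noteq> \<zero>}"
      "supported_from (Suc 0) P (a_kernel P M \<epsilon>)"
      by blast
    then show "\<exists>P \<epsilon>. projective_module R P \<and> \<epsilon> \<in> module_hom R P M \<and> \<epsilon> ` carrier P = carrier M \<and>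
        ?G 0 (P\<lparr>carrier := a_kernel P M \<epsilon>\<rparr>)"
      by (intro exI[of _ P] exI[of _ \<epsilon>]) (simp add: a_kernel_def' supp_kernel)
  next
    fix n and K :: "('a, ('a, 'm) res) module"
    assume K: "left_module R K" "?G n K"
    have "\<exists>j :: ('a, 'm) res \<Rightarrow> ('a + 'm) list. inj_on j (carrier K)"
      using K(2) by (intro finite_support_encoding) blast
    then obtain j :: "('a, 'm) res \<Rightarrow> ('a + 'm) list" where j: "inj_on j (carrier K)" ..
    from projective_cover_supported[OF K(1) j conjunct2[OF K(2)]]
    obtain P :: "('a, ('a, 'm) res) module" and \<epsilon> where P: "projective_module R P" "\<epsilon> \<in> module_hom R P K"
      "\<epsilon> ` carrier P = carrier K" "\<forall>f\<in>carrier P. finite {b. f b \<noteq> \<zero>}"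
      "supported_from (Suc (Suc n)) P (a_kernel P K \<epsilon>)" "carrier K = {\<zero>\<^bsub>K\<^esub>} \<longrightarrow> carrier P = {\<zero>\<^bsub>P\<^esub>}"
      by blast
    have "?Z (Suc n) P"
    proof
      assume "Suc n \<ge> h"
      then have "carrier K = {\<zero>\<^bsub>K\<^esub>}"
        using h K by (intro trivial_if_supported_late) force+
      then show "carrier P = {\<zero>\<^bsub>P\<^esub>}" using P(6) by blast
    qed
    then show "\<exists>P \<epsilon>. projective_module R P \<and> \<epsilon> \<in> module_hom R P K \<and> \<epsilon> ` carrier P = carrier K \<and>
        ?G (Suc n) (P\<lparr>carrier := a_kernel P K \<epsilon>\<rparr>) \<and> ?Z (Suc n) P"
      using P by (intro exI[of _ P] exI[of _ \<epsilon>]) (simp add: a_kernel_def' supp_kernel)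
  qed (rule that)
  then have "\<exists>(P :: nat \<Rightarrow> ('a, ('a, 'm) res) module) d \<epsilon>.
      projective_resolution R M P d \<epsilon> \<and> (\<forall>n>h. carrier (P n) = {\<zero>\<^bsub>P n\<^esub>})"
    by (intro exI[of _ P] exI[of _ d] exI[of _ \<epsilon>]) simp
  then show ?thesis
    unfolding projective_dimension_def by (intro Inf_lower) blast
qed

lemma global_dimension_finite: "global_dimension TYPE('m) R < \<infinity>"
proof -
  obtain h where h: "\<And>v. v \<in> V \<Longrightarrow> ht v < h"
    using finite_imageI[OF finite_V, of ht] unfolding finite_nat_set_iff_bounded by blast
  have "global_dimension TYPE('m) R \<le> enat h"
    unfolding global_dimension_def using projective_dimension_le[OF _ h] by (intro SUP_least) auto
  then show ?thesis using enat_ord_simps(4) order_le_less_trans by blast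
qed

end

section \<open>Algebras over a field\<close>

locale field_algebra = ring A for A :: "('k::field, 'a) module" (structure) +
  assumes sm_closed: "x \<in> carrier A \<Longrightarrow> c \<odot>\<^bsub>A\<^esub> x \<in> carrier A"
    and sm_add: "\<lbrakk>x \<in> carrier A; y \<in> carrier A\<rbrakk> \<Longrightarrow> c \<odot>\<^bsub>A\<^esub> (x \<oplus> y) = c \<odot>\<^bsub>A\<^esub> x \<oplus> c \<odot>\<^bsub>A\<^esub> y"
    and add_sm: "x \<in> carrier A \<Longrightarrow> (c + d) \<odot>\<^bsub>A\<^esub> x = c \<odot>\<^bsub>A\<^esub> x \<oplus> d \<odot>\<^bsub>A\<^esub> x"
    and mult_sm: "x \<in> carrier A \<Longrightarrow> (c * d) \<odot>\<^bsub>A\<^esub> x = c \<odot>\<^bsub>A\<^esub> (d \<odot>\<^bsub>A\<^esub> x)"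
    and one_sm: "x \<in> carrier A \<Longrightarrow> 1 \<odot>\<^bsub>A\<^esub> x = x"
    and sm_mult_left: "\<lbrakk>x \<in> carrier A; y \<in> carrier A\<rbrakk> \<Longrightarrow> (c \<odot>\<^bsub>A\<^esub> x) \<otimes> y = c \<odot>\<^bsub>A\<^esub> (x \<otimes> y)"
    and sm_mult_right: "\<lbrakk>x \<in> carrier A; y \<in> carrier A\<rbrakk> \<Longrightarrow> x \<otimes> (c \<odot>\<^bsub>A\<^esub> y) = c \<odot>\<^bsub>A\<^esub> (x \<otimes> y)"

lemma quotient_algebra_simps:
  "carrier (quotient_algebra A I) = carrier (A Quot I)"
  "monoid.mult (quotient_algebra A I) = monoid.mult (A Quot I)"
  "one (quotient_algebra A I) = one (A Quot I)"
  "zero (quotient_algebra A I) = zero (A Quot I)"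
  "add (quotient_algebra A I) = add (A Quot I)"
  "module.smult (quotient_algebra A I) = (\<lambda>c S. \<Union>x\<in>S. I +>\<^bsub>A\<^esub> (c \<odot>\<^bsub>A\<^esub> x))"
  by (simp_all add: quotient_algebra_def ring.defs module.defs)

locale quotient_field_algebra = field_algebra A + ideal I A for I and A (structure)
begin

abbreviation "H \<equiv> quotient_algebra A I"
abbreviation "\<phi> \<equiv> \<lambda>x. I +> x"

lemma H_ring: "ring H"
proof -
  interpret Q: ring "A Quot I" by (rule quotient_is_ring)
  show ?thesis
  proof (intro ringI abelian_groupI monoidI; (simp only: quotient_algebra_simps)?)
    show "\<exists>y\<in>carrier (A Quot I). y \<oplus>\<^bsub>A Quot I\<^esub> x = \<zero>\<^bsub>A Quot I\<^esub>" if "x \<in> carrier (A Quot I)" for x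
      using that by (rule Q.add.l_inv_ex)
  qed (simp_all add: Q.m_assoc Q.add.m_ac Q.l_distr Q.r_distr)
qed

lemma \<phi>_closed: "x \<in> carrier A \<Longrightarrow> \<phi> x \<in> carrier H"
  by (simp add: quotient_algebra_simps FactRing_def a_rcosetsI a_subset)

lemma H_cases: "S \<in> carrier H \<Longrightarrow> (\<And>x. x \<in> carrier A \<Longrightarrow> S = \<phi> x \<Longrightarrow> P) \<Longrightarrow> P"
  by (auto simp: quotient_algebra_simps FactRing_simps)

lemma \<phi>_mult: "\<lbrakk>x \<in> carrier A; y \<in> carrier A\<rbrakk> \<Longrightarrow> \<phi> x \<otimes>\<^bsub>H\<^esub> \<phi> y = \<phi> (x \<otimes> y)"
  by (simp add: quotient_algebra_simps FactRing_def rcoset_mult_add)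

lemma \<phi>_add: "\<lbrakk>x \<in> carrier A; y \<in> carrier A\<rbrakk> \<Longrightarrow> \<phi> x \<oplus>\<^bsub>H\<^esub> \<phi> y = \<phi> (x \<oplus> y)"
  by (simp add: quotient_algebra_simps FactRing_def a_rcos_sum)

lemma \<phi>_one: "\<one>\<^bsub>H\<^esub> = \<phi> \<one>"
  by (simp add: quotient_algebra_simps FactRing_def)

lemma \<phi>_ideal: "x \<in> I \<Longrightarrow> \<phi> x = \<zero>\<^bsub>H\<^esub>"
  by (simp add: quotient_algebra_simps FactRing_def a_rcos_const)

lemma \<phi>_zero: "\<phi> \<zero> = \<zero>\<^bsub>H\<^esub>"
  by (intro \<phi>_ideal) simp

lemma \<phi>_pow: "x \<in> carrier A \<Longrightarrow> \<phi> x [^]\<^bsub>H\<^esub> (n :: nat) = \<phi> (x [^] n)"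
proof (induction n)
  case 0
  then show ?case by (simp add: \<phi>_one nat_pow_def)
next
  case (Suc n)
  interpret H: ring H by (rule H_ring)
  show ?case using Suc by (simp add: \<phi>_mult)
qed

text \<open>The definition takes a union over all representatives. This is a single coset because
  \<open>c z = (c 1) z\<close> remains in the ideal for \<open>z\<close> in the ideal.\<close>

lemma \<phi>_smult:
  assumes x: "x \<in> carrier A"
  shows "c \<odot>\<^bsub>H\<^esub> \<phi> x = \<phi> (c \<odot>\<^bsub>A\<^esub> x)"
proof -
  have const: "\<phi> (c \<odot>\<^bsub>A\<^esub> y) = \<phi> (c \<odot>\<^bsub>A\<^esub> x)" if "y \<in> \<phi> x" for y
  proof -
    from that obtain z where z: "z \<in> I" "y = z \<oplus> x" by (auto simp: a_r_coset_def')
    then have zc: "z \<in> carrier A" by simp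
    have "(c \<odot>\<^bsub>A\<^esub> \<one>) \<otimes> z \<in> I" using z by (intro I_l_closed sm_closed) auto
    then have I: "c \<odot>\<^bsub>A\<^esub> z \<in> I" using zc by (simp add: sm_mult_left)
    have "\<phi> (c \<odot>\<^bsub>A\<^esub> y) = \<phi> (c \<odot>\<^bsub>A\<^esub> z) \<oplus>\<^bsub>H\<^esub> \<phi> (c \<odot>\<^bsub>A\<^esub> x)"
      using zc x by (simp add: z(2) sm_add \<phi>_add sm_closed)
    also have "\<dots> = \<phi> (c \<odot>\<^bsub>A\<^esub> x)"
    proof -
      interpret H: ring H by (rule H_ring)
      show ?thesis using x by (simp add: \<phi>_ideal[OF I] \<phi>_closed sm_closed)
    qed
    finally show ?thesis .
  qed
  have "\<phi> x \<noteq> {}" using a_rcos_self[OF x] by blast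
  then show ?thesis
    unfolding quotient_algebra_simps by (rule SUP_eq_const) (rule const)
qed

lemma H_algebra: "field_algebra H"
proof -
  interpret H: ring H by (rule H_ring)
  show ?thesis
    by unfold_locales
      ((elim H_cases; simp add: \<phi>_closed \<phi>_mult \<phi>_add \<phi>_smult sm_closed sm_add add_sm mult_sm one_sm sm_mult_left sm_mult_right)+)
qed

end

section \<open>Path algebras\<close>

lemma poly_mapping_additive_induct [consumes 1, case_names zero single add]:
  fixes f :: "'a \<Rightarrow>\<^sub>0 'b::comm_monoid_add"
  assumes "Poly_Mapping.keys f \<subseteq> S"
    and "P 0" "\<And>x c. x \<in> S \<Longrightarrow> P (Poly_Mapping.single x c)"
    and "\<And>f g. \<lbrakk>Poly_Mapping.keys f \<subseteq> S; Poly_Mapping.keys g \<subseteq> S; P f; P g\<rbrakk> \<Longrightarrow> P (f + g)"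
  shows "P f"
proof -
  let ?s = "\<lambda>x. Poly_Mapping.single x (Poly_Mapping.lookup f x)"
  have "P (\<Sum>x\<in>T. ?s x) \<and> Poly_Mapping.keys (\<Sum>x\<in>T. ?s x) \<subseteq> S" if "finite T" "T \<subseteq> S" for T
    using that
  proof (induction T)
    case (insert x T)
    have "Poly_Mapping.keys (?s x) \<subseteq> S" using insert by auto
    moreover from this have "Poly_Mapping.keys (?s x + (\<Sum>x\<in>T. ?s x)) \<subseteq> S"
      using insert keys_add[of "?s x" "\<Sum>x\<in>T. ?s x"] by blast
    ultimately show ?case using insert assms by simp
  qed (simp add: assms)
  then have "P (\<Sum>x\<in>Poly_Mapping.keys f. ?s x)" using assms(1) finite_keys[of f] by blast
  moreover have "(\<Sum>x\<in>Poly_Mapping.keys f. ?s x) = f"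
  proof (rule poly_mapping_eqI)
    fix y
    have "Poly_Mapping.lookup (\<Sum>x\<in>Poly_Mapping.keys f. ?s x) y = (\<Sum>x\<in>Poly_Mapping.keys f. if x = y then Poly_Mapping.lookup f x else 0)"
      unfolding lookup_sum by (intro sum.cong refl) (simp add: lookup_single when_def)
    then show "Poly_Mapping.lookup (\<Sum>x\<in>Poly_Mapping.keys f. ?s x) y = Poly_Mapping.lookup f y"
      by (simp add: in_keys_iff)
  qed
  ultimately show ?thesis by simp
qed

lemma poly_mapping_additive_induct_UNIV [case_names zero single add]:
  fixes f :: "'a \<Rightarrow>\<^sub>0 'b::comm_monoid_add"
  assumes "P 0" "\<And>x c. P (Poly_Mapping.single x c)" "\<And>f g. P f \<Longrightarrow> P g \<Longrightarrow> P (f + g)"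
  shows "P f"
  using subset_UNIV[of "Poly_Mapping.keys f"] assms by (induction f rule: poly_mapping_additive_induct) auto

definition path_term :: "('v, 'e) path \<Rightarrow> ('v, 'e) path \<Rightarrow> 'k::field \<Rightarrow> ('v, 'e) path \<Rightarrow>\<^sub>0 'k" where
  "path_term x y c = (case (x, y) of ((w, p, v), (u, q, w')) \<Rightarrow>
     if w = w' then Poly_Mapping.single (u, q @ p, v) c else 0)"

lemma path_term_simps:
  "path_term (w, p, v) (u, q, w') c = (if w = w' then Poly_Mapping.single (u, q @ p, v) c else 0)"
  "path_term x y 0 = 0" "path_term x y (c + d) = path_term x y c + path_term x y d"
  by (auto simp: path_term_def single_add split: prod.splits)

text \<open>\<open>path_term\<close> is 0 at coefficient 0, so both supports may be enlarged to
  common finite sets; additivity of the product then follows term by term.\<close>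

lemma path_mult_superset:
  assumes "finite S" "finite T" "Poly_Mapping.keys f \<subseteq> S" "Poly_Mapping.keys g \<subseteq> T"
  shows "path_mult f g = (\<Sum>x\<in>S. \<Sum>y\<in>T. path_term x y (Poly_Mapping.lookup f x * Poly_Mapping.lookup g y))"
proof -
  have "path_mult f g = (\<Sum>x\<in>Poly_Mapping.keys f. \<Sum>y\<in>Poly_Mapping.keys g. path_term x y (Poly_Mapping.lookup f x * Poly_Mapping.lookup g y))"
    unfolding path_mult_def path_term_def ..
  also have "\<dots> = (\<Sum>x\<in>Poly_Mapping.keys f. \<Sum>y\<in>T. path_term x y (Poly_Mapping.lookup f x * Poly_Mapping.lookup g y))"
    using assms by (intro sum.cong refl sum.mono_neutral_left) (auto simp: in_keys_iff path_term_simps)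
  also have "\<dots> = (\<Sum>x\<in>S. \<Sum>y\<in>T. path_term x y (Poly_Mapping.lookup f x * Poly_Mapping.lookup g y))"
    using assms by (intro sum.mono_neutral_left) (auto simp: in_keys_iff path_term_simps)
  finally show ?thesis .
qed

lemma path_mult_add_left: "path_mult (f + g) h = path_mult f h + path_mult g h"
proof -
  let ?S = "Poly_Mapping.keys f \<union> Poly_Mapping.keys g"
  show ?thesis
    using keys_add[of f g]
    by (subst (1 2 3) path_mult_superset[of ?S "Poly_Mapping.keys h"])
      (auto simp: lookup_add distrib_right path_term_simps sum.distrib)
qed

lemma path_mult_add_right: "path_mult h (f + g) = path_mult h f + path_mult h g"
proof -
  let ?S = "Poly_Mapping.keys f \<union> Poly_Mapping.keys g"
  show ?thesis
    using keys_add[of f g]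
    by (subst (1 2 3) path_mult_superset[of "Poly_Mapping.keys h" ?S])
      (auto simp: lookup_add distrib_left path_term_simps sum.distrib)
qed

lemma path_mult_zero [simp]: "path_mult 0 f = 0" "path_mult f 0 = 0"
  by (simp_all add: path_mult_def)

lemma path_mult_single:
  "path_mult (Poly_Mapping.single x c) (Poly_Mapping.single y d) = path_term x y (c * d)"
  by (subst path_mult_superset[of "{x}" "{y}"]) auto

lemma path_mult_sum_left: "path_mult (\<Sum>i\<in>S. f i) h = (\<Sum>i\<in>S. path_mult (f i) h)"
  by (induction S rule: infinite_finite_induct) (auto simp: path_mult_add_left)

lemma path_mult_sum_right: "path_mult h (\<Sum>i\<in>S. f i) = (\<Sum>i\<in>S. path_mult h (f i))"
  by (induction S rule: infinite_finite_induct) (auto simp: path_mult_add_right)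

lemma path_mult_assoc: "path_mult (path_mult f g) h = path_mult f (path_mult g h)"
proof (induction f rule: poly_mapping_additive_induct_UNIV)
  case (single x c)
  show ?case
  proof (induction g rule: poly_mapping_additive_induct_UNIV)
    case (single y d)
    show ?case
    proof (induction h rule: poly_mapping_additive_induct_UNIV)
      case (single z e)
      show ?case
        by (cases x; cases y; cases z) (simp add: path_mult_single path_term_simps mult.assoc)
    qed (auto simp: path_mult_add_left path_mult_add_right)
  qed (auto simp: path_mult_add_left path_mult_add_right)
qed (auto simp: path_mult_add_left path_mult_add_right)

lemma scale_add: "Poly_Mapping.map ((*) c) (f + g) = Poly_Mapping.map ((*) c) f + Poly_Mapping.map ((*) c) g" for c :: "'k::field"
  by (rule poly_mapping_eqI) (simp add: lookup_map_times lookup_add distrib_left)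

lemma scale_path_mult:
  "path_mult (Poly_Mapping.map ((*) c) f) g = Poly_Mapping.map ((*) c) (path_mult f g) \<and>
   path_mult f (Poly_Mapping.map ((*) c) g) = Poly_Mapping.map ((*) c) (path_mult f g)"
proof (induction f rule: poly_mapping_additive_induct_UNIV)
  case (single x a)
  show ?case
  proof (induction g rule: poly_mapping_additive_induct_UNIV)
    case (single y b)
    show ?case by (cases x; cases y) (simp add: path_mult_single path_term_simps mult.assoc mult.left_commute)
  qed (auto simp: path_mult_add_left path_mult_add_right scale_add)
qed (auto simp: path_mult_add_left path_mult_add_right scale_add)

lemma path_algebra_simps:
  "carrier (path_algebra Q) = {f. Poly_Mapping.keys f \<subseteq> paths Q}"
  "monoid.mult (path_algebra Q) = path_mult"
  "one (path_algebra Q) = (\<Sum>u\<in>verts Q. Poly_Mapping.single (u, [], u) 1)"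
  "zero (path_algebra Q) = 0"
  "add (path_algebra Q) = (+)"
  "module.smult (path_algebra Q) = (\<lambda>c. Poly_Mapping.map ((*) c))"
  by (simp_all add: path_algebra_def)

lemma path_mult_closed:
  assumes "wf_digraph Q" "Poly_Mapping.keys f \<subseteq> paths Q" "Poly_Mapping.keys g \<subseteq> paths Q"
  shows "Poly_Mapping.keys (path_mult f g) \<subseteq> paths Q"
  using assms(2)
proof (induction f rule: poly_mapping_additive_induct)
  case (single x c)
  show ?case
    using assms(3)
  proof (induction g rule: poly_mapping_additive_induct)
    case (single y d)
    then show ?case
      using \<open>x \<in> paths Q\<close> wf_digraph.awalk_appendI[OF assms(1)]
      by (cases x; cases y) (auto simp: path_mult_single path_term_simps paths_def)
  next
    case (add f g)
    then show ?case using keys_add[of "path_mult (Poly_Mapping.single x c) f" "path_mult (Poly_Mapping.single x c) g"]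
      by (auto simp: path_mult_add_right)
  qed simp
next
  case (add f h)
  then show ?case using keys_add[of "path_mult f g" "path_mult h g"] by (auto simp: path_mult_add_left)
qed simp

lemma path_algebra_field_algebra:
  assumes Q: "wf_digraph Q" "finite (verts Q)"
  shows "field_algebra (path_algebra Q :: ('k::field, ('v, 'e) path \<Rightarrow>\<^sub>0 'k) module)"
proof -
  let ?A = "path_algebra Q :: ('k::field, ('v, 'e) path \<Rightarrow>\<^sub>0 'k) module"
  let ?one = "\<Sum>u\<in>verts Q. Poly_Mapping.single (u, [], u) (1 :: 'k)"
  have one: "Poly_Mapping.keys ?one \<subseteq> paths Q"
  proof -
    have triv: "(u, [], u) \<in> paths Q" if "u \<in> verts Q" for u
      using that by (simp add: paths_def pre_digraph.awalk_def pre_digraph.cas.simps)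
    have "Poly_Mapping.keys (\<Sum>u\<in>S. Poly_Mapping.single (u, [], u) (1 :: 'k)) \<subseteq> paths Q" if "finite S" "S \<subseteq> verts Q" for S
      using that
    proof (induction S)
      case (insert u S)
      then show ?case
        using keys_add[of "Poly_Mapping.single (u, [], u) (1 :: 'k)" "\<Sum>u\<in>S. Poly_Mapping.single (u, [], u) 1"] triv[of u]
        by auto
    qed simp
    then show ?thesis using Q by blast
  qed
  have one_l: "path_mult ?one f = f" if "Poly_Mapping.keys f \<subseteq> paths Q" for f
    using that
  proof (induction f rule: poly_mapping_additive_induct)
    case (single x c)
    obtain a p b where x: "x = (a, p, b)" by (cases x)
    have b: "b \<in> verts Q" using single wf_digraph.awalk_last_in_verts[OF Q(1)] wf_digraph.awlast_in_verts[OF Q(1)]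
      by (auto simp: x paths_def)
    have "path_mult ?one (Poly_Mapping.single x c) = (\<Sum>u\<in>verts Q. if u = b then Poly_Mapping.single x c else 0)"
      unfolding path_mult_sum_left by (intro sum.cong refl) (simp add: path_mult_single path_term_simps x)
    then show ?case using b Q(2) by simp
  qed (auto simp: path_mult_add_right)
  have one_r: "path_mult f ?one = f" if "Poly_Mapping.keys f \<subseteq> paths Q" for f
    using that
  proof (induction f rule: poly_mapping_additive_induct)
    case (single x c)
    obtain a p b where x: "x = (a, p, b)" by (cases x)
    have a: "a \<in> verts Q" using single by (auto simp: x paths_def pre_digraph.awalk_def)
    have "path_mult (Poly_Mapping.single x c) ?one = (\<Sum>u\<in>verts Q. if u = a then Poly_Mapping.single x c else 0)"
      unfolding path_mult_sum_right by (intro sum.cong refl) (simp add: path_mult_single path_term_simps x)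
    then show ?case using a Q(2) by simp
  qed (auto simp: path_mult_add_left)
  have "abelian_group ?A"
  proof (rule abelian_groupI; (simp only: path_algebra_simps mem_Collect_eq)?)
    fix f g :: "('v, 'e) path \<Rightarrow>\<^sub>0 'k"
    assume f: "Poly_Mapping.keys f \<subseteq> paths Q"
    show "\<exists>y\<in>{f. Poly_Mapping.keys f \<subseteq> paths Q}. y + f = 0" using f by (intro bexI[of _ "- f"]) auto
    assume g: "Poly_Mapping.keys g \<subseteq> paths Q"
    show "Poly_Mapping.keys (f + g) \<subseteq> paths Q" using f g keys_add[of f g] by blast
  qed (auto simp: add_ac)
  then have "ring ?A"
    by (intro ringI monoidI; (simp only: path_algebra_simps mem_Collect_eq)?)
      (simp_all add: one one_l one_r path_mult_add_left path_mult_add_right path_mult_assoc path_mult_closed[OF Q(1)])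
  then show ?thesis
  proof (intro field_algebra.intro field_algebra_axioms.intro; (simp only: path_algebra_simps mem_Collect_eq)?)
    fix f g :: "('v, 'e) path \<Rightarrow>\<^sub>0 'k" and c d :: 'k
    show "Poly_Mapping.map ((*) (c + d)) f = Poly_Mapping.map ((*) c) f + Poly_Mapping.map ((*) d) f"
      "Poly_Mapping.map ((*) (c * d)) f = Poly_Mapping.map ((*) c) (Poly_Mapping.map ((*) d) f)"
      "Poly_Mapping.map ((*) 1) f = f"
      by (auto intro!: poly_mapping_eqI simp: lookup_map_times lookup_add algebra_simps)
    show "Poly_Mapping.keys f \<subseteq> paths Q \<Longrightarrow> Poly_Mapping.keys (Poly_Mapping.map ((*) c) f) \<subseteq> paths Q"
      by (auto simp: in_keys_iff lookup_map_times)
  qed (simp_all add: scale_add scale_path_mult)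
qed

section \<open>GLS algebras\<close>

text \<open>The candidate for an algebra map from paths to power series: it reads off the
  coefficients of the powers of the loop at \<open>i\<close> and ignores every other path. Length 0
  is the trivial path at \<open>i\<close>.\<close>

definition loop_series :: "'n \<Rightarrow> (('n, 'n gls_arrow) path \<Rightarrow>\<^sub>0 'k::field) \<Rightarrow> 'k fps" where
  "loop_series i f = Abs_fps (\<lambda>l. Poly_Mapping.lookup f (i, replicate l (Eps i), i))"

lemma loop_series_add: "loop_series i (f + g) = loop_series i f + loop_series i g"
  by (rule fps_ext) (simp add: loop_series_def lookup_add)

lemma loop_series_zero [simp]: "loop_series i 0 = 0"
  by (rule fps_ext) (simp add: loop_series_def)

lemma loop_series_scale: "loop_series i (Poly_Mapping.map ((*) c) f) = fps_const c * loop_series i f"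
  by (rule fps_ext) (simp add: loop_series_def lookup_map_times)

lemma loop_series_single:
  "loop_series i (Poly_Mapping.single (u, p, v) c) =
    (if u = i \<and> v = i \<and> set p \<subseteq> {Eps i} then fps_const c * fps_X ^ length p else 0)"
proof -
  have "p = replicate l (Eps i) \<longleftrightarrow> set p \<subseteq> {Eps i} \<and> l = length p" for l
  proof
    assume "set p \<subseteq> {Eps i} \<and> l = length p"
    then show "p = replicate l (Eps i)" using replicate_length_same[of p "Eps i"] by (simp add: subset_iff)
  qed (auto split: if_splits)
  then show ?thesis
    by (intro fps_ext) (auto simp: loop_series_def lookup_single when_def fps_X_power_iff)
qed

text \<open>Cut-off series with the cut-off product are the model of k[X]/(X^d) used throughout;
  here the product is seen to depend on the classes of its factors only.\<close>

lemma fps_cutoff_mult_cutoff: "fps_cutoff d (fps_cutoff d F * G) = fps_cutoff d (F * G)"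
  "fps_cutoff d (F * fps_cutoff d G) = fps_cutoff d (F * G)" for F G :: "'k::field fps"
  by (auto intro!: fps_ext sum.cong simp: fps_mult_nth)

lemma fps_cutoff_X_power: "fps_cutoff d (F * fps_X ^ d) = 0" for F :: "'k::field fps"
  by (rule fps_ext) (simp add: fps_X_power_mult_right_nth)

locale gls =
  fixes C D :: "int ^ 'n ^ 'n" and \<Omega> :: "('n \<times> 'n) set" and kt :: "'k::field itself"
  assumes cartan: "cartan_triple C D \<Omega>"
begin

abbreviation "Q \<equiv> gls_quiver C \<Omega>"
abbreviation "kQ \<equiv> path_algebra Q :: ('k, ('n, 'n gls_arrow) path \<Rightarrow>\<^sub>0 'k) module"
abbreviation "J \<equiv> Idl\<^bsub>kQ\<^esub> (gls_relations C D \<Omega>)"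
abbreviation "d \<equiv> \<lambda>i. nat (D $ i $ i)"
abbreviation "eps i \<equiv> arrow_elem Q (Eps i) :: ('n, 'n gls_arrow) path \<Rightarrow>\<^sub>0 'k"

lemma d_pos: "d i \<ge> 1"
proof -
  have "D $ i $ i \<ge> 1" using cartan by (simp add: cartan_triple_def symmetrizer_def)
  then show ?thesis by linarith
qed

lemma Q_wf: "wf_digraph Q"
  by (simp add: wf_digraph_def gls_quiver_def)

lemma Q_simps: "verts Q = UNIV" "tail Q (Eps i) = i" "head Q (Eps i) = i" "tail Q (Alpha i j g) = j" "head Q (Alpha i j g) = i"
  "Eps i \<in> arcs Q" "Alpha i j g \<in> arcs Q \<longleftrightarrow> (i, j, g) \<in> gls_alphas C \<Omega>"
  by (auto simp: gls_quiver_def)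

sublocale kQ: field_algebra kQ
  using Q_wf by (intro path_algebra_field_algebra) (simp_all add: Q_simps)

lemma arrow_closed: "a \<in> arcs Q \<Longrightarrow> arrow_elem Q a \<in> carrier kQ"
  using Q_wf by (auto simp: arrow_elem_def path_algebra_simps paths_def pre_digraph.awalk_def pre_digraph.cas.simps wf_digraph_def)

lemma relations_closed: "gls_relations C D \<Omega> \<subseteq> carrier kQ"
proof -
  have "eps i \<in> carrier kQ" for i by (rule arrow_closed) (simp add: Q_simps)
  moreover have "arrow_elem Q (Alpha i j g) \<in> carrier kQ" if "(i, j, g) \<in> gls_alphas C \<Omega>" for i j g
    by (rule arrow_closed) (simp add: Q_simps that)
  ultimately show ?thesis
    unfolding gls_relations_def Let_def by (auto intro!: kQ.nat_pow_closed kQ.m_closed kQ.minus_closed)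
qed

sublocale kQ: quotient_field_algebra J kQ
  by (intro quotient_field_algebra.intro kQ.field_algebra_axioms kQ.genideal_ideal relations_closed)

lemma gls_algebra_eq: "gls_algebra C D \<Omega> = kQ.H"
  by (simp add: gls_algebra_def Let_def)

lemma eps_pow: "eps i [^]\<^bsub>kQ\<^esub> Suc n = Poly_Mapping.single (i, replicate (Suc n) (Eps i), i) 1"
proof (induction n)
  case 0
  have "eps i \<in> carrier kQ" by (rule arrow_closed) (simp add: Q_simps)
  then show ?case by (simp add: arrow_elem_def Q_simps)
next
  case (Suc n)
  then show ?case
    by (simp add: path_algebra_simps arrow_elem_def Q_simps path_mult_single path_term_simps)
qed

lemma path_closed: "(u, p, v) \<in> paths Q \<Longrightarrow> Poly_Mapping.single (u, p, v) c \<in> carrier kQ"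
  by (simp add: path_algebra_simps)

lemma eps_pow_relation: "eps i [^]\<^bsub>kQ\<^esub> d i \<in> J"
  by (rule kQ.genideal_self[OF relations_closed, THEN subsetD])
    (unfold gls_relations_def Let_def, blast)

lemma acyclic: "acyclic \<Omega>"
proof -
  have ori: "v 1 \<noteq> v (t + 1)" if "t \<ge> 1" "\<forall>s\<in>{1..t}. (v s, v (s + 1)) \<in> \<Omega>" for t and v :: "nat \<Rightarrow> 'n"
    using cartan that unfolding cartan_triple_def orientation_def by blast
  have "(x, x) \<notin> \<Omega>\<^sup>+" for x
  proof
    assume "(x, x) \<in> \<Omega>\<^sup>+"
    then obtain n where n: "n > 0" "(x, x) \<in> \<Omega> ^^ n" by (auto simp: trancl_power)
    then obtain f where f: "f 0 = x" "f n = x" "\<forall>i<n. (f i, f (Suc i)) \<in> \<Omega>" by (auto simp: relpow_fun_conv)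
    \<comment> \<open>Sequences in an orientation are indexed from 1, those in a power of a relation
      from 0.\<close>
    have "(f (s - 1), f (s + 1 - 1)) \<in> \<Omega>" if "s \<in> {1..n}" for s
    proof -
      have "s - 1 < n" "Suc (s - 1) = s" using that by auto
      then show ?thesis using f(3)[rule_format, of "s - 1"] by simp
    qed
    then have "f (1 - 1) \<noteq> f (n + 1 - 1)" using n by (intro ori) auto
    then show False using f by simp
  qed
  then show ?thesis by (simp add: acyclic_def)
qed

text \<open>A pair \<open>(i, j)\<close> in \<open>\<Omega>\<close> stands for arrows from
  \<open>j\<close> to \<open>i\<close>, so this counts the sources of the nontrivial loop-free paths
  that end at \<open>i\<close>. Arrows lead to greater height.\<close>

definition ht :: "'n \<Rightarrow> nat" where "ht i = card {u. (i, u) \<in> \<Omega>\<^sup>+}"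

lemma ht_less: "(i, j) \<in> \<Omega> \<Longrightarrow> ht j < ht i"
  unfolding ht_def
proof (rule psubset_card_mono)
  assume ij: "(i, j) \<in> \<Omega>"
  have "j \<in> {u. (i, u) \<in> \<Omega>\<^sup>+}" "j \<notin> {u. (j, u) \<in> \<Omega>\<^sup>+}"
    using ij acyclic by (auto simp: acyclic_def)
  moreover have "{u. (j, u) \<in> \<Omega>\<^sup>+} \<subseteq> {u. (i, u) \<in> \<Omega>\<^sup>+}"
    using ij by (auto intro: trancl_into_trancl2)
  ultimately show "{u. (j, u) \<in> \<Omega>\<^sup>+} \<subset> {u. (i, u) \<in> \<Omega>\<^sup>+}" by blast
qed simp

text \<open>Every arrow of a loop-free path raises the height. Such a path is trivial if its end is
  not higher than its start.\<close>

lemma awalk_ht: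
  assumes "pre_digraph.awalk Q u p v" "\<And>i. Eps i \<notin> set p"
  shows "ht u + length p \<le> ht v"
proof -
  have "set p \<subseteq> arcs Q" "pre_digraph.cas Q u p v" using assms by (auto simp: pre_digraph.awalk_def)
  then show ?thesis
    using assms(2)
  proof (induction p arbitrary: u)
    case Nil
    then show ?case by (simp add: pre_digraph.cas.simps)
  next
    case (Cons a p)
    then obtain i j g where a: "a = Alpha i j g" by (cases a) auto
    then have "(i, j) \<in> \<Omega>" "u = j" using Cons.prems by (auto simp: Q_simps pre_digraph.cas.simps gls_alphas_def)
    moreover have "ht i + length p \<le> ht v" using Cons a by (auto simp: Q_simps pre_digraph.cas.simps)
    ultimately show ?case using ht_less[of i j] by simp
  qed
qed

lemma loop_awalk: "pre_digraph.cas Q i p v \<Longrightarrow> set p \<subseteq> {Eps i} \<Longrightarrow> v = i"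
  by (induction p) (auto simp: pre_digraph.cas.simps Q_simps)

text \<open>A concatenation of two paths is a power of the loop at \<open>i\<close> exactly if both
  factors are, and the exponents add up. A path of loops that starts at \<open>i\<close> also ends
  there, so the endpoints of two such factors match.\<close>

lemma loop_series_mult:
  assumes "f \<in> carrier kQ" "g \<in> carrier kQ"
  shows "loop_series i (f \<otimes>\<^bsub>kQ\<^esub> g) = loop_series i f * loop_series i g"
proof -
  have "loop_series i (path_mult f g) = loop_series i f * loop_series i g"
    if "Poly_Mapping.keys f \<subseteq> paths Q" "Poly_Mapping.keys g \<subseteq> paths Q" for f g :: "('n, 'n gls_arrow) path \<Rightarrow>\<^sub>0 'k"
    using that(1)
  proof (induction f rule: poly_mapping_additive_induct)
    case (single x a)
    note x = single
    show ?case
      using that(2)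
    proof (induction g rule: poly_mapping_additive_induct)
      case (single y b)
      obtain w p v u q w' where xy: "x = (w, p, v)" "y = (u, q, w')" by (cases x; cases y) auto
      have "w' = i" if "u = i" "set q \<subseteq> {Eps i}"
        using single that loop_awalk[of i q w'] by (auto simp: xy paths_def pre_digraph.awalk_def)
      then show ?case
        unfolding xy path_mult_single path_term_simps
        by (cases "w = w'"; cases "u = i \<and> set q \<subseteq> {Eps i}"; cases "v = i \<and> set p \<subseteq> {Eps i}")
          (auto simp: loop_series_single power_add fps_const_mult[symmetric] ac_simps simp del: fps_const_mult)
    qed (simp_all add: path_mult_add_right loop_series_add distrib_left)
  qed (simp_all add: path_mult_add_left loop_series_add distrib_right)
  then show ?thesis using assms by (simp add: path_algebra_simps)
qed

text \<open>Both terms of a commutation relation contain an arrow \<open>Alpha\<close> and are sent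
  to 0. A nilpotency relation gives X^(d i) at the vertex \<open>i\<close> and 0 at the
  others.\<close>

lemma loop_series_relations:
  fixes f :: "('n, 'n gls_arrow) path \<Rightarrow>\<^sub>0 'k"
  assumes "f \<in> gls_relations C D \<Omega>"
  shows "fps_cutoff (d i) (loop_series i f) = 0"
proof -
  from assms consider (nil) j where "f = eps j [^]\<^bsub>kQ\<^esub> d j"
    | (comm) a b j l g where "(j, l, g) \<in> gls_alphas C \<Omega>"
        "f = (eps j [^]\<^bsub>kQ\<^esub> (a :: nat)) \<otimes>\<^bsub>kQ\<^esub> arrow_elem Q (Alpha j l g) \<ominus>\<^bsub>kQ\<^esub> arrow_elem Q (Alpha j l g) \<otimes>\<^bsub>kQ\<^esub> (eps l [^]\<^bsub>kQ\<^esub> (b :: nat))"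
    unfolding gls_relations_def Let_def by blast
  then show ?thesis
  proof cases
    case nil
    \<comment> \<open>A positive power of the loop is a single path, whereas the zeroth power would
      be the sum of all trivial paths.\<close>
    obtain n where n: "d j = Suc n" using d_pos[of j] by (cases "d j") auto
    show ?thesis
    proof (cases "j = i")
      case True
      have "loop_series i f = fps_X ^ Suc n"
        unfolding nil n eps_pow using True by (simp add: loop_series_single set_replicate_conv_if del: power_Suc)
      then show ?thesis
        using fps_cutoff_X_power[of "d i" "1 :: 'k fps"] n True by (simp del: power_Suc)
    next
      case False
      then show ?thesis unfolding nil n eps_pow by (simp add: loop_series_single)
    qed
  next
    case comm
    let ?al = "arrow_elem Q (Alpha j l g) :: ('n, 'n gls_arrow) path \<Rightarrow>\<^sub>0 'k"
    have al: "loop_series i ?al = 0" by (simp add: arrow_elem_def loop_series_single)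
    have alc: "?al \<in> carrier kQ" by (rule arrow_closed) (simp add: Q_simps comm(1))
    have e: "eps j \<in> carrier kQ" for j by (rule arrow_closed) (simp add: Q_simps)
    let ?x = "(eps j [^]\<^bsub>kQ\<^esub> a) \<otimes>\<^bsub>kQ\<^esub> ?al" and ?y = "?al \<otimes>\<^bsub>kQ\<^esub> (eps l [^]\<^bsub>kQ\<^esub> b)"
    have xy: "?x \<in> carrier kQ" "?y \<in> carrier kQ" using e alc by auto
    have "loop_series i ?x = 0" "loop_series i ?y = 0" using e alc al by (simp_all add: loop_series_mult)
    moreover have "loop_series i (?x \<ominus>\<^bsub>kQ\<^esub> ?y) + loop_series i ?y = loop_series i (?x \<ominus>\<^bsub>kQ\<^esub> ?y \<oplus>\<^bsub>kQ\<^esub> ?y)"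
      by (simp add: path_algebra_simps loop_series_add)
    moreover have "?x \<ominus>\<^bsub>kQ\<^esub> ?y \<oplus>\<^bsub>kQ\<^esub> ?y = ?x"
      using xy by (simp add: kQ.minus_eq kQ.a_assoc kQ.l_neg)
    ultimately show ?thesis by (simp add: comm(2))
  qed
qed

text \<open>The elements whose series is divisible by X^(d i) form an ideal, because the series is
  multiplicative, and this ideal contains the generators of \<open>J\<close>.\<close>

lemma loop_series_ideal:
  assumes "f \<in> J"
  shows "fps_cutoff (d i) (loop_series i f) = 0"
proof -
  let ?Z = "{f \<in> carrier kQ. fps_cutoff (d i) (loop_series i f) = 0}"
  have cutoff_0: "fps_cutoff (d i) (F * G) = 0" if "fps_cutoff (d i) F = 0 \<or> fps_cutoff (d i) G = 0" for F G :: "'k fps"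
    using that fps_cutoff_mult_cutoff[of "d i" F G] by auto
  have add: "fps_cutoff (d i) (F + G) = fps_cutoff (d i) F + fps_cutoff (d i) G" for F G :: "'k fps"
    by (rule fps_ext) simp
  have "ideal ?Z kQ"
  proof (rule idealI[OF kQ.ring_axioms])
    show "subgroup ?Z (add_monoid kQ)"
    proof (rule kQ.add.subgroupI)
      have "\<zero>\<^bsub>kQ\<^esub> \<in> ?Z" using kQ.zero_closed by (simp add: path_algebra_simps)
      then show "?Z \<noteq> {}" by blast
    next
      fix f assume f: "f \<in> ?Z"
      then have "loop_series i (\<ominus>\<^bsub>kQ\<^esub> f) + loop_series i f = loop_series i (\<ominus>\<^bsub>kQ\<^esub> f \<oplus>\<^bsub>kQ\<^esub> f)"
        by (simp add: path_algebra_simps loop_series_add)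
      also have "\<dots> = 0" using f by (simp add: kQ.l_neg) (simp add: path_algebra_simps)
      finally have "fps_cutoff (d i) (loop_series i (\<ominus>\<^bsub>kQ\<^esub> f) + loop_series i f) = 0" by simp
      then show "\<ominus>\<^bsub>kQ\<^esub> f \<in> ?Z" using f by (simp add: add)
    qed (auto simp: loop_series_add add path_algebra_simps dest: keys_add[THEN subsetD])
  qed (auto simp: loop_series_mult cutoff_0)
  then have "J \<subseteq> ?Z"
    using relations_closed loop_series_relations by (intro kQ.genideal_minimal) auto
  then show ?thesis using assms by blast
qed

text \<open>All representatives of a coset give the same value, as \<open>J\<close> is sent to
  multiples of X^(d i).\<close>

definition loop_proj :: "'n \<Rightarrow> (('n, 'n gls_arrow) path \<Rightarrow>\<^sub>0 'k) set \<Rightarrow> 'k fps" where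
  "loop_proj i S = fps_cutoff (d i) (loop_series i (SOME f. f \<in> S))"

lemma loop_proj:
  assumes "f \<in> carrier kQ"
  shows "loop_proj i (kQ.\<phi> f) = fps_cutoff (d i) (loop_series i f)"
proof -
  have "f \<in> kQ.\<phi> f" using assms by (rule kQ.a_rcos_self)
  then have "(SOME g. g \<in> kQ.\<phi> f) \<in> kQ.\<phi> f" by (rule someI)
  then obtain j where j: "j \<in> J" "(SOME g. g \<in> kQ.\<phi> f) = j \<oplus>\<^bsub>kQ\<^esub> f"
    unfolding a_r_coset_def' by blast
  then have "(SOME g. g \<in> kQ.\<phi> f) = j + f" by (simp add: path_algebra_simps)
  moreover have "fps_cutoff (d i) (F + G) = fps_cutoff (d i) F + fps_cutoff (d i) G" for F G :: "'k fps"
    by (rule fps_ext) simp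
  ultimately show ?thesis
    by (simp add: loop_proj_def loop_series_add loop_series_ideal[OF j(1)])
qed

end

text \<open>\<open>p\<close> is an algebra homomorphism onto k[X]/(X^d), with cut-off series as
  elements, and \<open>x\<close> is a lift of X with the same nilpotency. The bound
  \<open>d \<ge> 2\<close> keeps X from being cut off and makes both 1 and d - 1 positive.\<close>

locale truncated_retract = field_algebra A for A :: "('k::field, 'a) module" (structure) +
  fixes x :: 'a and p :: "'a \<Rightarrow> 'k fps" and d :: nat
  assumes d2: "d \<ge> 2" and x_closed: "x \<in> carrier A" and x_pow: "x [^] d = \<zero>"
    and p_mult: "\<lbrakk>a \<in> carrier A; b \<in> carrier A\<rbrakk> \<Longrightarrow> p (a \<otimes> b) = fps_cutoff d (p a * p b)"
    and p_add: "\<lbrakk>a \<in> carrier A; b \<in> carrier A\<rbrakk> \<Longrightarrow> p (a \<oplus> b) = p a + p b"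
    and p_smult: "a \<in> carrier A \<Longrightarrow> p (c \<odot>\<^bsub>A\<^esub> a) = fps_const c * p a"
    and p_one: "p \<one> = 1" and p_x: "p x = fps_X"

context gls
begin

lemma truncated_retract:
  assumes "d i \<ge> 2"
  shows "truncated_retract kQ.H (kQ.\<phi> (eps i)) (loop_proj i) (d i)"
proof -
  interpret H: field_algebra kQ.H by (rule kQ.H_algebra)
  have e: "eps i \<in> carrier kQ" by (rule arrow_closed) (simp add: Q_simps)
  have add: "fps_cutoff (d i) (F + G) = fps_cutoff (d i) F + fps_cutoff (d i) G" for F G :: "'k fps"
    by (rule fps_ext) simp
  have const: "fps_cutoff (d i) (fps_const c * F) = fps_const c * fps_cutoff (d i) F" for c and F :: "'k fps"
    by (rule fps_ext) simp
  have one: "loop_series i \<one>\<^bsub>kQ\<^esub> = 1"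
  proof -
    have "loop_series i (\<Sum>u\<in>S. Poly_Mapping.single (u, [], u) (1 :: 'k)) = (\<Sum>u\<in>S. if u = i then 1 else 0)"
      if "finite S" for S
      using that by (induction S) (auto simp: loop_series_add loop_series_single)
    then show ?thesis by (simp add: path_algebra_simps Q_simps)
  qed
  show ?thesis
  proof (unfold_locales)
    show "kQ.\<phi> (eps i) \<in> carrier kQ.H" using e by (rule kQ.\<phi>_closed)
    show "kQ.\<phi> (eps i) [^]\<^bsub>kQ.H\<^esub> d i = \<zero>\<^bsub>kQ.H\<^esub>"
      using e eps_pow_relation by (simp add: kQ.\<phi>_pow kQ.\<phi>_ideal)
    show "loop_proj i \<one>\<^bsub>kQ.H\<^esub> = 1"
      using assms by (auto simp: kQ.\<phi>_one loop_proj one intro!: fps_ext)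
    show "loop_proj i (kQ.\<phi> (eps i)) = fps_X"
      using assms e by (auto simp: loop_proj arrow_elem_def Q_simps loop_series_single intro!: fps_ext)
  next
    fix a b assume "a \<in> carrier kQ.H" "b \<in> carrier kQ.H"
    then obtain f g where fg: "f \<in> carrier kQ" "g \<in> carrier kQ" "a = kQ.\<phi> f" "b = kQ.\<phi> g"
      by (elim kQ.H_cases)
    show "loop_proj i (a \<otimes>\<^bsub>kQ.H\<^esub> b) = fps_cutoff (d i) (loop_proj i a * loop_proj i b)"
      using fg by (simp add: kQ.\<phi>_mult loop_proj loop_series_mult fps_cutoff_mult_cutoff)
    have "loop_series i (f \<oplus>\<^bsub>kQ\<^esub> g) = loop_series i f + loop_series i g"
      by (simp add: path_algebra_simps loop_series_add)
    then show "loop_proj i (a \<oplus>\<^bsub>kQ.H\<^esub> b) = loop_proj i a + loop_proj i b"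
      using fg by (simp add: kQ.\<phi>_add loop_proj add)
  next
    fix c a assume "a \<in> carrier kQ.H"
    then obtain f where f: "f \<in> carrier kQ" "a = kQ.\<phi> f" by (elim kQ.H_cases)
    have "loop_series i (c \<odot>\<^bsub>kQ\<^esub> f) = fps_const c * loop_series i f"
      by (simp add: path_algebra_simps loop_series_scale)
    then show "loop_proj i (c \<odot>\<^bsub>kQ.H\<^esub> a) = fps_const c * loop_proj i a"
      using f by (simp add: kQ.\<phi>_smult loop_proj const kQ.sm_closed)
  qed (rule assms)
qed

section \<open>Triangularity when every loop is itself a relation\<close>

lemma path_through_eps:
  assumes d1: "d i = 1" and path: "(u, q, v) \<in> paths Q" "Eps i \<in> set q"
  shows "kQ.\<phi> (Poly_Mapping.single (u, q, v) c) = \<zero>\<^bsub>kQ.H\<^esub>"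
proof -
  from path(2) obtain q1 q2 where q: "q = q1 @ Eps i # q2" by (meson split_list)
  have w: "pre_digraph.awalk Q u q v" using path by (simp add: paths_def)
  have cas: "pre_digraph.cas Q u (q1 @ r) v \<longleftrightarrow> (\<exists>w. pre_digraph.cas Q u q1 w \<and> pre_digraph.cas Q w r v)" for u q1 r
    by (induction q1 arbitrary: u) (auto simp: pre_digraph.cas.simps)
  have *: "(u, q1, i) \<in> paths Q" "(i, q2, v) \<in> paths Q"
    using w by (auto simp: q paths_def pre_digraph.awalk_def cas pre_digraph.cas.simps Q_simps)
  let ?x = "Poly_Mapping.single (i, q2, v) c" and ?y = "Poly_Mapping.single (u, q1, i) (1 :: 'k)"
  \<comment> \<open>For \<open>d i = 1\<close> the nilpotency relation is the loop itself, so the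
    ideal absorbs every path through it.\<close>
  have "eps i \<in> J" using eps_pow_relation[of i] kQ.l_one arrow_closed[of "Eps i"] by (simp add: d1 Q_simps)
  then have "?x \<otimes>\<^bsub>kQ\<^esub> (eps i \<otimes>\<^bsub>kQ\<^esub> ?y) \<in> J"
    using * by (intro kQ.I_l_closed kQ.I_r_closed path_closed)
  moreover have "?x \<otimes>\<^bsub>kQ\<^esub> (eps i \<otimes>\<^bsub>kQ\<^esub> ?y) = Poly_Mapping.single (u, q, v) c"
    by (simp add: path_algebra_simps arrow_elem_def Q_simps path_mult_single path_term_simps q)
  ultimately show ?thesis by (simp add: kQ.\<phi>_ideal)
qed

abbreviation "triv v \<equiv> Poly_Mapping.single (v, [], v) 1 :: ('n, 'n gls_arrow) path \<Rightarrow>\<^sub>0 'k"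

lemma triv_closed: "triv v \<in> carrier kQ"
  by (simp add: path_algebra_simps paths_def pre_digraph.awalk_def pre_digraph.cas.simps Q_simps)

text \<open>Paths through a loop vanish and all others raise the height, so the condition on heights
  leaves only trivial paths. One statement covers the corners, where \<open>v = w\<close>, and the
  vanishing off the diagonal.\<close>

lemma corner:
  assumes d1: "\<And>i. d i = 1" and ht: "ht v \<le> ht w" and r: "r \<in> carrier kQ.H"
  shows "\<exists>c. kQ.\<phi> (triv v) \<otimes>\<^bsub>kQ.H\<^esub> r \<otimes>\<^bsub>kQ.H\<^esub> kQ.\<phi> (triv w) =
     (if v = w then c \<odot>\<^bsub>kQ.H\<^esub> \<one>\<^bsub>kQ.H\<^esub> \<otimes>\<^bsub>kQ.H\<^esub> kQ.\<phi> (triv v) else \<zero>\<^bsub>kQ.H\<^esub>)"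
proof -
  interpret H: field_algebra kQ.H by (rule kQ.H_algebra)
  have scalar: "c \<odot>\<^bsub>kQ.H\<^esub> \<one>\<^bsub>kQ.H\<^esub> \<otimes>\<^bsub>kQ.H\<^esub> kQ.\<phi> (triv v) = c \<odot>\<^bsub>kQ.H\<^esub> kQ.\<phi> (triv v)" for c
    using triv_closed by (simp add: H.sm_mult_left kQ.\<phi>_closed)
  let ?P = "\<lambda>f. \<exists>c. kQ.\<phi> (path_mult (path_mult (triv v) f) (triv w)) = (if v = w then c \<odot>\<^bsub>kQ.H\<^esub> kQ.\<phi> (triv v) else \<zero>\<^bsub>kQ.H\<^esub>)"
  have zero_ex: "\<exists>c. \<zero>\<^bsub>kQ.H\<^esub> = (if v = w then c \<odot>\<^bsub>kQ.H\<^esub> kQ.\<phi> (triv v) else \<zero>\<^bsub>kQ.H\<^esub>)"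
  proof -
    have "0 \<odot>\<^bsub>kQ\<^esub> triv v = \<zero>\<^bsub>kQ\<^esub>"
      by (auto simp: path_algebra_simps lookup_map_times intro!: poly_mapping_eqI)
    then have "0 \<odot>\<^bsub>kQ.H\<^esub> kQ.\<phi> (triv v) = \<zero>\<^bsub>kQ.H\<^esub>" using triv_closed by (simp add: kQ.\<phi>_smult kQ.\<phi>_zero)
    then show ?thesis by (intro exI[of _ 0]) auto
  qed
  have "?P f" if "Poly_Mapping.keys f \<subseteq> paths Q" for f
    using that
  proof (induction f rule: poly_mapping_additive_induct)
    case zero
    have "kQ.\<phi> 0 = \<zero>\<^bsub>kQ.H\<^esub>" using kQ.\<phi>_zero by (simp add: path_algebra_simps)
    then show ?case using zero_ex by simp
  next
    case (single x a)
    obtain u q t where x: "x = (u, q, t)" by (cases x)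
    have prod: "path_mult (path_mult (triv v) (Poly_Mapping.single x a)) (triv w) = (if t = v \<and> u = w then Poly_Mapping.single x a else 0)"
      by (simp add: x path_mult_single path_term_simps)
    have z: "kQ.\<phi> 0 = \<zero>\<^bsub>kQ.H\<^esub>" using kQ.\<phi>_zero by (simp add: path_algebra_simps)
    consider "\<not> (t = v \<and> u = w)" | i where "t = v" "u = w" "Eps i \<in> set q" | "t = v" "u = w" "\<And>i. Eps i \<notin> set q"
      by (cases "t = v \<and> u = w"; cases "\<exists>i. Eps i \<in> set q") auto
    then show ?case
    proof cases
      case 1
      then show ?thesis using zero_ex z by (simp only: prod) simp
    next
      case 2
      then have "kQ.\<phi> (Poly_Mapping.single x a) = \<zero>\<^bsub>kQ.H\<^esub>"
        using path_through_eps[OF d1, of u q t] single by (simp add: x)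
      then show ?thesis using zero_ex 2 by (simp add: prod)
    next
      case 3
      then have "ht w + length q \<le> ht v"
        using awalk_ht[of u q t] single by (auto simp: x paths_def)
      then have "length q = 0" using ht by linarith
      then have q: "q = []" by simp
      have vw: "v = w" using single 3 by (simp add: q x paths_def pre_digraph.awalk_def pre_digraph.cas.simps)
      have "kQ.\<phi> (Poly_Mapping.single (v, [], v) a) = a \<odot>\<^bsub>kQ.H\<^esub> kQ.\<phi> (triv v)"
        by (subst kQ.\<phi>_smult[OF triv_closed]) (simp add: path_algebra_simps)
      then show ?thesis
        unfolding prod using 3(1,2) vw by (intro exI[of _ a]) (simp add: x q)
    qed
  next
    case (add f g)
    let ?e = "\<lambda>f. path_mult (path_mult (triv v) f) (triv w)"
    obtain a where a: "kQ.\<phi> (?e f) = (if v = w then a \<odot>\<^bsub>kQ.H\<^esub> kQ.\<phi> (triv v) else \<zero>\<^bsub>kQ.H\<^esub>)"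
      using add.IH(1) ..
    obtain b where b: "kQ.\<phi> (?e g) = (if v = w then b \<odot>\<^bsub>kQ.H\<^esub> kQ.\<phi> (triv v) else \<zero>\<^bsub>kQ.H\<^esub>)"
      using add.IH(2) ..
    have e_closed: "?e h \<in> carrier kQ" if "Poly_Mapping.keys h \<subseteq> paths Q" for h
    proof -
      have "triv v \<otimes>\<^bsub>kQ\<^esub> h \<otimes>\<^bsub>kQ\<^esub> triv w \<in> carrier kQ"
        using that by (intro kQ.m_closed triv_closed) (simp add: path_algebra_simps)
      then show ?thesis by (simp only: path_algebra_simps)
    qed
    have "kQ.\<phi> (?e f) \<oplus>\<^bsub>kQ.H\<^esub> kQ.\<phi> (?e g) = kQ.\<phi> (?e f \<oplus>\<^bsub>kQ\<^esub> ?e g)"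
      using add.hyps by (intro kQ.\<phi>_add e_closed)
    then have "kQ.\<phi> (?e f + ?e g) = kQ.\<phi> (?e f) \<oplus>\<^bsub>kQ.H\<^esub> kQ.\<phi> (?e g)"
      by (simp only: path_algebra_simps)
    moreover have "?e (f + g) = ?e f + ?e g" by (simp add: path_mult_add_left path_mult_add_right)
    ultimately show ?case
      using triv_closed by (intro exI[of _ "a + b"]) (simp add: a b H.add_sm kQ.\<phi>_closed)
  qed
  note P = this
  obtain f where f: "f \<in> carrier kQ" "r = kQ.\<phi> f" using r by (elim kQ.H_cases)
  have "kQ.\<phi> (triv v) \<otimes>\<^bsub>kQ.H\<^esub> r \<otimes>\<^bsub>kQ.H\<^esub> kQ.\<phi> (triv w) = kQ.\<phi> (path_mult (path_mult (triv v) f) (triv w))"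
    using f(1) triv_closed[of v] triv_closed[of w] kQ.m_closed[OF triv_closed[of v] f(1)]
    by (simp add: f(2) kQ.\<phi>_mult) (simp add: path_algebra_simps)
  moreover have "?P f" using f(1) by (intro P) (simp add: path_algebra_simps)
  ultimately show ?thesis unfolding scalar by simp
qed

lemma triangular:
  assumes d1: "\<And>i. d i = 1"
  shows "triangular_ring kQ.H UNIV (\<lambda>v. kQ.\<phi> (triv v)) (\<lambda>c :: 'k. c \<odot>\<^bsub>kQ.H\<^esub> \<one>\<^bsub>kQ.H\<^esub>) ht"
proof -
  interpret H: field_algebra kQ.H by (rule kQ.H_algebra)
  have e: "kQ.\<phi> (triv v) \<in> carrier kQ.H" for v using triv_closed by (rule kQ.\<phi>_closed)
  have mult: "kQ.\<phi> (triv v) \<otimes>\<^bsub>kQ.H\<^esub> kQ.\<phi> (triv w) = (if v = w then kQ.\<phi> (triv v) else \<zero>\<^bsub>kQ.H\<^esub>)" for v w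
  proof -
    have "triv v \<otimes>\<^bsub>kQ\<^esub> triv w = (if v = w then triv v else \<zero>\<^bsub>kQ\<^esub>)"
      by (simp add: path_algebra_simps path_mult_single path_term_simps)
    then show ?thesis by (simp add: kQ.\<phi>_mult triv_closed kQ.\<phi>_zero)
  qed
  have sum: "(\<Oplus>\<^bsub>kQ.H\<^esub>v\<in>UNIV. kQ.\<phi> (triv v)) = \<one>\<^bsub>kQ.H\<^esub>"
  proof -
    have "(\<Oplus>\<^bsub>kQ.H\<^esub>v\<in>S. kQ.\<phi> (triv v)) = kQ.\<phi> (\<Sum>v\<in>S. triv v) \<and> (\<Sum>v\<in>S. triv v) \<in> carrier kQ" if "finite S" for S
      using that
    proof (induction S)
      case empty
      then show ?case using kQ.\<phi>_zero kQ.zero_closed by (simp add: path_algebra_simps)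
    next
      case (insert v S)
      have "triv v \<oplus>\<^bsub>kQ\<^esub> (\<Sum>v\<in>S. triv v) \<in> carrier kQ" using insert triv_closed by (intro kQ.add.m_closed) auto
      moreover have "kQ.\<phi> (triv v) \<oplus>\<^bsub>kQ.H\<^esub> kQ.\<phi> (\<Sum>v\<in>S. triv v) = kQ.\<phi> (triv v \<oplus>\<^bsub>kQ\<^esub> (\<Sum>v\<in>S. triv v))"
        using insert triv_closed by (intro kQ.\<phi>_add) auto
      moreover have "triv v \<oplus>\<^bsub>kQ\<^esub> (\<Sum>v\<in>S. triv v) = triv v + (\<Sum>v\<in>S. triv v)" by (simp add: path_algebra_simps)
      ultimately show ?case using insert e by simp
    qed
    from this[of UNIV] show ?thesis by (simp add: kQ.\<phi>_one) (simp add: path_algebra_simps Q_simps)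
  qed
  show ?thesis
  proof (unfold_locales)
    fix v w r assume "r \<in> carrier kQ.H" "v \<noteq> w" "ht v \<le> ht w"
    then show "kQ.\<phi> (triv v) \<otimes>\<^bsub>kQ.H\<^esub> r \<otimes>\<^bsub>kQ.H\<^esub> kQ.\<phi> (triv w) = \<zero>\<^bsub>kQ.H\<^esub>"
      using corner[OF d1, of v w r] by simp
  next
    fix v r assume "r \<in> carrier kQ.H"
    then show "\<exists>c :: 'k. kQ.\<phi> (triv v) \<otimes>\<^bsub>kQ.H\<^esub> r \<otimes>\<^bsub>kQ.H\<^esub> kQ.\<phi> (triv v) =
       c \<odot>\<^bsub>kQ.H\<^esub> \<one>\<^bsub>kQ.H\<^esub> \<otimes>\<^bsub>kQ.H\<^esub> kQ.\<phi> (triv v)"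
      using corner[OF d1, of v v r] by simp
  next
    show "(c * d) \<odot>\<^bsub>kQ.H\<^esub> \<one>\<^bsub>kQ.H\<^esub> = c \<odot>\<^bsub>kQ.H\<^esub> \<one>\<^bsub>kQ.H\<^esub> \<otimes>\<^bsub>kQ.H\<^esub> (d \<odot>\<^bsub>kQ.H\<^esub> \<one>\<^bsub>kQ.H\<^esub>)" for c d :: 'k
      by (simp add: H.sm_mult_left H.mult_sm H.sm_closed)
  qed (simp_all add: e mult sum H.add_sm H.one_sm H.sm_closed H.sm_mult_left H.sm_mult_right)
qed

end

section \<open>Tensor products\<close>

lemmas frag_diff_induct = free_Abelian_group_induct [consumes 1, case_names zero diff of]

context abelian_group
begin

lemma add_pow_int_0 [simp]: "[(0 :: int)] \<cdot> x = \<zero>"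
  by (simp add: add_pow_int_ge)

lemma frag_eval_superset:
  assumes "Poly_Mapping.keys f \<subseteq> S" "finite S" "h \<in> S \<rightarrow> carrier G"
  shows "frag_eval G h f = (\<Oplus>p\<in>S. [Poly_Mapping.lookup f p] \<cdot> h p)"
  unfolding frag_eval_def
  using assms by (intro add.finprod_mono_neutral_cong_left) (auto simp: in_keys_iff Pi_def subset_eq)

lemma frag_eval_closed:
  assumes "Poly_Mapping.keys f \<subseteq> S" "h \<in> S \<rightarrow> carrier G"
  shows "frag_eval G h f \<in> carrier G"
  unfolding frag_eval_def using assms by (intro finsum_closed) auto

lemma frag_eval_add:
  assumes "Poly_Mapping.keys f \<subseteq> S" "Poly_Mapping.keys g \<subseteq> S" "h \<in> S \<rightarrow> carrier G"
  shows "frag_eval G h (f + g) = frag_eval G h f \<oplus> frag_eval G h g"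
proof -
  let ?S = "Poly_Mapping.keys f \<union> Poly_Mapping.keys g"
  have h: "h p \<in> carrier G" if "p \<in> ?S" for p using assms that by blast
  have "frag_eval G h (f + g) = (\<Oplus>p\<in>?S. [Poly_Mapping.lookup (f + g) p] \<cdot> h p)"
    using keys_add[of f g] h by (intro frag_eval_superset) auto
  also have "\<dots> = (\<Oplus>p\<in>?S. [Poly_Mapping.lookup f p] \<cdot> h p \<oplus> [Poly_Mapping.lookup g p] \<cdot> h p)"
    using h by (intro finsum_cong' refl) (auto simp: lookup_add add.int_pow_mult)
  also have "\<dots> = (\<Oplus>p\<in>?S. [Poly_Mapping.lookup f p] \<cdot> h p) \<oplus> (\<Oplus>p\<in>?S. [Poly_Mapping.lookup g p] \<cdot> h p)"
    using h by (intro finsum_addf) auto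
  also have "\<dots> = frag_eval G h f \<oplus> frag_eval G h g"
    using h by (intro arg_cong2[of _ _ _ _ "add G"] frag_eval_superset[symmetric]) auto
  finally show ?thesis .
qed

lemma frag_eval_zero [simp]: "frag_eval G h 0 = \<zero>"
  by (simp add: frag_eval_def)

lemma frag_eval_of [simp]: "h p \<in> carrier G \<Longrightarrow> frag_eval G h (frag_of p) = h p"
  by (simp add: frag_eval_def)

lemma frag_eval_diff:
  assumes "Poly_Mapping.keys f \<subseteq> S" "Poly_Mapping.keys g \<subseteq> S" "h \<in> S \<rightarrow> carrier G"
  shows "frag_eval G h (f - g) = frag_eval G h f \<ominus> frag_eval G h g"
proof -
  have "Poly_Mapping.keys (f - g) \<subseteq> S" using assms keys_diff[of f g] by blast
  then have "frag_eval G h (f - g + g) = frag_eval G h (f - g) \<oplus> frag_eval G h g"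
    using assms by (intro frag_eval_add)
  moreover have "frag_eval G h (f - g) \<in> carrier G" "frag_eval G h g \<in> carrier G"
    using frag_eval_closed[OF _ assms(3)] \<open>Poly_Mapping.keys (f - g) \<subseteq> S\<close> assms(2) by auto
  ultimately show ?thesis by (simp add: minus_eq a_assoc r_neg)
qed

end

text \<open>An additive map can be moved inside a formal sum. Compatibility with scalars from the
  enveloping algebra is thereby reduced to single pairs.\<close>

lemma hom_frag_eval:
  assumes M: "abelian_group M" and N: "abelian_group N"
    and hom: "\<phi> \<in> carrier M \<rightarrow> carrier N" "\<And>x y. \<lbrakk>x \<in> carrier M; y \<in> carrier M\<rbrakk> \<Longrightarrow> \<phi> (x \<oplus>\<^bsub>M\<^esub> y) = \<phi> x \<oplus>\<^bsub>N\<^esub> \<phi> y"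
    and f: "Poly_Mapping.keys f \<subseteq> S" "h \<in> S \<rightarrow> carrier M"
  shows "\<phi> (frag_eval M h f) = frag_eval N (\<lambda>p. \<phi> (h p)) f"
proof -
  interpret M: abelian_group M by fact
  interpret N: abelian_group N by fact
  have h': "(\<lambda>p. \<phi> (h p)) \<in> S \<rightarrow> carrier N" using hom f by auto
  have zero: "\<phi> \<zero>\<^bsub>M\<^esub> = \<zero>\<^bsub>N\<^esub>"
    using hom(2)[of "\<zero>\<^bsub>M\<^esub>" "\<zero>\<^bsub>M\<^esub>"] hom(1) by (simp add: Pi_def)
  have minus: "\<phi> (x \<ominus>\<^bsub>M\<^esub> y) = \<phi> x \<ominus>\<^bsub>N\<^esub> \<phi> y" if "x \<in> carrier M" "y \<in> carrier M" for x y
  proof -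
    have "\<phi> (x \<ominus>\<^bsub>M\<^esub> y) \<oplus>\<^bsub>N\<^esub> \<phi> y = \<phi> (x \<ominus>\<^bsub>M\<^esub> y \<oplus>\<^bsub>M\<^esub> y)" using that by (simp add: hom(2))
    then have "\<phi> x = \<phi> (x \<ominus>\<^bsub>M\<^esub> y) \<oplus>\<^bsub>N\<^esub> \<phi> y" using that by (simp add: M.minus_eq M.a_assoc M.l_neg)
    moreover have "\<phi> (x \<ominus>\<^bsub>M\<^esub> y) \<in> carrier N" "\<phi> y \<in> carrier N" using hom(1) that by auto
    ultimately show ?thesis by (simp add: N.minus_eq N.a_assoc N.r_neg)
  qed
  show ?thesis
    using f(1)
  proof (induction f rule: frag_diff_induct)
    case (diff f g)
    then show ?case
      using M.frag_eval_closed[OF _ f(2)] minus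
      by (simp add: M.frag_eval_diff[OF _ _ f(2)] N.frag_eval_diff[OF _ _ h'])
  next
    case (of a)
    then show ?case using f(2) h' by (simp add: Pi_def)
  qed (simp add: zero)
qed

text \<open>The locale is used twice: for \<open>A\<close> and its opposite over the field, and for
  \<open>envR\<close> with a term of a resolution over the enveloping algebra. Closure of the
  operations places the relations in the free group.\<close>

locale tensor_modules =
  fixes R :: "('r, 'b) ring_scheme" and U :: "('r, 'x) module" and V :: "('r, 'y) module"
  assumes U_add: "\<lbrakk>x \<in> carrier U; x' \<in> carrier U\<rbrakk> \<Longrightarrow> x \<oplus>\<^bsub>U\<^esub> x' \<in> carrier U"
    and V_add: "\<lbrakk>y \<in> carrier V; y' \<in> carrier V\<rbrakk> \<Longrightarrow> y \<oplus>\<^bsub>V\<^esub> y' \<in> carrier V"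
    and U_smult: "\<lbrakk>r \<in> carrier R; x \<in> carrier U\<rbrakk> \<Longrightarrow> r \<odot>\<^bsub>U\<^esub> x \<in> carrier U"
    and V_smult: "\<lbrakk>r \<in> carrier R; y \<in> carrier V\<rbrakk> \<Longrightarrow> r \<odot>\<^bsub>V\<^esub> y \<in> carrier V"
begin

abbreviation "FG \<equiv> free_Abelian_group (carrier U \<times> carrier V)"
abbreviation "TK \<equiv> tensor_kernel R U V"

lemma keys_frag_diff: "\<lbrakk>Poly_Mapping.keys f \<subseteq> S; Poly_Mapping.keys g \<subseteq> S\<rbrakk> \<Longrightarrow> Poly_Mapping.keys (f - g) \<subseteq> S"
  using keys_diff[of f g] by blast

lemma relations_carrier: "tensor_relations R U V \<subseteq> carrier FG"
proof -
  have of: "Poly_Mapping.keys (frag_of p) \<subseteq> carrier U \<times> carrier V" if "p \<in> carrier U \<times> carrier V" for p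
    using that by simp
  show ?thesis
    unfolding tensor_relations_def
    by (safe; simp only: carrier_free_Abelian_group_iff)
      (intro keys_frag_diff of; simp add: U_add V_add U_smult V_smult)+
qed

lemma kernel_subgroup: "subgroup TK FG"
  unfolding tensor_kernel_def by (intro group.generate_is_subgroup group_free_Abelian_group relations_carrier)

lemma kernel_carrier: "f \<in> TK \<Longrightarrow> Poly_Mapping.keys f \<subseteq> carrier U \<times> carrier V"
  using subgroup.subset[OF kernel_subgroup, THEN subsetD] by (simp only: carrier_free_Abelian_group_iff)

lemma kernel_zero: "0 \<in> TK"
  using subgroup.one_closed[OF kernel_subgroup] by simp

lemma kernel_add: "\<lbrakk>f \<in> TK; g \<in> TK\<rbrakk> \<Longrightarrow> f + g \<in> TK"
  using subgroup.m_closed[OF kernel_subgroup, of f g] by simp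

lemma kernel_uminus: "f \<in> TK \<Longrightarrow> - f \<in> TK"
  using subgroup.m_inv_closed[OF kernel_subgroup, of f] kernel_carrier[of f] by simp

lemma kernel_diff: "\<lbrakk>f \<in> TK; g \<in> TK\<rbrakk> \<Longrightarrow> f - g \<in> TK"
  using kernel_add[OF _ kernel_uminus, of f g] by simp

lemma kernel_relation: "f \<in> tensor_relations R U V \<Longrightarrow> f \<in> TK"
  unfolding tensor_kernel_def by (rule generate.incl)

text \<open>Closure under differences takes care of inverses in the generated subgroup, since the
  inverse of a generator is its difference from 0.\<close>

lemma kernel_induct [consumes 1, case_names zero add_left add_right balanced diff]:
  assumes "f \<in> TK" "P 0"
    and "\<And>x x' y. \<lbrakk>x \<in> carrier U; x' \<in> carrier U; y \<in> carrier V\<rbrakk> \<Longrightarrow> P (frag_of (x \<oplus>\<^bsub>U\<^esub> x', y) - frag_of (x, y) - frag_of (x', y))"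
    and "\<And>x y y'. \<lbrakk>x \<in> carrier U; y \<in> carrier V; y' \<in> carrier V\<rbrakk> \<Longrightarrow> P (frag_of (x, y \<oplus>\<^bsub>V\<^esub> y') - frag_of (x, y) - frag_of (x, y'))"
    and "\<And>r x y. \<lbrakk>r \<in> carrier R; x \<in> carrier U; y \<in> carrier V\<rbrakk> \<Longrightarrow> P (frag_of (r \<odot>\<^bsub>U\<^esub> x, y) - frag_of (x, r \<odot>\<^bsub>V\<^esub> y))"
    and diff: "\<And>f g. \<lbrakk>f \<in> TK; g \<in> TK; P f; P g\<rbrakk> \<Longrightarrow> P (f - g)"
  shows "P f"
proof -
  have rel: "P f" if "f \<in> tensor_relations R U V" for f
    using that assms(3-5) unfolding tensor_relations_def by blast
  have uminus: "P (- f)" if "f \<in> TK" "P f" for f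
    using diff[OF kernel_zero that(1) assms(2) that(2)] by simp
  have "f \<in> TK \<and> P f"
    using assms(1) unfolding tensor_kernel_def
  proof (induction rule: generate.induct)
    case one
    then show ?case using kernel_zero assms(2) by (simp add: tensor_kernel_def)
  next
    case (incl h)
    then show ?case using rel by (auto intro: generate.incl)
  next
    case (inv h)
    then have "inv\<^bsub>FG\<^esub> h = - h" using relations_carrier by auto
    then show ?case using inv uminus[of h] rel[of h] kernel_relation[of h] kernel_uminus[of h] by (simp add: tensor_kernel_def)
  next
    case (eng f g)
    then have "P (f - (- g))" using uminus kernel_uminus by (intro diff) (auto simp: tensor_kernel_def)
    then show ?case using eng kernel_add[of f g] by (simp add: tensor_kernel_def)
  qed
  then show ?thesis ..
qed

lemma class_eq: "tensor_class R U V f = {t + f | t. t \<in> TK}"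
  by (auto simp: tensor_class_def r_coset_def)

lemma class_self: "f \<in> tensor_class R U V f"
  unfolding class_eq using kernel_zero by force

lemma class_eqI: "f - g \<in> TK \<Longrightarrow> tensor_class R U V f = tensor_class R U V g"
proof -
  assume fg: "f - g \<in> TK"
  show ?thesis
    unfolding class_eq
  proof safe
    fix t assume t: "t \<in> TK"
    show "\<exists>s. t + f = s + g \<and> s \<in> TK" using kernel_add[OF t fg] by (intro exI[of _ "t + (f - g)"]) simp
    show "\<exists>s. t + g = s + f \<and> s \<in> TK" using kernel_diff[OF t fg] by (intro exI[of _ "t - (f - g)"]) simp
  qed
qed

text \<open>Universal property of the tensor product: a balanced biadditive map annihilates the
  defining relations, so its additive extension factors through the quotient.\<close>

lemma frag_eval_kernel:
  assumes N: "abelian_group N" and h: "\<And>x y. \<lbrakk>x \<in> carrier U; y \<in> carrier V\<rbrakk> \<Longrightarrow> h (x, y) \<in> carrier N"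
    and "\<And>x x' y. \<lbrakk>x \<in> carrier U; x' \<in> carrier U; y \<in> carrier V\<rbrakk> \<Longrightarrow> h (x \<oplus>\<^bsub>U\<^esub> x', y) = h (x, y) \<oplus>\<^bsub>N\<^esub> h (x', y)"
    and "\<And>x y y'. \<lbrakk>x \<in> carrier U; y \<in> carrier V; y' \<in> carrier V\<rbrakk> \<Longrightarrow> h (x, y \<oplus>\<^bsub>V\<^esub> y') = h (x, y) \<oplus>\<^bsub>N\<^esub> h (x, y')"
    and "\<And>r x y. \<lbrakk>r \<in> carrier R; x \<in> carrier U; y \<in> carrier V\<rbrakk> \<Longrightarrow> h (r \<odot>\<^bsub>U\<^esub> x, y) = h (x, r \<odot>\<^bsub>V\<^esub> y)"
    and f: "f \<in> TK"
  shows "frag_eval N h f = \<zero>\<^bsub>N\<^esub>"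
proof -
  interpret N: abelian_group N by fact
  let ?S = "carrier U \<times> carrier V"
  have hS: "h \<in> ?S \<rightarrow> carrier N" using h by auto
  have of: "frag_eval N h (frag_of p) = h p" if "p \<in> ?S" for p
    by (rule N.frag_eval_of) (use hS that in blast)
  have cancel: "(a \<oplus>\<^bsub>N\<^esub> b) \<ominus>\<^bsub>N\<^esub> a \<ominus>\<^bsub>N\<^esub> b = \<zero>\<^bsub>N\<^esub>" if "a \<in> carrier N" "b \<in> carrier N" for a b
    using that by (simp add: N.minus_eq N.a_comm[of a b] N.a_assoc N.r_neg)
  have hdiff: "frag_eval N h (f - g) = frag_eval N h f \<ominus>\<^bsub>N\<^esub> frag_eval N h g"
    if "Poly_Mapping.keys f \<subseteq> ?S" "Poly_Mapping.keys g \<subseteq> ?S" for f g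
    using that hS by (rule N.frag_eval_diff)
  have of_closed: "Poly_Mapping.keys (frag_of p) \<subseteq> ?S" if "p \<in> ?S" for p using that by simp
  show ?thesis
    using f
  proof (induction rule: kernel_induct)
    case (add_left x x' y)
    then have "(x, y) \<in> ?S" "(x', y) \<in> ?S" "(x \<oplus>\<^bsub>U\<^esub> x', y) \<in> ?S" using U_add by auto
    then show ?case
      using assms(3) add_left h cancel by (simp only: hdiff keys_frag_diff of_closed of)
  next
    case (add_right x y y')
    then have "(x, y) \<in> ?S" "(x, y') \<in> ?S" "(x, y \<oplus>\<^bsub>V\<^esub> y') \<in> ?S" using V_add by auto
    then show ?case
      using assms(4) add_right h cancel by (simp only: hdiff keys_frag_diff of_closed of)
  next
    case (balanced r x y)
    then have "(r \<odot>\<^bsub>U\<^esub> x, y) \<in> ?S" "(x, r \<odot>\<^bsub>V\<^esub> y) \<in> ?S" using U_smult V_smult by auto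
    then show ?case
      using assms(5) balanced h V_smult by (simp only: hdiff of_closed of) (simp add: N.minus_eq N.r_neg)
  next
    case (diff f g)
    then show ?case using kernel_carrier by (simp add: hdiff N.minus_eq)
  qed simp
qed

lemma frag_eval_class:
  assumes "abelian_group N" "\<And>x y. \<lbrakk>x \<in> carrier U; y \<in> carrier V\<rbrakk> \<Longrightarrow> h (x, y) \<in> carrier N"
    and "\<And>x x' y. \<lbrakk>x \<in> carrier U; x' \<in> carrier U; y \<in> carrier V\<rbrakk> \<Longrightarrow> h (x \<oplus>\<^bsub>U\<^esub> x', y) = h (x, y) \<oplus>\<^bsub>N\<^esub> h (x', y)"
    and "\<And>x y y'. \<lbrakk>x \<in> carrier U; y \<in> carrier V; y' \<in> carrier V\<rbrakk> \<Longrightarrow> h (x, y \<oplus>\<^bsub>V\<^esub> y') = h (x, y) \<oplus>\<^bsub>N\<^esub> h (x, y')"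
    and "\<And>r x y. \<lbrakk>r \<in> carrier R; x \<in> carrier U; y \<in> carrier V\<rbrakk> \<Longrightarrow> h (r \<odot>\<^bsub>U\<^esub> x, y) = h (x, r \<odot>\<^bsub>V\<^esub> y)"
    and f: "Poly_Mapping.keys f \<subseteq> carrier U \<times> carrier V" and g: "g \<in> tensor_class R U V f"
  shows "frag_eval N h g = frag_eval N h f"
proof -
  interpret N: abelian_group N by fact
  have hS: "h \<in> carrier U \<times> carrier V \<rightarrow> carrier N" using assms(2) by auto
  obtain t where t: "t \<in> TK" "g = t + f" using g by (auto simp: class_eq)
  have "frag_eval N h t = \<zero>\<^bsub>N\<^esub>" by (rule frag_eval_kernel[OF assms(1-5) t(1)])
  then show ?thesis
    using N.frag_eval_add[OF kernel_carrier[OF t(1)] f hS] N.frag_eval_closed[OF f hS] by (simp add: t(2))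
qed

end

section \<open>Enveloping algebras\<close>

text \<open>\<open>frag_eval\<close> depends on the additive group alone, including the inverses
  used for negative multiplicities. The records \<open>A\<close>, \<open>envL\<close>,
  \<open>envR\<close> share this group but not their other fields, and the same is true of
  \<open>trunc\<close> and \<open>trunc_group\<close>.\<close>

lemma frag_eval_cong_scheme:
  assumes "carrier M = carrier N" "add M = add N" "\<zero>\<^bsub>M\<^esub> = \<zero>\<^bsub>N\<^esub>"
  shows "frag_eval M h f = frag_eval N h f"
proof -
  have inv: "inv\<^bsub>add_monoid M\<^esub> x = inv\<^bsub>add_monoid N\<^esub> x" for x
    unfolding m_inv_def by (simp add: assms)
  have "[n] \<cdot>\<^bsub>M\<^esub> x = [n] \<cdot>\<^bsub>N\<^esub> x" for n :: int and x
    unfolding add_pow_def int_pow_def nat_pow_def Let_def inv by (simp add: assms)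
  then show ?thesis
    unfolding frag_eval_def finsum_def finprod_def by (simp add: assms)
qed

lemma additive_zero:
  assumes M: "abelian_group M" and N: "abelian_group N" and closed: "\<phi> \<zero>\<^bsub>M\<^esub> \<in> carrier N"
    and add: "\<phi> (\<zero>\<^bsub>M\<^esub> \<oplus>\<^bsub>M\<^esub> \<zero>\<^bsub>M\<^esub>) = \<phi> \<zero>\<^bsub>M\<^esub> \<oplus>\<^bsub>N\<^esub> \<phi> \<zero>\<^bsub>M\<^esub>"
  shows "\<phi> \<zero>\<^bsub>M\<^esub> = \<zero>\<^bsub>N\<^esub>"
proof -
  interpret M: abelian_group M by fact
  interpret N: abelian_group N by fact
  show ?thesis using add closed by simp
qed

lemma additive_minus:
  assumes M: "abelian_group M" and N: "abelian_group N" and closed: "\<And>x. x \<in> carrier M \<Longrightarrow> \<phi> x \<in> carrier N"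
    and add: "\<And>x y. \<lbrakk>x \<in> carrier M; y \<in> carrier M\<rbrakk> \<Longrightarrow> \<phi> (x \<oplus>\<^bsub>M\<^esub> y) = \<phi> x \<oplus>\<^bsub>N\<^esub> \<phi> y"
    and xy: "x \<in> carrier M" "y \<in> carrier M"
  shows "\<phi> (x \<ominus>\<^bsub>M\<^esub> y) = \<phi> x \<ominus>\<^bsub>N\<^esub> \<phi> y"
proof -
  interpret M: abelian_group M by fact
  interpret N: abelian_group N by fact
  have "\<phi> (x \<ominus>\<^bsub>M\<^esub> y) \<oplus>\<^bsub>N\<^esub> \<phi> y = \<phi> (x \<ominus>\<^bsub>M\<^esub> y \<oplus>\<^bsub>M\<^esub> y)" using xy by (simp add: add)
  then have "\<phi> x = \<phi> (x \<ominus>\<^bsub>M\<^esub> y) \<oplus>\<^bsub>N\<^esub> \<phi> y" using xy by (simp add: M.minus_eq M.a_assoc M.l_neg)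
  moreover have "\<phi> (x \<ominus>\<^bsub>M\<^esub> y) \<in> carrier N" "\<phi> y \<in> carrier N" using closed xy by auto
  ultimately show ?thesis by (simp add: N.minus_eq N.a_assoc N.r_neg)
qed

lemma ring_of_type_algebra_simps [simp]:
  "carrier ring_of_type_algebra = UNIV" "add ring_of_type_algebra = (+)" "zero ring_of_type_algebra = 0"
  "monoid.mult ring_of_type_algebra = (*)" "one ring_of_type_algebra = 1"
  by (simp_all add: ring_of_type_algebra_def)

lemma opposite_ring_simps [simp]:
  "carrier (opposite_ring A) = carrier A" "add (opposite_ring A) = add A" "zero (opposite_ring A) = zero A"
  "one (opposite_ring A) = one A" "monoid.mult (opposite_ring A) = (\<lambda>x y. y \<otimes>\<^bsub>A\<^esub> x)"
  by (simp_all add: opposite_ring_def)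

lemma opposite_ring_smult [simp]: "module.smult (opposite_ring A) = module.smult A"
  by (simp add: opposite_ring_def)

context field_algebra
begin

abbreviation "K \<equiv> ring_of_type_algebra :: 'k ring"
abbreviation "AA \<equiv> carrier A \<times> carrier A"

sublocale tm: tensor_modules K A "opposite_ring A"
  by unfold_locales (simp_all add: sm_closed)

definition frag_mult :: "('a \<times> 'a \<Rightarrow>\<^sub>0 int) \<Rightarrow> ('a \<times> 'a \<Rightarrow>\<^sub>0 int) \<Rightarrow> ('a \<times> 'a \<Rightarrow>\<^sub>0 int)" where
  "frag_mult f g = frag_extend (\<lambda>(a, b). frag_extend (\<lambda>(a', b'). frag_of (a \<otimes> a', b' \<otimes> b)) g) f"

lemma frag_mult_of [simp]: "frag_mult (frag_of (a, b)) (frag_of (a', b')) = frag_of (a \<otimes> a', b' \<otimes> b)"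
  by (simp add: frag_mult_def)

lemma frag_mult_zero [simp]: "frag_mult 0 f = 0" "frag_mult f 0 = 0"
  by (simp_all add: frag_mult_def frag_extend_eq_0 split_def)

lemma frag_mult_diff_left: "frag_mult (f - g) h = frag_mult f h - frag_mult g h"
  by (simp add: frag_mult_def frag_extend_diff)

lemma frag_mult_diff_right: "frag_mult f (g - h) = frag_mult f g - frag_mult f h"
  using subset_UNIV
proof (induction f rule: frag_diff_induct)
  case (of p)
  show ?case by (cases p) (simp add: frag_mult_def frag_extend_diff)
qed (simp_all add: frag_mult_diff_left)

lemma frag_mult_uminus: "frag_mult (- f) g = - frag_mult f g" "frag_mult f (- g) = - frag_mult f g"
  using frag_mult_diff_left[of 0 f g] frag_mult_diff_right[of f 0 g] by simp_all

lemma frag_mult_add_left: "frag_mult (f + g) h = frag_mult f h + frag_mult g h"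
  using frag_mult_diff_left[of f "- g" h] by (simp add: frag_mult_uminus)

lemma frag_mult_add_right: "frag_mult f (g + h) = frag_mult f g + frag_mult f h"
  using frag_mult_diff_right[of f g "- h"] by (simp add: frag_mult_uminus)

lemma frag_mult_closed:
  assumes "Poly_Mapping.keys f \<subseteq> AA" "Poly_Mapping.keys g \<subseteq> AA"
  shows "Poly_Mapping.keys (frag_mult f g) \<subseteq> AA"
  using assms(1)
proof (induction f rule: frag_diff_induct)
  case (of p)
  show ?case
    using assms(2)
  proof (induction g rule: frag_diff_induct)
    case (of q)
    then show ?case using \<open>p \<in> AA\<close> by (cases p; cases q) simp
  next
    case (diff f g)
    show ?case unfolding frag_mult_diff_right using diff by (intro tm.keys_frag_diff)
  qed simp
next
  case (diff f h)
  show ?case unfolding frag_mult_diff_left using diff by (intro tm.keys_frag_diff)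
qed simp

lemma frag_mult_assoc:
  assumes "Poly_Mapping.keys f \<subseteq> AA" "Poly_Mapping.keys g \<subseteq> AA" "Poly_Mapping.keys h \<subseteq> AA"
  shows "frag_mult (frag_mult f g) h = frag_mult f (frag_mult g h)"
  using assms(1)
proof (induction f rule: frag_diff_induct)
  case (of p)
  show ?case
    using assms(2)
  proof (induction g rule: frag_diff_induct)
    case (of q)
    show ?case
      using assms(3)
    proof (induction h rule: frag_diff_induct)
      case (of r)
      then show ?case using \<open>p \<in> AA\<close> \<open>q \<in> AA\<close> by (cases p; cases q; cases r) (simp add: m_assoc)
    qed (simp_all add: frag_mult_diff_right)
  qed (simp_all add: frag_mult_diff_left frag_mult_diff_right)
qed (simp_all add: frag_mult_diff_left)

lemma frag_mult_one:
  assumes "Poly_Mapping.keys f \<subseteq> AA"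
  shows "frag_mult (frag_of (\<one>, \<one>)) f = f" "frag_mult f (frag_of (\<one>, \<one>)) = f"
proof -
  have "frag_mult (frag_of (\<one>, \<one>)) f = f \<and> frag_mult f (frag_of (\<one>, \<one>)) = f"
    using assms
  proof (induction f rule: frag_diff_induct)
    case (of p)
    then show ?case by (cases p) simp
  qed (simp_all add: frag_mult_diff_left frag_mult_diff_right)
  then show "frag_mult (frag_of (\<one>, \<one>)) f = f" "frag_mult f (frag_of (\<one>, \<one>)) = f" by auto
qed

text \<open>Formal sums of pairs, before the tensor relations are imposed. The enveloping algebra is
  the quotient of this ring by an ideal, which yields its ring axioms.\<close>

definition frag_ring :: "('a \<times> 'a \<Rightarrow>\<^sub>0 int) ring" where
  "frag_ring = \<lparr>carrier = {f. Poly_Mapping.keys f \<subseteq> AA}, monoid.mult = frag_mult, one = frag_of (\<one>, \<one>),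
     zero = 0, add = (+)\<rparr>"

lemma frag_ring_simps:
  "carrier frag_ring = {f. Poly_Mapping.keys f \<subseteq> AA}" "monoid.mult frag_ring = frag_mult"
  "one frag_ring = frag_of (\<one>, \<one>)" "zero frag_ring = 0" "add frag_ring = (+)"
  by (simp_all add: frag_ring_def)

lemma add_monoid_frag_ring: "add_monoid frag_ring = tm.FG"
  by (simp add: frag_ring_simps free_Abelian_group_def)

sublocale fr: ring frag_ring
proof (intro ringI abelian_groupI monoidI; (simp only: frag_ring_simps mem_Collect_eq)?)
  fix f g :: "'a \<times> 'a \<Rightarrow>\<^sub>0 int" assume f: "Poly_Mapping.keys f \<subseteq> AA"
  show "\<exists>g\<in>{f. Poly_Mapping.keys f \<subseteq> AA}. g + f = 0" using f by (intro bexI[of _ "- f"]) simp_all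
  assume g: "Poly_Mapping.keys g \<subseteq> AA"
  show "Poly_Mapping.keys (f + g) \<subseteq> AA" using f g keys_add[of f g] by blast
qed (simp_all add: add_ac frag_mult_closed frag_mult_assoc frag_mult_one frag_mult_add_left frag_mult_add_right)

text \<open>Multiplying a tensor relation by a pair, on either side, gives a tensor relation of the
  same kind: additivity follows from distributivity, balance from the bilinearity of the
  product.\<close>

lemma frag_mult_kernel_of:
  assumes p: "p \<in> AA" and t: "t \<in> tm.TK"
  shows "frag_mult (frag_of p) t \<in> tm.TK \<and> frag_mult t (frag_of p) \<in> tm.TK"
proof -
  obtain a b where ab: "p = (a, b)" "a \<in> carrier A" "b \<in> carrier A" using p by auto
  have left: "frag_of (x \<oplus> x', y) - frag_of (x, y) - frag_of (x', y) \<in> tm.TK"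
    if "x \<in> carrier A" "x' \<in> carrier A" "y \<in> carrier A" for x x' y
    using that by (intro tm.kernel_relation) (auto simp: tensor_relations_def)
  have right: "frag_of (x, y \<oplus> y') - frag_of (x, y) - frag_of (x, y') \<in> tm.TK"
    if "x \<in> carrier A" "y' \<in> carrier A" "y \<in> carrier A" for x y' y
    using that by (intro tm.kernel_relation) (auto simp: tensor_relations_def)
  have bal: "frag_of (c \<odot>\<^bsub>A\<^esub> x, y) - frag_of (x, c \<odot>\<^bsub>A\<^esub> y) \<in> tm.TK" if "x \<in> carrier A" "y \<in> carrier A" for c x y
    using that by (intro tm.kernel_relation) (auto simp: tensor_relations_def)
  show ?thesis
    using t
  proof (induction t rule: tm.kernel_induct)
    case (add_left x x' y)
    then show ?case
      using ab left[of "a \<otimes> x" "a \<otimes> x'" "y \<otimes> b"] left[of "x \<otimes> a" "x' \<otimes> a" "b \<otimes> y"]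
      by (simp add: frag_mult_diff_left frag_mult_diff_right l_distr r_distr)
  next
    case (add_right x y y')
    then show ?case
      using ab right[of "a \<otimes> x" "y' \<otimes> b" "y \<otimes> b"] right[of "x \<otimes> a" "b \<otimes> y'" "b \<otimes> y"]
      by (simp add: frag_mult_diff_left frag_mult_diff_right l_distr r_distr)
  next
    case (balanced r x y)
    then show ?case
      using ab bal[of "a \<otimes> x" "y \<otimes> b" r] bal[of "x \<otimes> a" "b \<otimes> y" r]
      by (simp add: frag_mult_diff_left frag_mult_diff_right sm_mult_left sm_mult_right)
  next
    case (diff f g)
    then show ?case by (simp add: frag_mult_diff_left frag_mult_diff_right tm.kernel_diff)
  qed (simp add: tm.kernel_zero)
qed

lemma frag_mult_kernel:
  assumes f: "Poly_Mapping.keys f \<subseteq> AA" and t: "t \<in> tm.TK"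
  shows "frag_mult f t \<in> tm.TK \<and> frag_mult t f \<in> tm.TK"
  using f
proof (induction f rule: frag_diff_induct)
  case (of p)
  then show ?case using frag_mult_kernel_of t by blast
next
  case (diff f g)
  then show ?case by (simp add: frag_mult_diff_left frag_mult_diff_right tm.kernel_diff)
qed (simp add: tm.kernel_zero)

sublocale fr: ideal tm.TK frag_ring
proof (rule idealI[OF fr.ring_axioms])
  show "subgroup tm.TK (add_monoid frag_ring)"
    using tm.kernel_subgroup by (simp only: add_monoid_frag_ring)
qed (simp_all add: frag_ring_simps frag_mult_kernel)

abbreviation "env \<equiv> enveloping_algebra K A"
abbreviation "cls \<equiv> tensor_class K A (opposite_ring A)"

lemma cls_eq: "cls f = tm.TK +>\<^bsub>frag_ring\<^esub> f"
  by (simp only: tensor_class_def a_r_coset_def add_monoid_frag_ring opposite_ring_simps)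

text \<open>The product in \<open>algebra_tensor\<close> is a union over representatives, which is
  literally the product of cosets in a quotient ring.\<close>

lemma env_eq: "env = frag_ring Quot tm.TK"
proof -
  have carrier: "carrier (tensor K A (opposite_ring A)) = a_rcosets\<^bsub>frag_ring\<^esub> tm.TK"
    by (simp only: tensor_def FactGroup_def A_RCOSETS_def add_monoid_frag_ring partial_object.simps opposite_ring_simps)
  have mult: "(\<Union>f\<in>S. \<Union>g\<in>T. cls (frag_extend (\<lambda>(a, b). frag_extend (\<lambda>(a', b'). frag_of (a \<otimes> a', b \<otimes>\<^bsub>opposite_ring A\<^esub> b')) g) f))
      = rcoset_mult frag_ring tm.TK S T" for S T
    by (simp add: rcoset_mult_def cls_eq frag_ring_simps frag_mult_def)
  have one: "cls (frag_of (\<one>, \<one>\<^bsub>opposite_ring A\<^esub>)) = tm.TK +>\<^bsub>frag_ring\<^esub> \<one>\<^bsub>frag_ring\<^esub>"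
    by (simp only: cls_eq frag_ring_simps opposite_ring_simps)
  have zero: "one (tensor K A (opposite_ring A)) = tm.TK"
    by (simp only: tensor_def FactGroup_def monoid.simps)
  have add: "monoid.mult (tensor K A (opposite_ring A)) = set_add frag_ring"
    by (simp only: tensor_def FactGroup_def monoid.simps set_add_def add_monoid_frag_ring opposite_ring_simps)
  show ?thesis
    unfolding enveloping_algebra_def algebra_tensor_def FactRing_def
    by (simp only: carrier mult one zero add)
qed

sublocale env: ring env
  unfolding env_eq by (rule fr.quotient_is_ring)

lemma cls_closed: "f \<in> carrier frag_ring \<Longrightarrow> cls f \<in> carrier env"
  by (simp add: env_eq cls_eq FactRing_def fr.a_rcosetsI fr.a_subset)

lemma env_cases: "T \<in> carrier env \<Longrightarrow> (\<And>f. f \<in> carrier frag_ring \<Longrightarrow> T = cls f \<Longrightarrow> P) \<Longrightarrow> P"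
  by (auto simp: env_eq FactRing_def A_RCOSETS_def' cls_eq)

lemma cls_mult: "\<lbrakk>f \<in> carrier frag_ring; g \<in> carrier frag_ring\<rbrakk> \<Longrightarrow> cls f \<otimes>\<^bsub>env\<^esub> cls g = cls (frag_mult f g)"
  by (simp add: env_eq cls_eq FactRing_def fr.rcoset_mult_add frag_ring_simps(2))

lemma cls_add: "\<lbrakk>f \<in> carrier frag_ring; g \<in> carrier frag_ring\<rbrakk> \<Longrightarrow> cls f \<oplus>\<^bsub>env\<^esub> cls g = cls (f + g)"
  by (simp add: env_eq cls_eq FactRing_def fr.a_rcos_sum frag_ring_simps(5))

lemma cls_one: "\<one>\<^bsub>env\<^esub> = cls (frag_of (\<one>, \<one>))"
  by (simp add: env_eq cls_eq FactRing_def frag_ring_simps(3))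

lemma cls_kernel: "t \<in> tm.TK \<Longrightarrow> cls t = \<zero>\<^bsub>env\<^esub>"
  by (simp add: env_eq cls_eq FactRing_def fr.a_rcos_const)

lemma frag_ring_diff: "\<lbrakk>f \<in> carrier frag_ring; g \<in> carrier frag_ring\<rbrakk> \<Longrightarrow> f - g \<in> carrier frag_ring"
  by (simp add: frag_ring_simps tm.keys_frag_diff)

lemma cls_diff:
  assumes "f \<in> carrier frag_ring" "g \<in> carrier frag_ring"
  shows "cls f \<ominus>\<^bsub>env\<^esub> cls g = cls (f - g)"
proof -
  have fg: "f - g \<in> carrier frag_ring" using assms by (rule frag_ring_diff)
  have "cls (f - g) \<oplus>\<^bsub>env\<^esub> cls g = cls f" using cls_add[OF fg assms(2)] by simp
  then have "cls f = cls (f - g) \<oplus>\<^bsub>env\<^esub> cls g" by simp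
  then show ?thesis using assms fg by (simp add: env.minus_eq env.a_assoc env.r_neg cls_closed)
qed

end

text \<open>Separated from \<open>env_action\<close> because of \<open>envR\<close>: its action is
  biadditive and balanced, but composes in the opposite order, so that it satisfies the law of a
  right module instead of \<open>act_mult\<close>.\<close>

locale env_biadditive = field_algebra A for A :: "('k::field, 'a) module" (structure) +
  fixes N :: "(('a \<times> 'a \<Rightarrow>\<^sub>0 int) set, 'n) module" and act :: "'a \<Rightarrow> 'a \<Rightarrow> 'n \<Rightarrow> 'n"
  assumes N: "abelian_group N"
    and act_closed: "\<lbrakk>a \<in> carrier A; b \<in> carrier A; x \<in> carrier N\<rbrakk> \<Longrightarrow> act a b x \<in> carrier N"
    and act_add_left: "\<lbrakk>a \<in> carrier A; a' \<in> carrier A; b \<in> carrier A; x \<in> carrier N\<rbrakk> \<Longrightarrow> act (a \<oplus> a') b x = act a b x \<oplus>\<^bsub>N\<^esub> act a' b x"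
    and act_add_right: "\<lbrakk>a \<in> carrier A; b \<in> carrier A; b' \<in> carrier A; x \<in> carrier N\<rbrakk> \<Longrightarrow> act a (b \<oplus> b') x = act a b x \<oplus>\<^bsub>N\<^esub> act a b' x"
    and act_balanced: "\<lbrakk>a \<in> carrier A; b \<in> carrier A; x \<in> carrier N\<rbrakk> \<Longrightarrow> act (c \<odot>\<^bsub>A\<^esub> a) b x = act a (c \<odot>\<^bsub>A\<^esub> b) x"
    and smult_N: "\<And>T x. T \<odot>\<^bsub>N\<^esub> x = the_elem (frag_eval N (\<lambda>(a, b). act a b x) ` T)"
begin

lemma act_fun: "x \<in> carrier N \<Longrightarrow> (\<lambda>(a, b). act a b x) \<in> AA \<rightarrow> carrier N"
  using act_closed by auto

text \<open>A balanced biadditive action has one value on all representatives of a coset, so the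
  \<open>the_elem\<close> in the definition returns that value.\<close>

lemma smult_cls:
  assumes f: "f \<in> carrier frag_ring" and x: "x \<in> carrier N"
  shows "cls f \<odot>\<^bsub>N\<^esub> x = frag_eval N (\<lambda>(a, b). act a b x) f"
proof -
  let ?h = "\<lambda>(a, b). act a b x"
  have "frag_eval N ?h g = frag_eval N ?h f" if "g \<in> cls f" for g
    using f that x by (intro tm.frag_eval_class[OF N])
      (simp_all add: act_closed act_add_left act_add_right act_balanced frag_ring_simps)
  then have "frag_eval N ?h ` cls f = {frag_eval N ?h f}"
    using tm.class_self[of f] by blast
  then show ?thesis by (simp add: smult_N)
qed

lemma smult_cls_of: "\<lbrakk>a \<in> carrier A; b \<in> carrier A; x \<in> carrier N\<rbrakk> \<Longrightarrow> cls (frag_of (a, b)) \<odot>\<^bsub>N\<^esub> x = act a b x"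
proof -
  interpret N: abelian_group N by (rule N)
  assume "a \<in> carrier A" "b \<in> carrier A" "x \<in> carrier N"
  then show ?thesis by (subst smult_cls) (simp_all add: frag_ring_simps act_closed)
qed

lemma smult_cls_closed: "\<lbrakk>T \<in> carrier env; x \<in> carrier N\<rbrakk> \<Longrightarrow> T \<odot>\<^bsub>N\<^esub> x \<in> carrier N"
  using abelian_group.frag_eval_closed[OF N _ act_fun]
  by (elim env_cases) (simp add: smult_cls frag_ring_simps)

lemma smult_cls_diff:
  assumes "f \<in> carrier frag_ring" "g \<in> carrier frag_ring" "x \<in> carrier N"
  shows "cls (f - g) \<odot>\<^bsub>N\<^esub> x = cls f \<odot>\<^bsub>N\<^esub> x \<ominus>\<^bsub>N\<^esub> cls g \<odot>\<^bsub>N\<^esub> x"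
proof -
  have "f - g \<in> carrier frag_ring" using assms(1,2) by (rule frag_ring_diff)
  then show ?thesis
    using assms abelian_group.frag_eval_diff[OF N _ _ act_fun]
    by (simp add: smult_cls frag_ring_simps)
qed

end

locale env_action = env_biadditive +
  assumes act_add: "\<lbrakk>a \<in> carrier A; b \<in> carrier A; x \<in> carrier N; y \<in> carrier N\<rbrakk> \<Longrightarrow> act a b (x \<oplus>\<^bsub>N\<^esub> y) = act a b x \<oplus>\<^bsub>N\<^esub> act a b y"
    and act_mult: "\<lbrakk>a \<in> carrier A; b \<in> carrier A; a' \<in> carrier A; b' \<in> carrier A; x \<in> carrier N\<rbrakk> \<Longrightarrow>
      act (a \<otimes> a') (b' \<otimes> b) x = act a b (act a' b' x)"
    and act_one: "x \<in> carrier N \<Longrightarrow> act \<one> \<one> x = x"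
begin

lemma env_left_module: "left_module env N"
proof -
  interpret N: abelian_group N by (rule N)
  let ?h = "\<lambda>x (a, b). act a b x"
  have act_zero: "act a b \<zero>\<^bsub>N\<^esub> = \<zero>\<^bsub>N\<^esub>" if "a \<in> carrier A" "b \<in> carrier A" for a b
    by (rule additive_zero[OF N N]) (simp_all add: that act_closed flip: act_add)
  have minus: "act a b (x \<ominus>\<^bsub>N\<^esub> y) = act a b x \<ominus>\<^bsub>N\<^esub> act a b y"
    if "a \<in> carrier A" "b \<in> carrier A" "x \<in> carrier N" "y \<in> carrier N" for a b x y
    by (rule additive_minus[OF N N]) (simp_all add: that act_closed act_add)
  have closed: "frag_eval N (?h x) f \<in> carrier N" if "Poly_Mapping.keys f \<subseteq> AA" "x \<in> carrier N" for f x
    by (rule N.frag_eval_closed[OF that(1) act_fun[OF that(2)]])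
  have eval_diff: "frag_eval N (?h x) (f - g) = frag_eval N (?h x) f \<ominus>\<^bsub>N\<^esub> frag_eval N (?h x) g"
    if "Poly_Mapping.keys f \<subseteq> AA" "Poly_Mapping.keys g \<subseteq> AA" "x \<in> carrier N" for f g x
    by (rule N.frag_eval_diff[OF that(1,2) act_fun[OF that(3)]])
  have eval_of: "frag_eval N (?h x) (frag_of p) = ?h x p" if "p \<in> AA" "x \<in> carrier N" for p x
    by (rule N.frag_eval_of) (use act_fun[OF that(2)] that(1) in blast)
  have ab: "(a \<oplus>\<^bsub>N\<^esub> b) \<ominus>\<^bsub>N\<^esub> (c \<oplus>\<^bsub>N\<^esub> d) = (a \<ominus>\<^bsub>N\<^esub> c) \<oplus>\<^bsub>N\<^esub> (b \<ominus>\<^bsub>N\<^esub> d)"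
    if "a \<in> carrier N" "b \<in> carrier N" "c \<in> carrier N" "d \<in> carrier N" for a b c d
    using that by (simp add: N.minus_eq N.minus_add N.add.m_ac)
  have add: "frag_eval N (?h (x \<oplus>\<^bsub>N\<^esub> y)) f = frag_eval N (?h x) f \<oplus>\<^bsub>N\<^esub> frag_eval N (?h y) f"
    if "Poly_Mapping.keys f \<subseteq> AA" "x \<in> carrier N" "y \<in> carrier N" for f x y
    using that(1)
  proof (induction f rule: frag_diff_induct)
    case (of p)
    then show ?case using that(2,3) act_add act_closed by (cases p) simp
  next
    case (diff f g)
    then show ?case
      using that(2,3) by (simp add: ab closed eval_diff)
  qed simp
  have mult_of: "frag_eval N (?h x) (frag_mult (frag_of p) g) = ?h (frag_eval N (?h x) g) p"
    if "p \<in> AA" "Poly_Mapping.keys g \<subseteq> AA" "x \<in> carrier N" for p g x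
    using that(2)
  proof (induction g rule: frag_diff_induct)
    case zero
    then show ?case using that(1) act_zero by (cases p) simp
  next
    case (of q)
    then show ?case using that act_mult act_closed by (cases p; cases q) simp
  next
    case (diff f g)
    have "Poly_Mapping.keys (frag_mult (frag_of p) f) \<subseteq> AA" "Poly_Mapping.keys (frag_mult (frag_of p) g) \<subseteq> AA"
      using that(1) diff(1,2) by (intro frag_mult_closed; simp)+
    then show ?case
      using that(1,3) diff by (cases p) (simp add: frag_mult_diff_right closed minus eval_diff)
  qed
  have mult: "frag_eval N (?h x) (frag_mult f g) = frag_eval N (?h (frag_eval N (?h x) g)) f"
    if "Poly_Mapping.keys f \<subseteq> AA" "Poly_Mapping.keys g \<subseteq> AA" "x \<in> carrier N" for f g x
    using that(1)
  proof (induction f rule: frag_diff_induct)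
    case (of p)
    have "frag_eval N (?h (frag_eval N (?h x) g)) (frag_of p) = ?h (frag_eval N (?h x) g) p"
      using of eval_of that closed act_closed by (cases p) simp
    then show ?case using mult_of[OF of that(2,3)] by simp
  next
    case (diff f h)
    have "Poly_Mapping.keys (frag_mult f g) \<subseteq> AA" "Poly_Mapping.keys (frag_mult h g) \<subseteq> AA"
      using that(2) diff(1,2) by (intro frag_mult_closed; simp)+
    then show ?case
      using that(2,3) diff by (simp add: frag_mult_diff_left closed eval_diff)
  qed simp
  show ?thesis
  proof (rule left_moduleI[OF env.ring_axioms N])
    fix S T x assume S: "S \<in> carrier env" and T: "T \<in> carrier env" and x: "x \<in> carrier N"
    obtain f where f: "f \<in> carrier frag_ring" "S = cls f" using S by (elim env_cases)
    obtain g where g: "g \<in> carrier frag_ring" "T = cls g" using T by (elim env_cases)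
    have fg: "Poly_Mapping.keys f \<subseteq> AA" "Poly_Mapping.keys g \<subseteq> AA" using f g by (simp_all add: frag_ring_simps)
    have "f + g \<in> carrier frag_ring" "frag_mult f g \<in> carrier frag_ring"
      using fr.add.m_closed[OF f(1) g(1)] fr.m_closed[OF f(1) g(1)] by (simp_all add: frag_ring_simps)
    then show "(S \<oplus>\<^bsub>env\<^esub> T) \<odot>\<^bsub>N\<^esub> x = S \<odot>\<^bsub>N\<^esub> x \<oplus>\<^bsub>N\<^esub> T \<odot>\<^bsub>N\<^esub> x"
      and "(S \<otimes>\<^bsub>env\<^esub> T) \<odot>\<^bsub>N\<^esub> x = S \<odot>\<^bsub>N\<^esub> (T \<odot>\<^bsub>N\<^esub> x)"
      using f g x fg closed N.frag_eval_add[OF _ _ act_fun] mult[OF fg x]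
      by (simp_all add: cls_add cls_mult smult_cls)
  next
    fix S x y assume S: "S \<in> carrier env" and x: "x \<in> carrier N" and y: "y \<in> carrier N"
    obtain f where f: "f \<in> carrier frag_ring" "S = cls f" using S by (elim env_cases)
    then show "S \<odot>\<^bsub>N\<^esub> (x \<oplus>\<^bsub>N\<^esub> y) = S \<odot>\<^bsub>N\<^esub> x \<oplus>\<^bsub>N\<^esub> S \<odot>\<^bsub>N\<^esub> y"
      using x y add by (simp add: smult_cls frag_ring_simps)
  qed (simp_all add: smult_cls_closed cls_one smult_cls_of act_one)
qed

end

context field_algebra
begin

abbreviation "envL \<equiv> enveloping_left_module A"
abbreviation "envR \<equiv> enveloping_right_module A"

lemma env_module_simps [simp]:
  "carrier envL = carrier A" "add envL = add A" "zero envL = \<zero>"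
  "carrier envR = carrier A" "add envR = add A" "zero envR = \<zero>"
  by (simp_all add: enveloping_left_module_def enveloping_right_module_def ring.defs module.defs)

lemma env_module_smult:
  "T \<odot>\<^bsub>envL\<^esub> x = the_elem (frag_eval A (\<lambda>(a, b). a \<otimes> x \<otimes> b) ` T)"
  "T \<odot>\<^bsub>envR\<^esub> x = the_elem (frag_eval A (\<lambda>(a, b). b \<otimes> x \<otimes> a) ` T)"
  by (simp_all add: enveloping_left_module_def enveloping_right_module_def ring.defs module.defs)

lemma env_module_frag_eval: "frag_eval envL h f = frag_eval A h f" "frag_eval envR h f = frag_eval A h f"
  by (intro frag_eval_cong_scheme; simp)+

lemma env_module_abelian_group: "abelian_group envL" "abelian_group envR"
proof -
  show "abelian_group envL" by (rule abelian_groupI) (simp_all add: add.m_ac add.l_inv_ex)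
  show "abelian_group envR" by (rule abelian_groupI) (simp_all add: add.m_ac add.l_inv_ex)
qed

sublocale envL: env_action A envL "\<lambda>a b x. a \<otimes> x \<otimes> b"
  by (intro env_action.intro env_biadditive.intro env_biadditive_axioms.intro env_action_axioms.intro
      field_algebra_axioms env_module_abelian_group)
    (simp_all add: l_distr r_distr sm_mult_left sm_mult_right m_assoc sm_closed env_module_smult env_module_frag_eval)

sublocale envR: env_biadditive A envR "\<lambda>a b x. b \<otimes> x \<otimes> a"
  by (intro env_biadditive.intro env_biadditive_axioms.intro field_algebra_axioms env_module_abelian_group)
    (simp_all add: l_distr r_distr sm_mult_left sm_mult_right m_assoc sm_closed env_module_smult env_module_frag_eval)

end

section \<open>Lifting along modules of other types\<close>

definition transport_module :: "('x \<Rightarrow> 'p) \<Rightarrow> ('r, 'x) module \<Rightarrow> ('r, 'p) module" where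
  "transport_module \<tau> M = (let i = inv_into (carrier M) \<tau> in
     \<lparr>carrier = \<tau> ` carrier M, monoid.mult = undefined, one = undefined, zero = \<tau> \<zero>\<^bsub>M\<^esub>,
      add = (\<lambda>u v. \<tau> (i u \<oplus>\<^bsub>M\<^esub> i v)), module.smult = (\<lambda>r u. \<tau> (r \<odot>\<^bsub>M\<^esub> i u))\<rparr>)"

lemma transport_module:
  assumes M: "left_module R M" and \<tau>: "inj_on \<tau> (carrier M)"
  shows "left_module R (transport_module \<tau> M)"
    and "\<tau> \<in> module_hom R M (transport_module \<tau> M)"
    and "inv_into (carrier M) \<tau> \<in> module_hom R (transport_module \<tau> M) M"
proof -
  interpret M: left_module R M by fact
  let ?T = "transport_module \<tau> M"
  have simps: "carrier ?T = \<tau> ` carrier M" "\<zero>\<^bsub>?T\<^esub> = \<tau> \<zero>\<^bsub>M\<^esub>"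
    "x \<in> carrier M \<Longrightarrow> y \<in> carrier M \<Longrightarrow> \<tau> x \<oplus>\<^bsub>?T\<^esub> \<tau> y = \<tau> (x \<oplus>\<^bsub>M\<^esub> y)"
    "x \<in> carrier M \<Longrightarrow> r \<odot>\<^bsub>?T\<^esub> \<tau> x = \<tau> (r \<odot>\<^bsub>M\<^esub> x)" for x y r
    using \<tau> by (simp_all add: transport_module_def Let_def)
  have "abelian_group ?T"
  proof (rule abelian_groupI)
    fix u assume "u \<in> carrier ?T"
    then obtain x where x: "x \<in> carrier M" "u = \<tau> x" by (auto simp: simps)
    show "\<exists>v\<in>carrier ?T. v \<oplus>\<^bsub>?T\<^esub> u = \<zero>\<^bsub>?T\<^esub>"
      by (rule bexI[of _ "\<tau> (\<ominus>\<^bsub>M\<^esub> x)"]) (use x in \<open>simp_all add: simps M.l_neg\<close>)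
  qed (auto simp: simps M.add.m_ac)
  then show "left_module R ?T"
    by (rule left_moduleI[OF M.R.ring_axioms])
      (auto simp: simps M.smult_l_distr M.smult_r_distr M.smult_assoc1)
  show "\<tau> \<in> module_hom R M ?T" by (rule module_homI) (simp_all add: simps)
  show "inv_into (carrier M) \<tau> \<in> module_hom R ?T M"
    using \<tau> by (intro module_homI) (auto simp: simps)
qed

text \<open>\<open>projective_module\<close> tests lifting only against modules with elements in
  \<open>'p\<close>. Injections carry \<open>M\<close> and \<open>N\<close> into that type; the lift
  found there is carried back.\<close>

lemma projective_lift:
  fixes P :: "('r, 'p) module" and M :: "('r, 'x) module" and N :: "('r, 'y) module"
  assumes P: "projective_module R P" and M: "left_module R M" and N: "left_module R N"
    and \<sigma>: "inj_on (\<sigma> :: 'x \<Rightarrow> 'p) (carrier M)" and \<tau>: "inj_on (\<tau> :: 'y \<Rightarrow> 'p) (carrier N)"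
    and g: "g \<in> module_hom R M N" "g ` carrier M = carrier N" and f: "f \<in> module_hom R P N"
  shows "\<exists>h\<in>module_hom R P M. \<forall>x\<in>carrier P. g (h x) = f x"
proof -
  let ?M = "transport_module \<sigma> M" and ?N = "transport_module \<tau> N"
  let ?i = "inv_into (carrier M) \<sigma>"
  note MT = transport_module[OF M \<sigma>]
  note NT = transport_module[OF N \<tau>]
  have i: "?i (\<sigma> x) = x" if "x \<in> carrier M" for x using that \<sigma> by simp
  have cM: "carrier ?M = \<sigma> ` carrier M" and cN: "carrier ?N = \<tau> ` carrier N" by (simp_all add: transport_module_def Let_def)
  let ?g = "\<lambda>u. \<tau> (g (?i u))"
  have g': "?g \<in> module_hom R ?M ?N" by (intro module_hom_comp[OF _ NT(2)] module_hom_comp[OF MT(3) g(1)])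
  have surj: "?g ` carrier ?M = carrier ?N"
  proof -
    have "?g ` carrier ?M = \<tau> ` (g ` carrier M)" unfolding cM image_image by (intro image_cong refl) (simp add: i)
    then show ?thesis by (simp add: g(2) cN)
  qed
  have f': "(\<lambda>x. \<tau> (f x)) \<in> module_hom R P ?N" by (rule module_hom_comp[OF f NT(2)])
  obtain h where h: "h \<in> module_hom R P ?M" "\<And>x. x \<in> carrier P \<Longrightarrow> ?g (h x) = \<tau> (f x)"
    using P MT(1) NT(1) g' surj f' unfolding projective_module_def by blast
  show ?thesis
  proof (intro bexI ballI)
    show "(\<lambda>x. ?i (h x)) \<in> module_hom R P M" by (rule module_hom_comp[OF h(1) MT(3)])
    fix x assume x: "x \<in> carrier P"
    have "?i (h x) \<in> carrier M" using module_hom_closed[OF h(1) x] by (auto simp: cM i)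
    then have "g (?i (h x)) \<in> carrier N" by (rule module_hom_closed[OF g(1)])
    moreover have "f x \<in> carrier N" using module_hom_closed[OF f x] .
    ultimately show "g (?i (h x)) = f x" using h(2)[OF x] \<tau> by (simp add: inj_on_eq_iff)
  qed
qed

lemma (in abelian_group) minus_zero_right: "x \<in> carrier G \<Longrightarrow> x \<ominus> \<zero> = x"
  using r_neg[of \<zero>] l_zero[of "\<ominus> \<zero>"] by (simp add: minus_eq)

section \<open>Hochschild homology of an algebra with a truncated polynomial retract\<close>

lemma fps_cutoff_add: "fps_cutoff e (F + G) = fps_cutoff e F + fps_cutoff e G" for F G :: "'k::field fps"
  by (rule fps_ext) simp

lemma fps_cutoff_mult_cutoff_le:
  "e \<le> d \<Longrightarrow> fps_cutoff e (fps_cutoff d F * G) = fps_cutoff e (F * G)" for F G :: "'k::field fps"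
  by (auto intro!: fps_ext sum.cong simp: fps_mult_nth)

text \<open>The witness is the series with its coefficients moved down by \<open>b\<close>. Nothing
  is lost, as the first \<open>b\<close> coefficients and those from \<open>d\<close> on are
  zero.\<close>

lemma fps_cutoff_exact:
  fixes q :: "'k::field fps"
  assumes "fps_cutoff d q = q" "\<And>i. i < b \<Longrightarrow> q $ i = 0"
  shows "\<exists>q'. fps_cutoff d q' = q' \<and> q = fps_cutoff d (fps_X ^ b * q')"
proof (intro exI conjI)
  have q: "q $ i = 0" if "i \<ge> d" for i
  proof -
    have "fps_cutoff d q $ i = 0" using that by simp
    then show ?thesis using assms(1) by simp
  qed
  show "fps_cutoff d (fps_shift b q) = fps_shift b q" using q by (intro fps_ext) simp
  show "q = fps_cutoff d (fps_X ^ b * fps_shift b q)"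
    using q assms(2) by (intro fps_ext) (simp add: fps_X_power_mult_nth)
qed

context truncated_retract
begin

section \<open>The test bimodules k[X]/(X^e)\<close>

abbreviation "\<eta> a \<equiv> p a $ 0"

text \<open>The additive group comes first because the scalar action of \<open>trunc\<close> is
  itself a \<open>frag_eval\<close> in this group.\<close>

definition trunc_group :: "nat \<Rightarrow> (('a \<times> 'a \<Rightarrow>\<^sub>0 int) set, 'k fps) module" where
  "trunc_group e = \<lparr>carrier = {F. fps_cutoff e F = F}, monoid.mult = undefined, one = undefined, zero = 0, add = (+),
     module.smult = undefined\<rparr>"

definition trunc_act :: "nat \<Rightarrow> 'a \<Rightarrow> 'a \<Rightarrow> 'k fps \<Rightarrow> 'k fps" where
  "trunc_act e a b q = fps_cutoff e (p a * fps_const (\<eta> b) * q)"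

text \<open>\<open>k[X]/(X\<^sup>e)\<close>, on which \<open>a \<otimes> b\<close> acts as multiplication by \<open>p a\<close> and by the constant term of \<open>p b\<close>\<close>

definition trunc :: "nat \<Rightarrow> (('a \<times> 'a \<Rightarrow>\<^sub>0 int) set, 'k fps) module" where
  "trunc e = (trunc_group e)\<lparr>module.smult := \<lambda>T q. the_elem (frag_eval (trunc_group e) (\<lambda>(a, b). trunc_act e a b q) ` T)\<rparr>"

lemma trunc_simps [simp]: "carrier (trunc e) = {F. fps_cutoff e F = F}" "add (trunc e) = (+)" "zero (trunc e) = 0"
  by (simp_all add: trunc_def trunc_group_def)

lemma trunc_abelian_group: "abelian_group (trunc e)"
proof (rule abelian_groupI)
  fix F assume "F \<in> carrier (trunc e)"
  moreover have "fps_cutoff e (- F) = - fps_cutoff e F" by (rule fps_ext) simp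
  ultimately have "fps_cutoff e (- F) = - F" by simp
  then show "\<exists>G\<in>carrier (trunc e). G \<oplus>\<^bsub>trunc e\<^esub> F = \<zero>\<^bsub>trunc e\<^esub>" by (intro bexI[of _ "- F"]) simp_all
qed (simp_all add: fps_cutoff_add)

lemma \<eta>_mult: "\<lbrakk>a \<in> carrier A; b \<in> carrier A\<rbrakk> \<Longrightarrow> \<eta> (a \<otimes> b) = \<eta> a * \<eta> b"
  using d2 by (simp add: p_mult)

text \<open>\<open>p\<close> is multiplicative only modulo X^d, and cutting off at
  \<open>e \<le> d\<close> hides the difference. The cases used are \<open>e = d\<close>, for the
  terms of the periodic complex, and \<open>e = 1\<close>, for the simple module that it
  resolves.\<close>

lemma trunc_action:
  assumes e: "1 \<le> e" "e \<le> d"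
  shows "env_action A (trunc e) (trunc_act e)"
proof (intro env_action.intro env_biadditive.intro env_biadditive_axioms.intro env_action_axioms.intro
      field_algebra_axioms trunc_abelian_group)
  show "T \<odot>\<^bsub>trunc e\<^esub> q = the_elem (frag_eval (trunc e) (\<lambda>(a, b). trunc_act e a b q) ` T)" for T q
  proof -
    have eq: "frag_eval (trunc e) h = frag_eval (trunc_group e) h" for h :: "'a \<times> 'a \<Rightarrow> 'k fps"
      by (intro ext frag_eval_cong_scheme) (simp_all add: trunc_group_def)
    show ?thesis unfolding eq by (simp add: trunc_def)
  qed
  have p_mult': "fps_cutoff e (p (a \<otimes> b) * q) = fps_cutoff e (p a * p b * q)" if "a \<in> carrier A" "b \<in> carrier A" for a b q
    using that e by (simp add: p_mult fps_cutoff_mult_cutoff_le)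
  fix a a' b b' q assume ab: "a \<in> carrier A" "b \<in> carrier A" "a' \<in> carrier A" "b' \<in> carrier A" "q \<in> carrier (trunc e)"
  have "trunc_act e (a \<otimes> a') (b' \<otimes> b) q = fps_cutoff e (p (a \<otimes> a') * (fps_const (\<eta> (b' \<otimes> b)) * q))"
    by (simp add: trunc_act_def mult.assoc)
  also have "\<dots> = fps_cutoff e (p a * p a' * (fps_const (\<eta> (b' \<otimes> b)) * q))" using ab by (simp add: p_mult')
  also have "\<dots> = fps_cutoff e (p a * fps_const (\<eta> b) * (p a' * fps_const (\<eta> b') * q))"
    using ab by (simp add: \<eta>_mult fps_const_mult[symmetric] mult_ac del: fps_const_mult)
  also have "\<dots> = trunc_act e a b (trunc_act e a' b' q)"
    by (simp add: trunc_act_def fps_cutoff_mult_cutoff)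
  finally show "trunc_act e (a \<otimes> a') (b' \<otimes> b) q = trunc_act e a b (trunc_act e a' b' q)" .
qed (simp_all add: trunc_act_def p_add p_smult fps_cutoff_add distrib_left distrib_right fps_const_add[symmetric]
       fps_const_mult[symmetric] mult_ac p_one fps_cutoff_mult_cutoff(1)[of e _ 1, simplified] del: fps_const_add fps_const_mult)

lemma d_ge_1: "1 \<le> d" using d2 by simp

sublocale trunc: env_action A "trunc d" "trunc_act d"
  by (rule trunc_action[OF d_ge_1 order_refl])

lemma trunc_left_module: "1 \<le> e \<Longrightarrow> e \<le> d \<Longrightarrow> left_module env (trunc e)"
  by (rule env_action.env_left_module[OF trunc_action])

text \<open>\<open>projective_lift\<close> needs series to fit into the element type of the
  resolution. The coefficient at \<open>n\<close> is stored, as a multiple of 1 in \<open>A\<close>,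
  at the lists of length \<open>n\<close>, and \<open>p\<close> recovers it from there.\<close>

lemma trunc_embedding:
  "inj_on (\<lambda>F (l :: ('r + 's) list). {frag_of ((F $ length l) \<odot>\<^bsub>A\<^esub> \<one>, \<one>)}) S"
proof (rule inj_onI)
  fix F G assume eq: "(\<lambda>l :: ('r + 's) list. {frag_of ((F $ length l) \<odot>\<^bsub>A\<^esub> \<one>, \<one>)}) = (\<lambda>l. {frag_of ((G $ length l) \<odot>\<^bsub>A\<^esub> \<one>, \<one>)})"
  show "F = G"
  proof (rule fps_ext)
    fix n
    have "(F $ n) \<odot>\<^bsub>A\<^esub> \<one> = (G $ n) \<odot>\<^bsub>A\<^esub> \<one>"
      using fun_cong[OF eq, of "replicate n undefined"] by (simp add: frag_of_eq)
    then have "p ((F $ n) \<odot>\<^bsub>A\<^esub> \<one>) = p ((G $ n) \<odot>\<^bsub>A\<^esub> \<one>)" by simp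
    then show "F $ n = G $ n" by (simp add: p_smult p_one)
  qed
qed

section \<open>The two periodic elements of the enveloping algebra\<close>

abbreviation "lx \<equiv> cls (frag_of (x, \<one>))"
abbreviation "rx \<equiv> cls (frag_of (\<one>, x))"

lemma frag_of_closed: "\<lbrakk>a \<in> carrier A; b \<in> carrier A\<rbrakk> \<Longrightarrow> frag_of (a, b) \<in> carrier frag_ring"
  by (simp add: frag_ring_simps)

lemma lx_closed: "lx \<in> carrier env"
  by (rule cls_closed[OF frag_of_closed[OF x_closed one_closed]])

lemma rx_closed: "rx \<in> carrier env"
  by (rule cls_closed[OF frag_of_closed[OF one_closed x_closed]])

text \<open>The additivity relation for 0 + 0 is, up to sign, the element in question.\<close>

lemma frag_of_zero:
  assumes a: "a \<in> carrier A"
  shows "frag_of (\<zero>, a) \<in> tm.TK" "frag_of (a, \<zero>) \<in> tm.TK"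
proof -
  have "frag_of (x \<oplus> x', y) - frag_of (x, y) - frag_of (x', y) \<in> tm.TK"
    if "x \<in> carrier A" "x' \<in> carrier A" "y \<in> carrier A" for x x' y
    using that by (intro tm.kernel_relation) (auto simp: tensor_relations_def)
  from this[OF zero_closed zero_closed a]
  have 1: "frag_of (\<zero>, a) - frag_of (\<zero>, a) - frag_of (\<zero>, a) \<in> tm.TK"
    unfolding l_zero[OF zero_closed] .
  have "frag_of (x, y \<oplus> y') - frag_of (x, y) - frag_of (x, y') \<in> tm.TK"
    if "x \<in> carrier A" "y' \<in> carrier A" "y \<in> carrier A" for x y' y
    using that by (intro tm.kernel_relation) (auto simp: tensor_relations_def)
  from this[OF a zero_closed zero_closed]
  have 2: "frag_of (a, \<zero>) - frag_of (a, \<zero>) - frag_of (a, \<zero>) \<in> tm.TK"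
    unfolding l_zero[OF zero_closed] .
  have "frag_of p \<in> tm.TK" if "frag_of p - frag_of p - frag_of p \<in> tm.TK" for p :: "'a \<times> 'a"
    using tm.kernel_uminus[OF that] by simp
  then show "frag_of (\<zero>, a) \<in> tm.TK" "frag_of (a, \<zero>) \<in> tm.TK" using 1 2 by blast+
qed

lemma lx_pow: "lx [^]\<^bsub>env\<^esub> (n :: nat) = cls (frag_of (x [^] n, \<one>))"
  using x_closed by (induction n) (simp_all add: cls_one cls_mult frag_of_closed)

lemma rx_pow: "rx [^]\<^bsub>env\<^esub> (n :: nat) = cls (frag_of (\<one>, x [^] n))"
proof (induction n)
  case (Suc n)
  then show ?case using x_closed nat_pow_Suc2[of x n] by (simp add: cls_mult frag_of_closed)
qed (simp add: cls_one)

lemma lx_rx_comm: "lx \<otimes>\<^bsub>env\<^esub> rx = rx \<otimes>\<^bsub>env\<^esub> lx"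
  using x_closed by (simp add: cls_mult frag_of_closed)

lemma lx_nilpotent: "lx [^]\<^bsub>env\<^esub> d = \<zero>\<^bsub>env\<^esub>" and rx_nilpotent: "rx [^]\<^bsub>env\<^esub> d = \<zero>\<^bsub>env\<^esub>"
  by (simp_all add: lx_pow rx_pow x_pow cls_kernel frag_of_zero)

definition commutator_elem :: "('a \<times> 'a \<Rightarrow>\<^sub>0 int) set" where
  "commutator_elem = lx \<ominus>\<^bsub>env\<^esub> rx"

text \<open>\<open>norm_elem m\<close> is the sum of x^a \<otimes> x^b over a + b + 1 = m, the
  cofactor of lx - rx in lx^m - rx^m. The recursion multiplies by \<open>lx\<close> and adds the
  term with a = 0.\<close>

fun norm_elem :: "nat \<Rightarrow> ('a \<times> 'a \<Rightarrow>\<^sub>0 int) set" where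
  "norm_elem 0 = \<zero>\<^bsub>env\<^esub>"
| "norm_elem (Suc m) = lx \<otimes>\<^bsub>env\<^esub> norm_elem m \<oplus>\<^bsub>env\<^esub> rx [^]\<^bsub>env\<^esub> m"

lemma commutator_closed: "commutator_elem \<in> carrier env"
  using lx_closed rx_closed by (simp add: commutator_elem_def)

lemma norm_closed: "norm_elem m \<in> carrier env"
  using lx_closed rx_closed by (induction m) simp_all

lemma commutator_comm_lx: "commutator_elem \<otimes>\<^bsub>env\<^esub> lx = lx \<otimes>\<^bsub>env\<^esub> commutator_elem"
  and commutator_comm_rx: "commutator_elem \<otimes>\<^bsub>env\<^esub> rx = rx \<otimes>\<^bsub>env\<^esub> commutator_elem"
  using lx_closed rx_closed lx_rx_comm
  by (simp_all add: commutator_elem_def env.minus_eq env.l_distr env.r_distr env.l_minus env.r_minus)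

lemma commutator_comm_rx_pow: "commutator_elem \<otimes>\<^bsub>env\<^esub> rx [^]\<^bsub>env\<^esub> (m :: nat) = rx [^]\<^bsub>env\<^esub> m \<otimes>\<^bsub>env\<^esub> commutator_elem"
proof (induction m)
  case (Suc m)
  have "commutator_elem \<otimes>\<^bsub>env\<^esub> (rx [^]\<^bsub>env\<^esub> m \<otimes>\<^bsub>env\<^esub> rx) = rx [^]\<^bsub>env\<^esub> m \<otimes>\<^bsub>env\<^esub> (commutator_elem \<otimes>\<^bsub>env\<^esub> rx)"
    using Suc lx_closed rx_closed commutator_closed by (simp flip: env.m_assoc)
  then show ?case using rx_closed commutator_closed by (simp add: commutator_comm_rx env.m_assoc)
qed (use commutator_closed in simp)

text \<open>A telescoping sum. At \<open>m = d\<close> both powers are zero, so the commutator and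
  the norm element annihilate each other.\<close>

lemma commutator_norm: "commutator_elem \<otimes>\<^bsub>env\<^esub> norm_elem m = lx [^]\<^bsub>env\<^esub> m \<ominus>\<^bsub>env\<^esub> rx [^]\<^bsub>env\<^esub> m"
proof (induction m)
  case 0
  then show ?case using commutator_closed by (simp add: env.minus_eq env.r_neg)
next
  case (Suc m)
  note c = lx_closed rx_closed commutator_closed norm_closed[of m]
  have "commutator_elem \<otimes>\<^bsub>env\<^esub> norm_elem (Suc m)
      = lx \<otimes>\<^bsub>env\<^esub> (commutator_elem \<otimes>\<^bsub>env\<^esub> norm_elem m) \<oplus>\<^bsub>env\<^esub> commutator_elem \<otimes>\<^bsub>env\<^esub> rx [^]\<^bsub>env\<^esub> m"
    using c commutator_comm_lx by (simp add: env.r_distr) (simp flip: env.m_assoc)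
  also have "\<dots> = (lx \<otimes>\<^bsub>env\<^esub> lx [^]\<^bsub>env\<^esub> m \<ominus>\<^bsub>env\<^esub> lx \<otimes>\<^bsub>env\<^esub> rx [^]\<^bsub>env\<^esub> m) \<oplus>\<^bsub>env\<^esub> (lx \<otimes>\<^bsub>env\<^esub> rx [^]\<^bsub>env\<^esub> m \<ominus>\<^bsub>env\<^esub> rx \<otimes>\<^bsub>env\<^esub> rx [^]\<^bsub>env\<^esub> m)"
  proof -
    have "commutator_elem \<otimes>\<^bsub>env\<^esub> rx [^]\<^bsub>env\<^esub> m = lx \<otimes>\<^bsub>env\<^esub> rx [^]\<^bsub>env\<^esub> m \<ominus>\<^bsub>env\<^esub> rx \<otimes>\<^bsub>env\<^esub> rx [^]\<^bsub>env\<^esub> m"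
      using c by (simp add: commutator_elem_def env.minus_eq env.l_distr env.l_minus)
    moreover have "lx \<otimes>\<^bsub>env\<^esub> (lx [^]\<^bsub>env\<^esub> m \<ominus>\<^bsub>env\<^esub> rx [^]\<^bsub>env\<^esub> m) = lx \<otimes>\<^bsub>env\<^esub> lx [^]\<^bsub>env\<^esub> m \<ominus>\<^bsub>env\<^esub> lx \<otimes>\<^bsub>env\<^esub> rx [^]\<^bsub>env\<^esub> m"
      using c by (simp add: env.minus_eq env.r_distr env.r_minus)
    ultimately show ?thesis unfolding Suc by simp
  qed
  also have "\<dots> = lx \<otimes>\<^bsub>env\<^esub> lx [^]\<^bsub>env\<^esub> m \<ominus>\<^bsub>env\<^esub> rx \<otimes>\<^bsub>env\<^esub> rx [^]\<^bsub>env\<^esub> m"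
    using c by (simp add: env.minus_eq env.a_assoc env.r_neg2 env.r_neg1)
  also have "\<dots> = lx [^]\<^bsub>env\<^esub> Suc m \<ominus>\<^bsub>env\<^esub> rx [^]\<^bsub>env\<^esub> Suc m"
    using c env.nat_pow_Suc2 by (simp del: env.nat_pow_Suc)
  finally show ?case .
qed

lemma norm_commutator_comm: "norm_elem m \<otimes>\<^bsub>env\<^esub> commutator_elem = commutator_elem \<otimes>\<^bsub>env\<^esub> norm_elem m"
proof (induction m)
  case (Suc m)
  note c = lx_closed rx_closed commutator_closed norm_closed[of m]
  have "norm_elem (Suc m) \<otimes>\<^bsub>env\<^esub> commutator_elem
     = lx \<otimes>\<^bsub>env\<^esub> (norm_elem m \<otimes>\<^bsub>env\<^esub> commutator_elem) \<oplus>\<^bsub>env\<^esub> rx [^]\<^bsub>env\<^esub> m \<otimes>\<^bsub>env\<^esub> commutator_elem"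
    using c by (simp add: env.l_distr env.m_assoc)
  also have "\<dots> = (lx \<otimes>\<^bsub>env\<^esub> commutator_elem) \<otimes>\<^bsub>env\<^esub> norm_elem m \<oplus>\<^bsub>env\<^esub> commutator_elem \<otimes>\<^bsub>env\<^esub> rx [^]\<^bsub>env\<^esub> m"
    using c by (simp add: Suc commutator_comm_rx_pow env.m_assoc)
  also have "\<dots> = commutator_elem \<otimes>\<^bsub>env\<^esub> norm_elem (Suc m)"
    using c by (simp flip: commutator_comm_lx add: env.r_distr env.m_assoc)
  finally show ?case .
qed (use commutator_closed in simp)

definition periodic_elem :: "nat \<Rightarrow> ('a \<times> 'a \<Rightarrow>\<^sub>0 int) set" where
  "periodic_elem n = (if even n then commutator_elem else norm_elem d)"

text \<open>The power of X by which \<open>periodic_elem n\<close> acts on \<open>trunc d\<close>.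
  Two consecutive exponents add up to \<open>d\<close>.\<close>

definition periodic_exp :: "nat \<Rightarrow> nat" where
  "periodic_exp n = (if even n then 1 else d - 1)"

lemma periodic_closed: "periodic_elem n \<in> carrier env"
  by (simp add: periodic_elem_def commutator_closed norm_closed)

lemma periodic_mult: "periodic_elem (Suc n) \<otimes>\<^bsub>env\<^esub> periodic_elem n = \<zero>\<^bsub>env\<^esub>"
proof -
  have "commutator_elem \<otimes>\<^bsub>env\<^esub> norm_elem d = \<zero>\<^bsub>env\<^esub>"
    by (simp add: commutator_norm lx_nilpotent rx_nilpotent env.minus_eq env.r_neg)
  then show ?thesis by (simp add: periodic_elem_def norm_commutator_comm)
qed

lemma periodic_exp: "1 \<le> periodic_exp n" "periodic_exp n < d" "periodic_exp n + periodic_exp (Suc n) = d"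
  using d2 by (auto simp: periodic_exp_def)

abbreviation "shift n q \<equiv> fps_cutoff d (fps_X ^ periodic_exp n * q)"

lemma lx_trunc: "q \<in> carrier (trunc d) \<Longrightarrow> lx \<odot>\<^bsub>trunc d\<^esub> q = fps_cutoff d (fps_X * q)"
  using x_closed by (subst trunc.smult_cls_of) (simp_all add: trunc_act_def p_x p_one)

lemma rx_trunc: "q \<in> carrier (trunc d) \<Longrightarrow> rx \<odot>\<^bsub>trunc d\<^esub> q = 0"
  using x_closed by (subst trunc.smult_cls_of) (simp_all add: trunc_act_def p_x p_one)

text \<open>The factor \<open>rx\<close> acts as 0, so only the term x^m \<otimes> 1 of the sum
  survives.\<close>

lemma norm_trunc: "q \<in> carrier (trunc d) \<Longrightarrow> norm_elem (Suc m) \<odot>\<^bsub>trunc d\<^esub> q = fps_cutoff d (fps_X ^ m * q)"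
proof (induction m)
  case 0
  interpret T: left_module env "trunc d" by (rule trunc.env_left_module)
  show ?case using 0 lx_closed by (simp del: trunc_simps(1)) simp
next
  case (Suc m)
  interpret T: left_module env "trunc d" by (rule trunc.env_left_module)
  note c = lx_closed rx_closed norm_closed[of "Suc m"] Suc.prems
  have n: "norm_elem (Suc (Suc m)) = lx \<otimes>\<^bsub>env\<^esub> norm_elem (Suc m) \<oplus>\<^bsub>env\<^esub> rx [^]\<^bsub>env\<^esub> m \<otimes>\<^bsub>env\<^esub> rx"
    by (subst norm_elem.simps(2)) simp
  have s: "fps_cutoff d (fps_X ^ m * q) \<in> carrier (trunc d)" by (auto intro!: fps_ext)
  have "(rx [^]\<^bsub>env\<^esub> m \<otimes>\<^bsub>env\<^esub> rx) \<odot>\<^bsub>trunc d\<^esub> q = \<zero>\<^bsub>trunc d\<^esub>"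
    using c T.smult_zero_right[of "rx [^]\<^bsub>env\<^esub> m"] by (simp add: T.smult_assoc1 rx_trunc del: trunc_simps(1))
  moreover have "(lx \<otimes>\<^bsub>env\<^esub> norm_elem (Suc m)) \<odot>\<^bsub>trunc d\<^esub> q = fps_cutoff d (fps_X ^ Suc m * q)"
    using c Suc.IH[OF Suc.prems] lx_trunc[OF s]
    by (simp add: T.smult_assoc1 fps_cutoff_mult_cutoff mult.assoc del: norm_elem.simps trunc_simps(1))
  ultimately show ?case
    unfolding n using c by (simp add: T.smult_l_distr del: norm_elem.simps trunc_simps(1))
qed

lemma periodic_trunc:
  assumes q: "q \<in> carrier (trunc d)"
  shows "periodic_elem n \<odot>\<^bsub>trunc d\<^esub> q = shift n q"
proof (cases "even n")
  case True
  interpret T: left_module env "trunc d" by (rule trunc.env_left_module)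
  have s: "fps_cutoff d (fps_X * q) \<in> carrier (trunc d)" by (auto intro!: fps_ext)
  have "commutator_elem \<odot>\<^bsub>trunc d\<^esub> q = fps_cutoff d (fps_X * q) \<ominus>\<^bsub>trunc d\<^esub> \<zero>\<^bsub>trunc d\<^esub>"
    using q lx_closed rx_closed by (simp add: commutator_elem_def T.smult_diff_left lx_trunc rx_trunc del: trunc_simps(1))
  also have "\<dots> = fps_cutoff d (fps_X * q)" using s by (rule T.M.minus_zero_right)
  finally show ?thesis using True by (simp add: periodic_elem_def periodic_exp_def)
next
  case False
  have "Suc (d - 1) = d" using d2 by simp
  then show ?thesis
    using norm_trunc[OF q, of "d - 1"] False by (simp only: periodic_elem_def periodic_exp_def if_False)
qed

lemma shift_hom: "shift n \<in> module_hom env (trunc d) (trunc d)"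
proof (rule module_homI)
  show "shift n q \<in> carrier (trunc d)" for q by (auto intro!: fps_ext)
  show "shift n (q \<oplus>\<^bsub>trunc d\<^esub> q') = shift n q \<oplus>\<^bsub>trunc d\<^esub> shift n q'" for q q'
    by (simp add: distrib_left fps_cutoff_add)
  fix T q assume T: "T \<in> carrier env" and q: "q \<in> carrier (trunc d)"
  obtain f where f: "f \<in> carrier frag_ring" "T = cls f" using T by (elim env_cases)
  have f': "Poly_Mapping.keys f \<subseteq> AA" using f by (simp add: frag_ring_simps)
  have s: "shift n q \<in> carrier (trunc d)" for q by (auto intro!: fps_ext)
  have "shift n (frag_eval (trunc d) (\<lambda>(a, b). trunc_act d a b q) f)
      = frag_eval (trunc d) (\<lambda>z. shift n (case z of (a, b) \<Rightarrow> trunc_act d a b q)) f"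
    by (rule hom_frag_eval[OF trunc_abelian_group trunc_abelian_group _ _ f' trunc.act_fun[OF q]])
      (use s in \<open>auto simp: distrib_left fps_cutoff_add simp del: trunc_simps(1)\<close>)
  also have "(\<lambda>z. shift n (case z of (a, b) \<Rightarrow> trunc_act d a b q)) = (\<lambda>(a, b). trunc_act d a b (shift n q))"
    by (rule ext) (simp add: split_def trunc_act_def fps_cutoff_mult_cutoff, simp add: mult_ac)
  finally show "shift n (T \<odot>\<^bsub>trunc d\<^esub> q) = T \<odot>\<^bsub>trunc d\<^esub> shift n q"
    using trunc.smult_cls[OF f(1) q] trunc.smult_cls[OF f(1) s] by (simp add: f(2) del: trunc_simps(1))
qed

text \<open>The annihilator of X^a in k[X]/(X^d) is generated by X^(d-a), and consecutive exponents
  add up to \<open>d\<close>.\<close>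

lemma shift_exact:
  assumes "q \<in> carrier (trunc d)" "shift n q = 0"
  shows "q \<in> shift (Suc n) ` carrier (trunc d)"
proof -
  have "q $ i = 0" if "i < periodic_exp (Suc n)" for i
  proof -
    have "i + periodic_exp n < d" using that periodic_exp(3)[of n] by simp
    moreover have "shift n q $ (i + periodic_exp n) = 0" using assms(2) by simp
    ultimately show ?thesis by (simp add: fps_X_power_mult_nth)
  qed
  then show ?thesis using assms(1) fps_cutoff_exact[of d q "periodic_exp (Suc n)"] by auto
qed

text \<open>Both maps end in the simple module \<open>trunc 1\<close>, on which a \<otimes> b acts
  by the product of the constant terms of \<open>p a\<close> and \<open>p b\<close>. The first
  augments the periodic complex, the second sends \<open>A\<close> to the same place; lifting
  through the first is the start of the comparison.\<close>

lemma augmentation_hom: "fps_cutoff 1 \<in> module_hom env (trunc d) (trunc 1)"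
  and augmentation_envL: "(\<lambda>a. fps_const (\<eta> a)) \<in> module_hom env envL (trunc 1)"
proof -
  interpret T1: env_action A "trunc 1" "trunc_act 1" by (rule trunc_action) (use d2 in auto)
  have cut: "fps_cutoff 1 (fps_cutoff d F) = fps_cutoff 1 F" for F :: "'k fps"
    using d2 by (auto intro!: fps_ext)
  have cut1: "fps_cutoff 1 F = fps_const (F $ 0)" for F :: "'k fps"
    by (auto intro!: fps_ext simp: less_Suc_eq)
  have s: "fps_cutoff 1 F \<in> carrier (trunc 1)" for F by (auto intro!: fps_ext)
  have sc: "fps_const c \<in> carrier (trunc 1)" for c
  proof -
    have "fps_cutoff 1 (fps_const c) = fps_const c" by (subst cut1) simp
    then show ?thesis by (simp only: trunc_simps mem_Collect_eq)
  qed
  show "fps_cutoff 1 \<in> module_hom env (trunc d) (trunc 1)"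
  proof (rule module_homI)
    fix T q assume T: "T \<in> carrier env" and q: "q \<in> carrier (trunc d)"
    obtain f where f: "f \<in> carrier frag_ring" "T = cls f" using T by (elim env_cases)
    have f': "Poly_Mapping.keys f \<subseteq> AA" using f by (simp add: frag_ring_simps)
    have "fps_cutoff 1 (frag_eval (trunc d) (\<lambda>(a, b). trunc_act d a b q) f)
        = frag_eval (trunc 1) (\<lambda>z. fps_cutoff 1 (case z of (a, b) \<Rightarrow> trunc_act d a b q)) f"
      by (rule hom_frag_eval[OF trunc_abelian_group trunc_abelian_group _ _ f' trunc.act_fun[OF q]])
        (use s in \<open>auto simp: fps_cutoff_add simp del: trunc_simps(1)\<close>)
    also have "(\<lambda>z. fps_cutoff 1 (case z of (a, b) \<Rightarrow> trunc_act d a b q)) = (\<lambda>(a, b). trunc_act 1 a b (fps_cutoff 1 q))"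
      by (rule ext) (simp add: split_def trunc_act_def fps_cutoff_mult_cutoff cut[unfolded One_nat_def])
    finally show "fps_cutoff 1 (T \<odot>\<^bsub>trunc d\<^esub> q) = T \<odot>\<^bsub>trunc 1\<^esub> fps_cutoff 1 q"
      using trunc.smult_cls[OF f(1) q] T1.smult_cls[OF f(1) s] by (simp add: f(2) del: trunc_simps(1))
  qed (use s in \<open>simp_all add: fps_cutoff_add\<close>)
  show "(\<lambda>a. fps_const (\<eta> a)) \<in> module_hom env envL (trunc 1)"
  proof (rule module_homI)
    fix T y assume T: "T \<in> carrier env" and y: "y \<in> carrier envL"
    obtain f where f: "f \<in> carrier frag_ring" "T = cls f" using T by (elim env_cases)
    have f': "Poly_Mapping.keys f \<subseteq> AA" using f by (simp add: frag_ring_simps)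
    have y': "y \<in> carrier A" using y by simp
    have "fps_const (\<eta> (frag_eval envL (\<lambda>(a, b). a \<otimes> y \<otimes> b) f))
        = frag_eval (trunc 1) (\<lambda>z. fps_const (\<eta> (case z of (a, b) \<Rightarrow> a \<otimes> y \<otimes> b))) f"
      by (rule hom_frag_eval[where \<phi> = "\<lambda>a. fps_const (\<eta> a)", OF env_module_abelian_group(1) trunc_abelian_group _ _ f' envL.act_fun[OF y]])
        (use sc in \<open>auto simp: p_add fps_const_add[symmetric] simp del: trunc_simps(1) fps_const_add\<close>)
    also have "\<dots> = frag_eval (trunc 1) (\<lambda>(a, b). trunc_act 1 a b (fps_const (\<eta> y))) f"
      unfolding frag_eval_def
    proof (rule abelian_monoid.finsum_cong')
      show "abelian_monoid (trunc 1)" using trunc_abelian_group by (rule abelian_group.axioms)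
      interpret T: abelian_group "trunc 1" by (rule trunc_abelian_group)
      fix z assume z: "z \<in> Poly_Mapping.keys f"
      then obtain a b where ab: "z = (a, b)" "a \<in> carrier A" "b \<in> carrier A" using f' by (cases z) auto
      have "fps_const (\<eta> (a \<otimes> y \<otimes> b)) = trunc_act 1 a b (fps_const (\<eta> y))"
        using ab y' by (simp add: trunc_act_def cut1[unfolded One_nat_def] \<eta>_mult mult_ac)
      then show "[Poly_Mapping.lookup f z] \<cdot>\<^bsub>trunc 1\<^esub> fps_const (\<eta> (case z of (a, b) \<Rightarrow> a \<otimes> y \<otimes> b)) =
         [Poly_Mapping.lookup f z] \<cdot>\<^bsub>trunc 1\<^esub> (case z of (a, b) \<Rightarrow> trunc_act 1 a b (fps_const (\<eta> y)))"
        by (simp add: ab(1))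
    next
      interpret T: abelian_group "trunc 1" by (rule trunc_abelian_group)
      show "(\<lambda>z. [Poly_Mapping.lookup f z] \<cdot>\<^bsub>trunc 1\<^esub> (case z of (a, b) \<Rightarrow> trunc_act 1 a b (fps_const (\<eta> y)))) \<in> Poly_Mapping.keys f \<rightarrow> carrier (trunc 1)"
      proof (intro funcsetI T.add.int_pow_closed)
        fix z assume "z \<in> Poly_Mapping.keys f"
        then show "(case z of (a, b) \<Rightarrow> trunc_act 1 a b (fps_const (\<eta> y))) \<in> carrier (trunc 1)"
          using T1.act_fun[OF sc, of "\<eta> y"] f' by blast
      qed
    qed simp
    finally show "fps_const (\<eta> (T \<odot>\<^bsub>envL\<^esub> y)) = T \<odot>\<^bsub>trunc 1\<^esub> fps_const (\<eta> y)"
      using envL.smult_cls[OF f(1) y] T1.smult_cls[OF f(1) sc] by (simp add: f(2) del: trunc_simps(1))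
  qed (use sc in \<open>simp_all add: p_add fps_const_add[symmetric] del: trunc_simps(1) fps_const_add\<close>)
qed

end

context truncated_retract
begin

lemma p_zero: "p \<zero> = 0"
proof -
  have "p (\<zero> \<oplus> \<zero>) = p \<zero> + p \<zero>" by (rule p_add) simp_all
  then have "p \<zero> + 0 = p \<zero> + p \<zero>" by (simp only: l_zero[OF zero_closed] add_0_right)
  then show ?thesis by (simp only: add_left_cancel)
qed

section \<open>Comparison with an arbitrary projective resolution\<close>

context
  fixes P :: "nat \<Rightarrow> (('a \<times> 'a \<Rightarrow>\<^sub>0 int) set, (('a \<times> 'a \<Rightarrow>\<^sub>0 int) set, 'a) res) module"
    and \<delta> :: "nat \<Rightarrow> (('a \<times> 'a \<Rightarrow>\<^sub>0 int) set, 'a) res \<Rightarrow> (('a \<times> 'a \<Rightarrow>\<^sub>0 int) set, 'a) res"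
    and \<epsilon> :: "(('a \<times> 'a \<Rightarrow>\<^sub>0 int) set, 'a) res \<Rightarrow> 'a"
  assumes res: "projective_resolution env envL P \<delta> \<epsilon>"
begin

lemma P_projective: "projective_module env (P n)"
  and \<delta>_hom: "\<delta> n \<in> module_hom env (P (Suc n)) (P n)"
  and \<epsilon>_hom: "\<epsilon> \<in> module_hom env (P 0) envL"
  and \<epsilon>_surj: "\<epsilon> ` carrier (P 0) = carrier A"
  and exact_0: "\<delta> 0 ` carrier (P 1) = a_kernel (P 0) envL \<epsilon>"
  and exact_Suc: "\<delta> (Suc n) ` carrier (P (Suc (Suc n))) = a_kernel (P (Suc n)) (P n) (\<delta> n)"
  using res by (simp_all add: projective_resolution_def)

lemma P_module: "left_module env (P n)"
  by (rule projective_moduleD[OF P_projective])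

lemma \<epsilon>_\<delta>: "y \<in> carrier (P 1) \<Longrightarrow> \<epsilon> (\<delta> 0 y) = \<zero>"
  using exact_0 by (auto simp: a_kernel_def')

lemma \<delta>_\<delta>: "y \<in> carrier (P (Suc (Suc n))) \<Longrightarrow> \<delta> n (\<delta> (Suc n) y) = \<zero>\<^bsub>P n\<^esub>"
  using exact_Suc[of n] by (auto simp: a_kernel_def')

text \<open>The chain starts over 1 in \<open>A\<close>, which the commutator element kills; later
  on, consecutive periodic elements have product 0. Hence the periodic multiple of
  \<open>y n\<close> is always a cycle, and exactness provides \<open>y (Suc n)\<close>.\<close>

lemma periodic_chain:
  "\<exists>y. \<epsilon> (y 0) = \<one> \<and> (\<forall>n. y n \<in> carrier (P n) \<and> \<delta> n (y (Suc n)) = periodic_elem n \<odot>\<^bsub>P n\<^esub> y n)"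
proof -
  let ?Inv = "\<lambda>n y. y \<in> carrier (P n) \<and> periodic_elem n \<odot>\<^bsub>P n\<^esub> y \<in> \<delta> n ` carrier (P (Suc n)) \<and> (n = 0 \<longrightarrow> \<epsilon> y = \<one>)"
  let ?Rel = "\<lambda>n y y'. \<delta> n y' = periodic_elem n \<odot>\<^bsub>P n\<^esub> y"
  have "\<exists>y. \<forall>n. ?Inv n (y n) \<and> ?Rel n (y n) (y (Suc n))"
  proof (rule dependent_nat_choice)
    interpret P0: left_module env "P 0" by (rule P_module)
    interpret L: left_module env envL by (rule envL.env_left_module)
    have "\<one> \<in> \<epsilon> ` carrier (P 0)" by (simp add: \<epsilon>_surj)
    then obtain y where y: "y \<in> carrier (P 0)" "\<epsilon> y = \<one>" by fastforce
    have "lx \<odot>\<^bsub>envL\<^esub> \<one> = x" "rx \<odot>\<^bsub>envL\<^esub> \<one> = x"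
      using x_closed by (simp_all add: envL.smult_cls_of)
    then have "commutator_elem \<odot>\<^bsub>envL\<^esub> \<one> = \<zero>\<^bsub>envL\<^esub>"
      using lx_closed rx_closed x_closed L.M.r_neg[of x] by (simp add: commutator_elem_def L.smult_diff_left L.M.minus_eq)
    moreover have "\<epsilon> (periodic_elem 0 \<odot>\<^bsub>P 0\<^esub> y) = periodic_elem 0 \<odot>\<^bsub>envL\<^esub> \<one>"
      by (simp only: module_hom_smult[OF \<epsilon>_hom periodic_closed y(1)] y(2))
    ultimately have "\<epsilon> (periodic_elem 0 \<odot>\<^bsub>P 0\<^esub> y) = \<zero>\<^bsub>envL\<^esub>"
      by (simp add: periodic_elem_def)
    then have "periodic_elem 0 \<odot>\<^bsub>P 0\<^esub> y \<in> \<delta> 0 ` carrier (P 1)"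
      using y(1) periodic_closed P0.smult_closed unfolding exact_0 by (simp add: a_kernel_def')
    then show "\<exists>y. ?Inv 0 y" using y by auto
  next
    fix y n assume I: "?Inv n y"
    interpret Pn: left_module env "P n" by (rule P_module)
    interpret Ps: left_module env "P (Suc n)" by (rule P_module)
    from I obtain y' where y': "y' \<in> carrier (P (Suc n))" "\<delta> n y' = periodic_elem n \<odot>\<^bsub>P n\<^esub> y" by auto
    have "\<delta> n (periodic_elem (Suc n) \<odot>\<^bsub>P (Suc n)\<^esub> y') = periodic_elem (Suc n) \<odot>\<^bsub>P n\<^esub> (periodic_elem n \<odot>\<^bsub>P n\<^esub> y)"
      using y' by (simp add: module_hom_smult[OF \<delta>_hom periodic_closed])
    also have "\<dots> = \<zero>\<^bsub>P n\<^esub>"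
      using I periodic_closed by (simp flip: Pn.smult_assoc1 add: periodic_mult)
    finally have "periodic_elem (Suc n) \<odot>\<^bsub>P (Suc n)\<^esub> y' \<in> \<delta> (Suc n) ` carrier (P (Suc (Suc n)))"
      using y'(1) periodic_closed Ps.smult_closed unfolding exact_Suc by (simp add: a_kernel_def')
    then show "\<exists>y'. ?Inv (Suc n) y' \<and> ?Rel n y y'" using y' by (intro exI[of _ y'] conjI) simp_all
  qed
  then obtain y where "\<forall>n. ?Inv n (y n) \<and> ?Rel n (y n) (y (Suc n))" ..
  then show ?thesis by (intro exI[of _ y]) simp
qed

text \<open>Projectivity lifts along surjections only, so \<open>shift n\<close> is regarded as a
  map onto its image, which is a submodule of \<open>trunc d\<close>.\<close>

lemma lift_step:
  assumes f: "f \<in> module_hom env (P n) (trunc d)"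
    and im: "\<And>y. y \<in> carrier (P (Suc n)) \<Longrightarrow> f (\<delta> n y) \<in> shift n ` carrier (trunc d)"
  shows "\<exists>f'\<in>module_hom env (P (Suc n)) (trunc d). \<forall>y\<in>carrier (P (Suc n)). shift n (f' y) = f (\<delta> n y)"
proof -
  interpret Q: left_module env "trunc d" by (rule trunc.env_left_module)
  let ?N = "(trunc d)\<lparr>carrier := shift n ` carrier (trunc d)\<rparr>"
  have sub: "shift n ` carrier (trunc d) \<subseteq> carrier (trunc d)" using module_hom_closed[OF shift_hom] by blast
  have N: "left_module env ?N"
  proof (rule Q.submodule[OF sub])
    show "\<zero>\<^bsub>trunc d\<^esub> \<in> shift n ` carrier (trunc d)"
      using module_hom_zero[OF Q.left_module_axioms Q.left_module_axioms shift_hom] Q.M.zero_closed by (metis imageI)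
  next
    fix u v assume "u \<in> shift n ` carrier (trunc d)" "v \<in> shift n ` carrier (trunc d)"
    then obtain q r where qr: "q \<in> carrier (trunc d)" "r \<in> carrier (trunc d)" "u = shift n q" "v = shift n r" by blast
    show "u \<oplus>\<^bsub>trunc d\<^esub> v \<in> shift n ` carrier (trunc d)"
    proof
      show "u \<oplus>\<^bsub>trunc d\<^esub> v = shift n (q \<oplus>\<^bsub>trunc d\<^esub> r)" by (simp only: qr module_hom_add[OF shift_hom])
    qed (rule Q.M.add.m_closed[OF qr(1,2)])
  next
    fix T u assume "T \<in> carrier env" "u \<in> shift n ` carrier (trunc d)"
    then obtain q where q: "q \<in> carrier (trunc d)" "u = shift n q" "T \<in> carrier env" by blast
    show "T \<odot>\<^bsub>trunc d\<^esub> u \<in> shift n ` carrier (trunc d)"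
    proof
      show "T \<odot>\<^bsub>trunc d\<^esub> u = shift n (T \<odot>\<^bsub>trunc d\<^esub> q)" by (simp only: q module_hom_smult[OF shift_hom])
    qed (rule Q.smult_closed[OF q(3,1)])
  qed
  have g: "shift n \<in> module_hom env (trunc d) ?N" "shift n ` carrier (trunc d) = carrier ?N"
    using shift_hom by (simp_all add: module_hom_def Pi_def)
  have "(\<lambda>y. f (\<delta> n y)) \<in> module_hom env (P (Suc n)) (trunc d)" by (rule module_hom_comp[OF \<delta>_hom f])
  then have h: "(\<lambda>y. f (\<delta> n y)) \<in> module_hom env (P (Suc n)) ?N"
    using im by (simp add: module_hom_def Pi_def del: trunc_simps)
  show ?thesis
    by (rule projective_lift[OF P_projective Q.left_module_axioms N trunc_embedding trunc_embedding g h])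
qed

text \<open>The comparison theorem for a projective source and an exact target: \<open>f\<close> is
  a chain map to the periodic complex that lifts \<open>\<eta>\<close>. By
  \<open>shift_exact\<close> each new map again sends boundaries into the image of the next
  \<open>shift\<close>.\<close>

lemma comparison_map:
  "\<exists>f. (\<forall>y\<in>carrier (P 0). fps_nth (f 0 y) 0 = \<eta> (\<epsilon> y)) \<and> (\<forall>n. f n \<in> module_hom env (P n) (trunc d) \<and>
    (\<forall>y\<in>carrier (P (Suc n)). shift n (f (Suc n) y) = f n (\<delta> n y)))"
proof -
  let ?im = "\<lambda>n f. \<forall>y\<in>carrier (P (Suc n)). f (\<delta> n y) \<in> shift n ` carrier (trunc d)"
  let ?Inv = "\<lambda>n f. f \<in> module_hom env (P n) (trunc d) \<and> ?im n f \<and> (n = 0 \<longrightarrow> (\<forall>y\<in>carrier (P 0). fps_nth (f y) 0 = \<eta> (\<epsilon> y)))"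
  let ?Rel = "\<lambda>n f f'. \<forall>y\<in>carrier (P (Suc n)). shift n (f' y) = f (\<delta> n y)"
  have "\<exists>f. \<forall>n. ?Inv n (f n) \<and> ?Rel n (f n) (f (Suc n))"
  proof (rule dependent_nat_choice)
    interpret Q1: left_module env "trunc 1" using d2 by (intro trunc_left_module) auto
    have surj: "fps_cutoff 1 ` carrier (trunc d) = carrier (trunc 1)"
    proof
      show "fps_cutoff 1 ` carrier (trunc d) \<subseteq> carrier (trunc 1)"
        using module_hom_closed[OF augmentation_hom] by blast
      have "fps_cutoff d F = F" if "fps_cutoff 1 F = F" for F :: "'k fps"
      proof (rule fps_ext)
        fix n
        have "fps_cutoff 1 F $ n = F $ n" by (simp only: that)
        then show "fps_cutoff d F $ n = F $ n" using d2 by (auto split: if_splits)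
      qed
      then show "carrier (trunc 1) \<subseteq> fps_cutoff 1 ` carrier (trunc d)" by force
    qed
    obtain f where f: "f \<in> module_hom env (P 0) (trunc d)"
        and f': "\<forall>y\<in>carrier (P 0). fps_cutoff 1 (f y) = fps_const (\<eta> (\<epsilon> y))"
      using projective_lift[OF P_projective trunc.env_left_module Q1.left_module_axioms trunc_embedding trunc_embedding
             augmentation_hom surj module_hom_comp[OF \<epsilon>_hom augmentation_envL]] ..
    have f0: "fps_nth (f y) 0 = \<eta> (\<epsilon> y)" if "y \<in> carrier (P 0)" for y
    proof -
      have "fps_cutoff 1 (f y) $ 0 = fps_const (\<eta> (\<epsilon> y)) $ 0" by (simp only: f'[rule_format, OF that])
      then show ?thesis by simp
    qed
    \<comment> \<open>The constant term is \<open>\<eta>\<close> of \<epsilon> (\<delta> 0 y) = 0,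
      so the series is divisible by X, and \<open>shift 0\<close> is multiplication by X.\<close>
    have "f (\<delta> 0 y) \<in> shift 0 ` carrier (trunc d)" if y: "y \<in> carrier (P 1)" for y
    proof -
      have c: "\<delta> 0 y \<in> carrier (P 0)" using module_hom_closed[OF \<delta>_hom[of 0]] y by simp
      have "fps_nth (f (\<delta> 0 y)) i = 0" if "i < 1" for i using f0[OF c] \<epsilon>_\<delta>[OF y] that p_zero by simp
      moreover have "fps_cutoff d (f (\<delta> 0 y)) = f (\<delta> 0 y)" using module_hom_closed[OF f c] by simp
      ultimately show ?thesis using fps_cutoff_exact[of d "f (\<delta> 0 y)" 1] by (auto simp: periodic_exp_def)
    qed
    then show "\<exists>f. ?Inv 0 f" using f f0 by (intro exI[of _ f] conjI ballI) simp_all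
  next
    fix f n assume I: "?Inv n f"
    have "\<exists>f'\<in>module_hom env (P (Suc n)) (trunc d). \<forall>y\<in>carrier (P (Suc n)). shift n (f' y) = f (\<delta> n y)"
      by (rule lift_step) (use I in blast)+
    then obtain f' where f': "f' \<in> module_hom env (P (Suc n)) (trunc d)"
      and f'_eq: "\<forall>y\<in>carrier (P (Suc n)). shift n (f' y) = f (\<delta> n y)" ..
    have "f' (\<delta> (Suc n) y) \<in> shift (Suc n) ` carrier (trunc d)" if y: "y \<in> carrier (P (Suc (Suc n)))" for y
    proof (rule shift_exact)
      have c: "\<delta> (Suc n) y \<in> carrier (P (Suc n))" by (rule module_hom_closed[OF \<delta>_hom y])
      show "f' (\<delta> (Suc n) y) \<in> carrier (trunc d)" by (rule module_hom_closed[OF f' c])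
      have "f \<zero>\<^bsub>P n\<^esub> = \<zero>\<^bsub>trunc d\<^esub>" using I by (intro module_hom_zero[OF P_module trunc.env_left_module]) blast
      then show "shift n (f' (\<delta> (Suc n) y)) = 0" using f'_eq[rule_format, OF c] \<delta>_\<delta>[OF y] by simp
    qed
    then show "\<exists>f'. ?Inv (Suc n) f' \<and> ?Rel n f f'" using f' f'_eq by (intro exI[of _ f'] conjI ballI) simp_all
  qed
  then obtain f where f: "\<forall>n. ?Inv n (f n) \<and> ?Rel n (f n) (f (Suc n))" ..
  show ?thesis
  proof (intro exI[of _ f] conjI allI)
    show "\<forall>y\<in>carrier (P 0). fps_nth (f 0 y) 0 = \<eta> (\<epsilon> y)" using spec[OF f, of 0] by simp
    show "f n \<in> module_hom env (P n) (trunc d)" for n using spec[OF f, of n] by (elim conjE)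
    show "\<forall>y\<in>carrier (P (Suc n)). shift n (f (Suc n) y) = f n (\<delta> n y)" for n using spec[OF f, of n] by (elim conjE)
  qed
qed

lemma tensor_modules_P: "tensor_modules env envR (P n)"
proof -
  interpret Pn: left_module env "P n" by (rule P_module)
  show ?thesis by unfold_locales (auto intro: envR.smult_cls_closed[simplified])
qed

text \<open>Because the differential is a module homomorphism, it carries tensor relations to tensor
  relations. This makes the union over representatives in \<open>tensor_map\<close> a single
  class.\<close>

lemma tensor_kernel_map:
  assumes "t \<in> tensor_kernel env envR (P (Suc n))"
  shows "frag_extend (\<lambda>(a, y). frag_of (a, \<delta> n y)) t \<in> tensor_kernel env envR (P n)"
proof -
  interpret T: tensor_modules env envR "P (Suc n)" by (rule tensor_modules_P)
  interpret T0: tensor_modules env envR "P n" by (rule tensor_modules_P)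
  show ?thesis
    using assms
  proof (induction t rule: T.kernel_induct)
    case zero
    show ?case by (simp add: T0.kernel_zero)
  next
    case (add_left a a' u)
    then have "frag_of (a \<oplus> a', \<delta> n u) - frag_of (a, \<delta> n u) - frag_of (a', \<delta> n u) \<in> tensor_relations env envR (P n)"
      using module_hom_closed[OF \<delta>_hom, of u n] by (auto simp: tensor_relations_def)
    then show ?case by (simp add: frag_extend_diff T0.kernel_relation)
  next
    case (add_right a u u')
    then have "frag_of (a, \<delta> n u \<oplus>\<^bsub>P n\<^esub> \<delta> n u') - frag_of (a, \<delta> n u) - frag_of (a, \<delta> n u') \<in> tensor_relations env envR (P n)"
      using module_hom_closed[OF \<delta>_hom, of _ n] by (auto simp: tensor_relations_def)
    then show ?case using add_right by (simp add: frag_extend_diff T0.kernel_relation module_hom_add[OF \<delta>_hom])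
  next
    case (balanced r a u)
    then have "frag_of (r \<odot>\<^bsub>envR\<^esub> a, \<delta> n u) - frag_of (a, r \<odot>\<^bsub>P n\<^esub> \<delta> n u) \<in> tensor_relations env envR (P n)"
      using module_hom_closed[OF \<delta>_hom, of u n] by (auto simp: tensor_relations_def)
    then show ?case using balanced by (simp add: frag_extend_diff T0.kernel_relation module_hom_smult[OF \<delta>_hom])
  next
    case (diff t s)
    then show ?case by (simp add: frag_extend_diff T0.kernel_diff)
  qed
qed

lemma shift_const: "shift n q $ 0 = 0"
  using periodic_exp[of n] by (simp add: fps_X_power_mult_nth)

text \<open>
  \<open>\<eta>(a) \<cdot> f\<^sub>n(y)(0)\<close> is a functional on \<open>A \<otimes> P\<^sub>n\<close> that vanishes on boundaries, while for odd \<open>n\<close> it takes the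
  value 1 at the cycle \<open>1 \<otimes> y\<^sub>n\<close>.
\<close>

lemma tensor_homology_nontrivial:
  assumes "even m"
  shows "\<not> trivial_group (tensor_homology env envR P \<delta> (Suc m))"
proof
  assume triv: "trivial_group (tensor_homology env envR P \<delta> (Suc m))"
  obtain y where y': "\<epsilon> (y 0) = \<one> \<and> (\<forall>n. y n \<in> carrier (P n) \<and> \<delta> n (y (Suc n)) = periodic_elem n \<odot>\<^bsub>P n\<^esub> y n)"
    using periodic_chain ..
  then have y: "y n \<in> carrier (P n)" "\<epsilon> (y 0) = \<one>" "\<delta> n (y (Suc n)) = periodic_elem n \<odot>\<^bsub>P n\<^esub> y n" for n
    by simp_all
  obtain f where f': "(\<forall>y\<in>carrier (P 0). fps_nth (f 0 y) 0 = \<eta> (\<epsilon> y)) \<and> (\<forall>n. f n \<in> module_hom env (P n) (trunc d) \<and>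
      (\<forall>y\<in>carrier (P (Suc n)). shift n (f (Suc n) y) = f n (\<delta> n y)))"
    using comparison_map ..
  have f: "f n \<in> module_hom env (P n) (trunc d)"
    "u \<in> carrier (P 0) \<Longrightarrow> fps_nth (f 0 u) 0 = \<eta> (\<epsilon> u)"
    "v \<in> carrier (P (Suc n)) \<Longrightarrow> shift n (f (Suc n) v) = f n (\<delta> n v)" for n u v
    using f' by simp_all
  \<comment> \<open>Compare the coefficients at X^(\<open>periodic_exp n\<close>): on both sides
    they are constant terms moved up by the shift, and they survive the cut-off since
    \<open>periodic_exp n < d\<close>.\<close>
  have fy: "fps_nth (f n (y n)) 0 = 1" for n
  proof (induction n)
    case 0
    then show ?case using f(2) y(1,2) by (simp add: p_one)
  next
    case (Suc n)
    have c: "f n (y n) \<in> carrier (trunc d)" by (rule module_hom_closed[OF f(1) y(1)])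
    have "shift n (f (Suc n) (y (Suc n))) = f n (\<delta> n (y (Suc n)))" by (rule f(3)[OF y(1)])
    also have "\<dots> = periodic_elem n \<odot>\<^bsub>trunc d\<^esub> f n (y n)"
      by (simp only: y(3) module_hom_smult[OF f(1) periodic_closed y(1)])
    also have "\<dots> = shift n (f n (y n))" by (rule periodic_trunc[OF c])
    finally have "shift n (f (Suc n) (y (Suc n))) $ periodic_exp n = shift n (f n (y n)) $ periodic_exp n" by simp
    then show ?case using Suc periodic_exp(2)[of n] by (simp add: fps_X_power_mult_nth)
  qed
  let ?T = "\<lambda>n. tensor env envR (P n)"
  let ?C = "\<lambda>n. tensor_class env envR (P n)"
  interpret T: tensor_modules env envR "P (Suc m)" by (rule tensor_modules_P)
  interpret T0: tensor_modules env envR "P m" by (rule tensor_modules_P)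
  interpret T2: tensor_modules env envR "P (Suc (Suc m))" by (rule tensor_modules_P)
  interpret Pm: left_module env "P m" by (rule P_module)
  have T_carrier: "carrier (?T n) = {?C n g | g. Poly_Mapping.keys g \<subseteq> carrier A \<times> carrier (P n)}" for n
    by (auto simp: tensor_def FactGroup_def RCOSETS_def tensor_class_def)
  have T_one: "\<one>\<^bsub>?T n\<^esub> = tensor_kernel env envR (P n)" for n
    by (simp add: tensor_def FactGroup_def)
  let ?h = "\<lambda>n (a, y). frag_of (a, \<delta> n y)"
  define z where "z = ?C (Suc m) (frag_of (\<one>, y (Suc m)))"
  have zc: "z \<in> carrier (?T (Suc m))"
    unfolding T_carrier z_def using y(1)[of "Suc m"] by (intro CollectI exI[of _ "frag_of (\<one>, y (Suc m))"]) simp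
  \<comment> \<open>Moving the periodic element across the tensor sign turns 1 \<otimes> \<delta> y
    into a tensor whose first factor is the periodic element applied to 1. As \<open>m\<close> is
    even this element is the commutator, and the factor is x - x = 0.\<close>
  have cycle: "frag_of (\<one>, \<delta> m (y (Suc m))) \<in> T0.TK"
  proof -
    have "lx \<odot>\<^bsub>envR\<^esub> \<one> = x" "rx \<odot>\<^bsub>envR\<^esub> \<one> = x" using x_closed by (simp_all add: envR.smult_cls_of)
    moreover have "commutator_elem \<odot>\<^bsub>envR\<^esub> \<one> = lx \<odot>\<^bsub>envR\<^esub> \<one> \<ominus>\<^bsub>envR\<^esub> rx \<odot>\<^bsub>envR\<^esub> \<one>"
      unfolding commutator_elem_def using x_closed
      by (subst cls_diff) (simp_all add: frag_of_closed envR.smult_cls_diff)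
    moreover have "x \<ominus>\<^bsub>envR\<^esub> x = \<zero>\<^bsub>envR\<^esub>"
    proof -
      interpret R: abelian_group envR by (rule env_module_abelian_group)
      show ?thesis using x_closed by (simp only: R.minus_eq) (rule R.r_neg, simp)
    qed
    ultimately have "periodic_elem m \<odot>\<^bsub>envR\<^esub> \<one> = \<zero>" using assms by (simp add: periodic_elem_def)
    moreover have "frag_of (periodic_elem m \<odot>\<^bsub>envR\<^esub> \<one>, y m) - frag_of (\<one>, periodic_elem m \<odot>\<^bsub>P m\<^esub> y m) \<in> tensor_relations env envR (P m)"
      using periodic_closed[of m] y(1)[of m] by (auto simp: tensor_relations_def)
    ultimately have 1: "frag_of (\<zero>, y m) - frag_of (\<one>, \<delta> m (y (Suc m))) \<in> T0.TK"
      by (simp add: T0.kernel_relation y(3))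
    have "frag_of (\<zero> \<oplus> \<zero>, y m) - frag_of (\<zero>, y m) - frag_of (\<zero>, y m) \<in> T0.TK"
      by (rule T0.kernel_relation, unfold tensor_relations_def, intro UnI1 CollectI exI[of _ \<zero>] exI[of _ "y m"]) (simp add: y(1))
    then have "- frag_of (\<zero>, y m) \<in> T0.TK" by simp
    from T0.kernel_uminus[OF T0.kernel_add[OF this 1]] show ?thesis by simp
  qed
  have map_z: "tensor_map env envR (P m) (\<delta> m) z = \<one>\<^bsub>?T m\<^esub>"
  proof -
    have "?C m (frag_extend (?h m) g) = T0.TK" if g: "g \<in> z" for g
    proof -
      obtain t where t: "t \<in> T.TK" "g = t + frag_of (\<one>, y (Suc m))" using g by (auto simp: z_def T.class_eq)
      have "frag_extend (?h m) g \<in> T0.TK"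
        using T0.kernel_add[OF tensor_kernel_map[OF t(1)] cycle] by (simp add: t(2) frag_extend_add)
      then have "?C m (frag_extend (?h m) g) = ?C m 0" by (intro T0.class_eqI) simp
      then show ?thesis by (simp add: T0.class_eq)
    qed
    moreover have "z \<noteq> {}" using T.class_self[of "frag_of (\<one>, y (Suc m))"] by (auto simp: z_def)
    ultimately show ?thesis unfolding tensor_map_def T_one by (intro SUP_eq_const)
  qed
  let ?Bd = "tensor_map env envR (P (Suc m)) (\<delta> (Suc m)) ` carrier (?T (Suc (Suc m)))"
  let ?Z = "kernel (?T (Suc m)) (?T m) (tensor_map env envR (P m) (\<delta> m))"
  have zZ: "z \<in> ?Z" using zc map_z by (simp add: kernel_def)
  have H: "tensor_homology env envR P \<delta> (Suc m) = (?T (Suc m))\<lparr>carrier := ?Z\<rparr> Mod ?Bd"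
    by (simp add: tensor_homology_def Let_def)
  have "?Bd #>\<^bsub>(?T (Suc m))\<lparr>carrier := ?Z\<rparr>\<^esub> z \<in> carrier ((?T (Suc m))\<lparr>carrier := ?Z\<rparr> Mod ?Bd)"
    using zZ by (auto simp: FactGroup_def RCOSETS_def)
  then have eq: "?Bd #>\<^bsub>(?T (Suc m))\<lparr>carrier := ?Z\<rparr>\<^esub> z = ?Bd"
    using triv unfolding H trivial_group_def by (simp add: FactGroup_def)
  \<comment> \<open>In the trivial quotient the coset of \<open>z\<close> equals \<open>?Bd\<close>.
    Since \<open>?Bd\<close> contains the neutral class, that coset contains \<open>z\<close>
    itself, and so \<open>z\<close> is a boundary.\<close>
  have one_Bd: "T.TK \<in> ?Bd"
  proof
    have zero: "?C n 0 = tensor_kernel env envR (P n)" for n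
      using tensor_modules.class_eq[OF tensor_modules_P, of n 0] by simp
    have "?C (Suc m) (frag_extend (?h (Suc m)) g) = T.TK" if "g \<in> T2.TK" for g
    proof -
      have "frag_extend (?h (Suc m)) g \<in> T.TK" by (rule tensor_kernel_map[OF that])
      then have "?C (Suc m) (frag_extend (?h (Suc m)) g) = ?C (Suc m) 0" by (intro T.class_eqI) simp
      then show ?thesis by (simp add: zero)
    qed
    then show "T.TK = tensor_map env envR (P (Suc m)) (\<delta> (Suc m)) T2.TK"
      unfolding tensor_map_def using T2.kernel_zero by (intro SUP_eq_const[symmetric]) auto
    show "T2.TK \<in> carrier (?T (Suc (Suc m)))"
      unfolding T_carrier zero[symmetric] by (intro CollectI exI[of _ 0]) simp
  qed
  have "\<one>\<^bsub>?T (Suc m)\<^esub> \<otimes>\<^bsub>?T (Suc m)\<^esub> z = z"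
  proof -
    have comm: "comm_group T.FG" by (rule abelian_free_Abelian_group)
    have "group (T.FG Mod T.TK)"
      using comm_group.abelian_FactGroup[OF comm T.kernel_subgroup] by (rule comm_group.axioms(2))
    then have "group (?T (Suc m))" by (simp add: tensor_def)
    then show ?thesis using zc by (simp add: group.is_monoid monoid.l_one)
  qed
  then have "T.TK \<otimes>\<^bsub>?T (Suc m)\<^esub> z = z" by (simp only: T_one)
  moreover have "T.TK \<otimes>\<^bsub>?T (Suc m)\<^esub> z \<in> ?Bd #>\<^bsub>(?T (Suc m))\<lparr>carrier := ?Z\<rparr>\<^esub> z"
    unfolding r_coset_def by (rule UN_I[OF one_Bd]) simp
  ultimately have "z \<in> ?Bd" by (simp only: eq)
  then obtain W where W: "W \<in> carrier (?T (Suc (Suc m)))" "z = tensor_map env envR (P (Suc m)) (\<delta> (Suc m)) W" by blast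
  have "frag_of (\<one>, y (Suc m)) \<in> z" unfolding z_def by (rule T.class_self)
  then obtain g where g: "g \<in> W" "frag_of (\<one>, y (Suc m)) \<in> ?C (Suc m) (frag_extend (?h (Suc m)) g)"
    using W(2) by (auto simp: tensor_map_def)
  have g_keys: "Poly_Mapping.keys g \<subseteq> carrier A \<times> carrier (P (Suc (Suc m)))"
  proof -
    obtain g0 t where "Poly_Mapping.keys g0 \<subseteq> carrier A \<times> carrier (P (Suc (Suc m)))" "t \<in> T2.TK" "g = t + g0"
      using W(1) g(1) by (auto simp: T_carrier T2.class_eq)
    then show ?thesis using T2.kernel_carrier[of t] keys_add[of t g0] by auto
  qed

  interpret K: abelian_group K
    by (rule ring.is_abelian_group) (rule ring_from_type_algebra)
  have K_eval_cong: "frag_eval K h1 t = frag_eval K h2 t" if "\<And>q. q \<in> Poly_Mapping.keys t \<Longrightarrow> h1 q = h2 q" for h1 h2 and t :: "'z \<Rightarrow>\<^sub>0 int"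
    unfolding frag_eval_def using that by (intro K.finsum_cong') auto
  \<comment> \<open>\<open>\<sigma>\<close> is \<open>\<eta>\<close> on both tensor factors. After
    passing to constant terms, the right action on \<open>A\<close> and the left action on
    \<open>trunc d\<close> are both multiplication by \<open>\<sigma> t\<close>, which makes
    \<open>?\<psi>\<close> balanced.\<close>
  define \<sigma> where "\<sigma> = (\<lambda>t. frag_eval K (\<lambda>(a, b). \<eta> a * \<eta> b) t)"
  have \<sigma>_scale: "\<sigma> t * c = frag_eval K (\<lambda>z. (case z of (a, b) \<Rightarrow> \<eta> a * \<eta> b) * c) t" for t c
    unfolding \<sigma>_def
    by (rule hom_frag_eval[where \<phi> = "\<lambda>u. u * c", OF K.abelian_group_axioms K.abelian_group_axioms _ _ subset_refl])
      (auto simp: distrib_right)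
  have right: "\<eta> (cls t \<odot>\<^bsub>envR\<^esub> a) = \<sigma> t * \<eta> a" if t: "t \<in> carrier frag_ring" and a: "a \<in> carrier A" for t a
  proof -
    have t': "Poly_Mapping.keys t \<subseteq> AA" using t by (simp add: frag_ring_simps)
    have a': "a \<in> carrier envR" using a by simp
    have "\<eta> (cls t \<odot>\<^bsub>envR\<^esub> a) = \<eta> (frag_eval envR (\<lambda>(b, b'). b' \<otimes> a \<otimes> b) t)"
      by (simp only: envR.smult_cls[OF t a'])
    also have "\<dots> = frag_eval K (\<lambda>z. \<eta> (case z of (b, b') \<Rightarrow> b' \<otimes> a \<otimes> b)) t"
      by (rule hom_frag_eval[where \<phi> = \<eta>, OF env_module_abelian_group(2) K.abelian_group_axioms _ _ t' envR.act_fun[OF a']])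
        (auto simp: p_add)
    also have "\<dots> = \<sigma> t * \<eta> a"
      unfolding \<sigma>_scale using t' a by (intro K_eval_cong) (auto simp: \<eta>_mult)
    finally show ?thesis .
  qed
  have left: "(cls t \<odot>\<^bsub>trunc d\<^esub> q) $ 0 = \<sigma> t * q $ 0" if t: "t \<in> carrier frag_ring" and q: "q \<in> carrier (trunc d)" for t q
  proof -
    have t': "Poly_Mapping.keys t \<subseteq> AA" using t by (simp add: frag_ring_simps)
    have "(cls t \<odot>\<^bsub>trunc d\<^esub> q) $ 0 = frag_eval (trunc d) (\<lambda>(a, b). trunc_act d a b q) t $ 0"
      by (simp only: trunc.smult_cls[OF t q])
    also have "\<dots> = frag_eval K (\<lambda>z. (case z of (a, b) \<Rightarrow> trunc_act d a b q) $ 0) t"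
      by (rule hom_frag_eval[where \<phi> = "\<lambda>F. fps_nth F 0", OF trunc_abelian_group K.abelian_group_axioms _ _ t' trunc.act_fun[OF q]])
        auto
    also have "\<dots> = \<sigma> t * q $ 0"
      unfolding \<sigma>_scale using d2 by (intro K_eval_cong) (auto simp: trunc_act_def)
    finally show ?thesis .
  qed
  let ?\<psi> = "\<lambda>(a, u). \<eta> a * fps_nth (f (Suc m) u) 0"
  have "frag_eval K ?\<psi> (frag_of (\<one>, y (Suc m))) = frag_eval K ?\<psi> (frag_extend (?h (Suc m)) g)"
  proof (rule T.frag_eval_class[OF K.abelian_group_axioms _ _ _ _ _ g(2)])
    show "Poly_Mapping.keys (frag_extend (?h (Suc m)) g) \<subseteq> carrier envR \<times> carrier (P (Suc m))"
      using keys_frag_extend[of "?h (Suc m)" g] g_keys module_hom_closed[OF \<delta>_hom, of _ "Suc m"] by fastforce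
  next
    fix r a u assume r: "r \<in> carrier env" and a: "a \<in> carrier envR" and u: "u \<in> carrier (P (Suc m))"
    obtain t where t: "t \<in> carrier frag_ring" "r = cls t" using r by (elim env_cases)
    have "fps_nth (f (Suc m) (r \<odot>\<^bsub>P (Suc m)\<^esub> u)) 0 = \<sigma> t * fps_nth (f (Suc m) u) 0"
      unfolding module_hom_smult[OF f(1) r u] unfolding t(2) by (rule left[OF t(1) module_hom_closed[OF f(1) u]])
    moreover have "\<eta> (r \<odot>\<^bsub>envR\<^esub> a) = \<sigma> t * \<eta> a" unfolding t(2) by (rule right[OF t(1)]) (use a in simp)
    ultimately show "?\<psi> (r \<odot>\<^bsub>envR\<^esub> a, u) = ?\<psi> (a, r \<odot>\<^bsub>P (Suc m)\<^esub> u)" by simp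
  qed (auto simp: p_add distrib_right distrib_left module_hom_add[OF f(1)])
  \<comment> \<open>The comparison map sends a boundary to a \<open>shift\<close>, and a
    \<open>shift\<close> has constant term 0.\<close>
  also have "\<dots> = 0"
    using g_keys
  proof (induction g rule: frag_diff_induct)
    case (of q)
    then obtain a u where "q = (a, u)" "u \<in> carrier (P (Suc (Suc m)))" by auto
    moreover from this(2) have "fps_nth (f (Suc m) (\<delta> (Suc m) u)) 0 = 0"
      by (simp only: f(3)[symmetric] shift_const)
    ultimately show ?case by simp
  next
    case (diff s t)
    have "?\<psi> \<in> UNIV \<rightarrow> carrier K" by simp
    from K.frag_eval_diff[OF subset_UNIV subset_UNIV this]
    have "frag_eval K ?\<psi> (frag_extend (?h (Suc m)) (s - t)) = 0 \<ominus>\<^bsub>K\<^esub> 0"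
      using diff by (simp add: frag_extend_diff)
    moreover have "0 \<ominus>\<^bsub>K\<^esub> (0 :: 'k) = 0" using K.r_neg[of 0] by (simp add: K.minus_eq)
    ultimately show ?case by (simp only:)
  qed simp
  finally have "\<eta> \<one> * fps_nth (f (Suc m) (y (Suc m))) 0 = 0" by simp
  then show False by (simp add: fy p_one)
qed

end

text \<open>Existence of a resolution ensures that \<open>chosen_resolution\<close> returns one.
  Nothing more is known about it, hence the preceding result for an arbitrary resolution.\<close>

lemma hochschild_homology_nontrivial:
  assumes "even m"
  shows "\<not> trivial_group (hochschild_homology K A (Suc m))"
proof -
  obtain P \<delta> \<epsilon> where "projective_resolution env envL (P :: nat \<Rightarrow> (('a \<times> 'a \<Rightarrow>\<^sub>0 int) set, (('a \<times> 'a \<Rightarrow>\<^sub>0 int) set, 'a) res) module) \<delta> \<epsilon>"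
    by (rule projective_resolution_exists[OF envL.env_left_module])
  then have "\<exists>Pd. case Pd of (P :: nat \<Rightarrow> (('a \<times> 'a \<Rightarrow>\<^sub>0 int) set, (('a \<times> 'a \<Rightarrow>\<^sub>0 int) set, 'a) res) module, \<delta>) \<Rightarrow> \<exists>\<epsilon>. projective_resolution env envL P \<delta> \<epsilon>"
    by auto
  then have "case chosen_resolution env envL of (P, \<delta>) \<Rightarrow> \<exists>\<epsilon>. projective_resolution env envL P \<delta> \<epsilon>"
    unfolding chosen_resolution_def by (rule someI_ex)
  then obtain P \<delta> \<epsilon> where P: "chosen_resolution env envL = (P, \<delta>)" "projective_resolution env envL P \<delta> \<epsilon>"
    by (auto split: prod.splits)
  then have "hochschild_homology K A (Suc m) = tensor_homology env envR P \<delta> (Suc m)"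
    by (simp add: hochschild_homology_def Tor_def)
  then show ?thesis using tensor_homology_nontrivial[OF P(2) assms] by simp
qed

end

theorem theorem5p3:
  fixes C D :: "int ^ 'n ^ 'n" and \<Omega> :: "('n \<times> 'n) set"
    and H :: "('k::field, (('n, 'n gls_arrow) path \<Rightarrow>\<^sub>0 'k) set) module"
  assumes "cartan_triple C D \<Omega>"
    and "H = gls_algebra C D \<Omega>"
    and "\<exists>N. \<forall>n\<ge>N. trivial_group (hochschild_homology (ring_of_type_algebra :: 'k ring) H n)"
  shows "global_dimension TYPE('m) H < \<infinity>"
proof -
  interpret gls C D \<Omega> "TYPE('k)" by unfold_locales (rule assms(1))
  have H: "H = kQ.H" unfolding assms(2) by (rule gls_algebra_eq)
  show ?thesis
  proof (cases "\<forall>i. d i = 1")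
    case True
    then interpret T: triangular_ring kQ.H UNIV "\<lambda>v. kQ.\<phi> (triv v)" "\<lambda>c :: 'k. c \<odot>\<^bsub>kQ.H\<^esub> \<one>\<^bsub>kQ.H\<^esub>" ht
      by (intro triangular) simp
    show ?thesis unfolding H by (rule T.global_dimension_finite)
  next
    case False
    then obtain i where "d i \<noteq> 1" by blast
    with d_pos[of i] have "d i \<ge> 2" by linarith
    then interpret R: truncated_retract kQ.H "kQ.\<phi> (eps i)" "loop_proj i" "d i" by (rule truncated_retract)
    obtain N where N: "\<And>n. n \<ge> N \<Longrightarrow> trivial_group (hochschild_homology (ring_of_type_algebra :: 'k ring) H n)"
      using assms(3) by blast
    \<comment> \<open>An odd degree beyond the bound \<open>N\<close>.\<close>
    have "trivial_group (hochschild_homology (ring_of_type_algebra :: 'k ring) kQ.H (Suc (2 * N)))"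
      using N[of "Suc (2 * N)"] by (simp add: H)
    moreover have "even (2 * N)" by simp
    ultimately show ?thesis using R.hochschild_homology_nontrivial by blast
  qed
qed

end
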